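(* Let $C$ be an infinite dimensional colocal coalgebra over a field $K$ which is left finite Rat-splitting. Then $C$ is a chain coalgebra.
   Context: $C$ is a coalgebra over a field $K$ with comultiplication $\Delta(c)=c_1\otimes c_2$ and counit $\varepsilon$; $C^*=\mathrm{Hom}_K(C,K)$ is the dual algebra with convolution product $(fg)(c)=f(c_1)g(c_2)$. Right $C$-comodules are regarded as left $C^*$-modules via $f\cdot m=f(m_1)m_0$; left $C^*$-modules arising this way are called rational. For a left $C^*$-module $M$, $\mathrm{Rat}(M)$ is the sum of all rational submodules of $M$; equivalently $m\in\mathrm{Rat}(M)$ iff there are finitely many $m_i\in M$, $c_i\in C$ with $f\cdot m=\sum_i f(c_i)m_i$ for all $f\in C^*$. $C$ is left finite Rat-splitting if $\mathrm{Rat}(M)$ is a direct summand of $M$ for every finitely generated left $C^*$-module $M$. $C$ is colocal if its coradical $C_0$ (the sum of all simple subcomodules of $C$) is a simple left (and consequently simple right) $C$-comodule. $C$ is a chain coalgebra if any two left subcomodules of $C$ are comparable under inclusion (this is equivalent to the same condition for right subcomodules). *)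

theory Defs
  imports
    "HOL-Library.Poly_Mapping"
    "HOL-Algebra.Module"
    "HOL-Algebra.AbelCoset"
    "HOL-Algebra.Algebraic_Closure_Type"
begin

section \<open>Tensor products of vector spaces\<close>

text \<open>
  The base field is a type \<open>'k :: field\<close>.  A vector space whose carrier is a subset of a type
  is a HOL-Algebra module record over \<^term>\<open>ring_of_type_algebra\<close>, the field \<open>'k\<close> seen as a
  HOL-Algebra ring.  A vector space whose carrier is a whole type is given by its scalar
  multiplication; \<open>space_of\<close> turns it into a record (the ring multiplication and unit of such a
  record carry no meaning).

  The tensor product is the free vector space on tuples (finitely supported functions) modulo
  the subspace spanned by the multilinearity relations.  Its elements are written as lists:
  the list \<open>[(a1, b1), \<dots>, (an, bn)]\<close> stands for the class of the sum of the \<open>ai \<otimes> bi\<close>.  Two lists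
  are the same tensor iff they are related by \<open>tensor2_eq\<close> (for triples \<open>tensor3_eq\<close>), so a
  map into a tensor product is a list-valued function, and the laws it has to satisfy are
  stated up to this relation.
\<close>

definition space_of :: "('k::field \<Rightarrow> 'v::ab_group_add \<Rightarrow> 'v) \<Rightarrow> ('k, 'v) module" where
  "space_of scale = \<lparr>carrier = UNIV, monoid.mult = undefined, one = undefined,
     ring.zero = 0, add = (+), module.smult = scale\<rparr>"

definition free_scale :: "'k::field \<Rightarrow> ('t \<Rightarrow>\<^sub>0 'k) \<Rightarrow> ('t \<Rightarrow>\<^sub>0 'k)" where
  "free_scale k p = Poly_Mapping.map ((*) k) p"

definition formal_sum :: "'t list \<Rightarrow> ('t \<Rightarrow>\<^sub>0 'k::field)" where
  "formal_sum ts = (\<Sum>t\<leftarrow>ts. Poly_Mapping.single t 1)"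

text \<open>The relations saying that the class of the tuple \<open>F v\<close> depends linearly on \<open>v\<close>;
  \<open>F\<close> inserts \<open>v\<close> into one slot of a tuple.\<close>

definition slot_relations :: "('k::field, 'v) module \<Rightarrow> ('v \<Rightarrow> 't) \<Rightarrow> ('t \<Rightarrow>\<^sub>0 'k) set" where
  "slot_relations V F =
     {Poly_Mapping.single (F (v \<oplus>\<^bsub>V\<^esub> w)) 1 - Poly_Mapping.single (F v) 1 - Poly_Mapping.single (F w) 1 | v w.
        v \<in> carrier V \<and> w \<in> carrier V} \<union>
     {Poly_Mapping.single (F (k \<odot>\<^bsub>V\<^esub> v)) 1 - free_scale k (Poly_Mapping.single (F v) 1) | k v.
        v \<in> carrier V}"

definition tensor2_relations ::
  "('k::field, 'u) module \<Rightarrow> ('k, 'v) module \<Rightarrow> ('u \<times> 'v \<Rightarrow>\<^sub>0 'k) set" where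
  "tensor2_relations U V =
     (\<Union>v\<in>carrier V. slot_relations U (\<lambda>u. (u, v))) \<union>
     (\<Union>u\<in>carrier U. slot_relations V (\<lambda>v. (u, v)))"

definition tensor3_relations ::
  "('k::field, 'u) module \<Rightarrow> ('k, 'v) module \<Rightarrow> ('k, 'w) module \<Rightarrow> ('u \<times> 'v \<times> 'w \<Rightarrow>\<^sub>0 'k) set" where
  "tensor3_relations U V W =
     (\<Union>v\<in>carrier V. \<Union>w\<in>carrier W. slot_relations U (\<lambda>u. (u, v, w))) \<union>
     (\<Union>u\<in>carrier U. \<Union>w\<in>carrier W. slot_relations V (\<lambda>v. (u, v, w))) \<union>
     (\<Union>u\<in>carrier U. \<Union>v\<in>carrier V. slot_relations W (\<lambda>w. (u, v, w)))"

definition tensor2_eq ::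
  "('k::field, 'u) module \<Rightarrow> ('k, 'v) module \<Rightarrow> ('u \<times> 'v) list \<Rightarrow> ('u \<times> 'v) list \<Rightarrow> bool" where
  "tensor2_eq U V xs ys \<longleftrightarrow>
     formal_sum xs - formal_sum ys \<in> Modules.module.span free_scale (tensor2_relations U V)"

definition tensor3_eq ::
  "('k::field, 'u) module \<Rightarrow> ('k, 'v) module \<Rightarrow> ('k, 'w) module \<Rightarrow>
   ('u \<times> 'v \<times> 'w) list \<Rightarrow> ('u \<times> 'v \<times> 'w) list \<Rightarrow> bool" where
  "tensor3_eq U V W xs ys \<longleftrightarrow>
     formal_sum xs - formal_sum ys \<in> Modules.module.span free_scale (tensor3_relations U V W)"


section \<open>Modules over a not necessarily commutative ring\<close>

text \<open>The locale \<open>module\<close> of HOL-Algebra with \<open>cring\<close> relaxed to \<open>ring\<close>.\<close>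

locale left_module = R?: ring R + M?: abelian_group M
  for R :: "('r, 'y) ring_scheme" (structure)
    and M :: "('r, 'm, 'x) module_scheme" (structure) +
  assumes smult_closed [simp, intro]:
      "\<lbrakk>a \<in> carrier R; x \<in> carrier M\<rbrakk> \<Longrightarrow> a \<odot>\<^bsub>M\<^esub> x \<in> carrier M"
    and smult_l_distr:
      "\<lbrakk>a \<in> carrier R; b \<in> carrier R; x \<in> carrier M\<rbrakk> \<Longrightarrow>
       (a \<oplus>\<^bsub>R\<^esub> b) \<odot>\<^bsub>M\<^esub> x = a \<odot>\<^bsub>M\<^esub> x \<oplus>\<^bsub>M\<^esub> b \<odot>\<^bsub>M\<^esub> x"
    and smult_r_distr:
      "\<lbrakk>a \<in> carrier R; x \<in> carrier M; y \<in> carrier M\<rbrakk> \<Longrightarrow>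
       a \<odot>\<^bsub>M\<^esub> (x \<oplus>\<^bsub>M\<^esub> y) = a \<odot>\<^bsub>M\<^esub> x \<oplus>\<^bsub>M\<^esub> a \<odot>\<^bsub>M\<^esub> y"
    and smult_assoc1:
      "\<lbrakk>a \<in> carrier R; b \<in> carrier R; x \<in> carrier M\<rbrakk> \<Longrightarrow>
       (a \<otimes>\<^bsub>R\<^esub> b) \<odot>\<^bsub>M\<^esub> x = a \<odot>\<^bsub>M\<^esub> (b \<odot>\<^bsub>M\<^esub> x)"
    and smult_one [simp]:
      "x \<in> carrier M \<Longrightarrow> \<one>\<^bsub>R\<^esub> \<odot>\<^bsub>M\<^esub> x = x"

lemma (in left_module) smult_l_null: "x \<in> carrier M \<Longrightarrow> \<zero>\<^bsub>R\<^esub> \<odot>\<^bsub>M\<^esub> x = \<zero>\<^bsub>M\<^esub>"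
  using smult_l_distr[OF R.zero_closed R.zero_closed, of x]
  by (metis M.add.r_cancel_one' R.zero_closed R.l_zero smult_closed)

lemma (in left_module) smult_r_null: "a \<in> carrier R \<Longrightarrow> a \<odot>\<^bsub>M\<^esub> \<zero>\<^bsub>M\<^esub> = \<zero>\<^bsub>M\<^esub>"
  using smult_r_distr[OF _ M.zero_closed M.zero_closed, of a]
  by (metis M.add.r_cancel_one' M.zero_closed M.l_zero smult_closed)

lemma (in left_module) minus_eq_smult:
  assumes "x \<in> carrier M"
  shows "\<ominus>\<^bsub>M\<^esub> x = (\<ominus>\<^bsub>R\<^esub> \<one>\<^bsub>R\<^esub>) \<odot>\<^bsub>M\<^esub> x"
proof -
  have "(\<ominus>\<^bsub>R\<^esub> \<one>\<^bsub>R\<^esub>) \<odot>\<^bsub>M\<^esub> x \<oplus>\<^bsub>M\<^esub> \<one>\<^bsub>R\<^esub> \<odot>\<^bsub>M\<^esub> x = (\<ominus>\<^bsub>R\<^esub> \<one>\<^bsub>R\<^esub> \<oplus>\<^bsub>R\<^esub> \<one>\<^bsub>R\<^esub>) \<odot>\<^bsub>M\<^esub> x"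
    using assms by (simp add: smult_l_distr)
  also have "\<dots> = \<zero>\<^bsub>M\<^esub>" using assms by (simp add: R.l_neg smult_l_null)
  finally show ?thesis using assms by (simp add: M.minus_equality)
qed

definition list_sum :: "('a, 'x) ring_scheme \<Rightarrow> 'a list \<Rightarrow> 'a" where
  "list_sum M xs = foldr (add M) xs \<zero>\<^bsub>M\<^esub>"

definition finitely_generated :: "('r, 'y) ring_scheme \<Rightarrow> ('r, 'm, 'x) module_scheme \<Rightarrow> bool" where
  "finitely_generated R M \<longleftrightarrow>
     (\<exists>S. finite S \<and> S \<subseteq> carrier M \<and> (\<forall>H. submodule H R M \<and> S \<subseteq> H \<longrightarrow> H = carrier M))"

definition direct_summand ::
  "('r, 'y) ring_scheme \<Rightarrow> ('r, 'm, 'x) module_scheme \<Rightarrow> 'm set \<Rightarrow> bool" where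
  "direct_summand R M A \<longleftrightarrow> submodule A R M \<and>
     (\<exists>B. submodule B R M \<and> A \<inter> B = {\<zero>\<^bsub>M\<^esub>} \<and> A <+>\<^bsub>M\<^esub> B = carrier M)"


section \<open>Coalgebras\<close>

text \<open>In Sweedler notation, the list \<open>\<Delta> c\<close> consists of the pairs \<open>(c\<^sub>1, c\<^sub>2)\<close>.\<close>

locale coalgebra = vector_space scale
  for scale :: "'k::field \<Rightarrow> 'c::ab_group_add \<Rightarrow> 'c" +
  fixes \<Delta> :: "'c \<Rightarrow> ('c \<times> 'c) list"
    and \<epsilon> :: "'c \<Rightarrow> 'k"
  assumes comult_add:
      "tensor2_eq (space_of scale) (space_of scale) (\<Delta> (x + y)) (\<Delta> x @ \<Delta> y)"
    and comult_scale:
      "tensor2_eq (space_of scale) (space_of scale)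
         (\<Delta> (scale k x)) [(scale k a, b). (a, b) \<leftarrow> \<Delta> x]"
    and coassoc:
      "tensor3_eq (space_of scale) (space_of scale) (space_of scale)
         [(a1, a2, b). (a, b) \<leftarrow> \<Delta> x, (a1, a2) \<leftarrow> \<Delta> a]
         [(a, b1, b2). (a, b) \<leftarrow> \<Delta> x, (b1, b2) \<leftarrow> \<Delta> b]"
    and counit_linear: "Vector_Spaces.linear scale (*) \<epsilon>"
    and counit_left: "(\<Sum>(a, b)\<leftarrow>\<Delta> x. scale (\<epsilon> a) b) = x"
    and counit_right: "(\<Sum>(a, b)\<leftarrow>\<Delta> x. scale (\<epsilon> b) a) = x"
begin

definition infinite_dimensional :: bool where
  "infinite_dimensional \<longleftrightarrow> \<not> (\<exists>B. finite B \<and> span B = UNIV)"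

text \<open>A subspace \<open>Y\<close> with \<open>\<Delta> Y \<subseteq> C \<otimes> Y\<close>.\<close>

definition left_subcomodule :: "'c set \<Rightarrow> bool" where
  "left_subcomodule Y \<longleftrightarrow> subspace Y \<and>
     (\<forall>x\<in>Y. \<exists>t. set t \<subseteq> UNIV \<times> Y \<and> tensor2_eq (space_of scale) (space_of scale) (\<Delta> x) t)"

definition simple_left_subcomodule :: "'c set \<Rightarrow> bool" where
  "simple_left_subcomodule Y \<longleftrightarrow> left_subcomodule Y \<and> Y \<noteq> {0} \<and>
     (\<forall>Z. left_subcomodule Z \<and> Z \<subseteq> Y \<longrightarrow> Z = {0} \<or> Z = Y)"

text \<open>The simple right subcomodules, or the simple subcoalgebras, have the same sum.\<close>

definition coradical :: "'c set" where
  "coradical = span (\<Union>{Y. simple_left_subcomodule Y})"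

definition colocal :: bool where
  "colocal \<longleftrightarrow> simple_left_subcomodule coradical"

definition chain_coalgebra :: bool where
  "chain_coalgebra \<longleftrightarrow>
     (\<forall>Y Z. left_subcomodule Y \<and> left_subcomodule Z \<longrightarrow> Y \<subseteq> Z \<or> Z \<subseteq> Y)"

definition dual_algebra :: "('c \<Rightarrow> 'k) ring" where
  "dual_algebra = \<lparr>carrier = {f. Vector_Spaces.linear scale (*) f},
     monoid.mult = (\<lambda>f g c. \<Sum>(a, b)\<leftarrow>\<Delta> c. f a * g b), one = \<epsilon>,
     ring.zero = (\<lambda>_. 0), add = (\<lambda>f g c. f c + g c)\<rparr>"

definition right_comodule :: "('k, 'm) module \<Rightarrow> ('m \<Rightarrow> ('m \<times> 'c) list) \<Rightarrow> bool" where
  "right_comodule V \<rho> \<longleftrightarrow>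
     Module.module ring_of_type_algebra V \<and>
     (\<forall>v\<in>carrier V. set (\<rho> v) \<subseteq> carrier V \<times> UNIV) \<and>
     (\<forall>v\<in>carrier V. \<forall>w\<in>carrier V. tensor2_eq V (space_of scale) (\<rho> (v \<oplus>\<^bsub>V\<^esub> w)) (\<rho> v @ \<rho> w)) \<and>
     (\<forall>k. \<forall>v\<in>carrier V. tensor2_eq V (space_of scale)
        (\<rho> (k \<odot>\<^bsub>V\<^esub> v)) [(k \<odot>\<^bsub>V\<^esub> u, c). (u, c) \<leftarrow> \<rho> v]) \<and>
     (\<forall>v\<in>carrier V. tensor3_eq V (space_of scale) (space_of scale)
        [(u0, u1, c). (u, c) \<leftarrow> \<rho> v, (u0, u1) \<leftarrow> \<rho> u]
        [(u, c1, c2). (u, c) \<leftarrow> \<rho> v, (c1, c2) \<leftarrow> \<Delta> c]) \<and>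
     (\<forall>v\<in>carrier V. list_sum V [\<epsilon> c \<odot>\<^bsub>V\<^esub> u. (u, c) \<leftarrow> \<rho> v] = v)"

definition rational :: "('c \<Rightarrow> 'k, 'm) module \<Rightarrow> bool" where
  "rational M \<longleftrightarrow>
     (\<exists>V \<rho>. right_comodule V \<rho> \<and>
        carrier V = carrier M \<and> add V = add M \<and> \<zero>\<^bsub>V\<^esub> = \<zero>\<^bsub>M\<^esub> \<and>
        (\<forall>f\<in>carrier dual_algebra. \<forall>m\<in>carrier M.
           f \<odot>\<^bsub>M\<^esub> m = list_sum V [f c \<odot>\<^bsub>V\<^esub> u. (u, c) \<leftarrow> \<rho> m]))"

definition Rat :: "('c \<Rightarrow> 'k, 'm) module \<Rightarrow> 'm set" where
  "Rat M = {list_sum M xs | xs.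
     set xs \<subseteq> \<Union>{N. submodule N dual_algebra M \<and> rational (M\<lparr>carrier := N\<rparr>)}}"

text \<open>HOL cannot quantify over types inside a formula, so the modules range over all those with
  carrier in one fixed type.  The type chosen is that of the cosets in a finite power of the dual
  algebra; it contains an isomorphic copy of every finitely generated module, see
  \<open>finitely_generated_isomorphic_copy\<close> below.\<close>

definition left_finite_Rat_splitting :: bool where
  "left_finite_Rat_splitting \<longleftrightarrow>
     (\<forall>M :: ('c \<Rightarrow> 'k, (nat \<Rightarrow> 'c \<Rightarrow> 'k) set) module.
        left_module dual_algebra M \<and> finitely_generated dual_algebra M \<longrightarrow>
        direct_summand dual_algebra M (Rat M))"

end

section \<open>The dual algebra is a ring\<close>

lemma lookup_free_scale: "Poly_Mapping.lookup (free_scale k p) t = k * Poly_Mapping.lookup p t"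
  by (simp add: free_scale_def map.rep_eq when_def)

lemma vector_space_free_scale: "vector_space (free_scale :: 'k::field \<Rightarrow> ('t \<Rightarrow>\<^sub>0 'k) \<Rightarrow> _)"
  by standard (auto intro!: poly_mapping_eqI simp: lookup_free_scale lookup_add algebra_simps)

definition eval_free :: "('t \<Rightarrow> 'k::field) \<Rightarrow> ('t \<Rightarrow>\<^sub>0 'k) \<Rightarrow> 'k" where
  "eval_free F p = (\<Sum>t\<in>Poly_Mapping.keys p. Poly_Mapping.lookup p t * F t)"

lemma eval_free_superset:
  assumes "finite A" "Poly_Mapping.keys p \<subseteq> A"
  shows "eval_free F p = (\<Sum>t\<in>A. Poly_Mapping.lookup p t * F t)"
  unfolding eval_free_def using assms
  by (intro sum.mono_neutral_left) (auto simp: in_keys_iff)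

lemma eval_free_add: "eval_free F (p + q) = eval_free F p + eval_free F q"
proof -
  let ?A = "Poly_Mapping.keys p \<union> Poly_Mapping.keys q"
  have "Poly_Mapping.keys (p + q) \<subseteq> ?A" by (rule keys_add)
  then show ?thesis
    by (simp add: eval_free_superset[of ?A] lookup_add algebra_simps sum.distrib)
qed

lemma eval_free_scale: "eval_free F (free_scale k p) = k * eval_free F p"
proof -
  have l: "Poly_Mapping.lookup (free_scale k p) t = k * Poly_Mapping.lookup p t" for t
    by (simp add: free_scale_def map.rep_eq when_def)
  have "Poly_Mapping.keys (free_scale k p) \<subseteq> Poly_Mapping.keys p" by (auto simp: in_keys_iff l)
  then show ?thesis
    by (simp add: eval_free_superset[of "Poly_Mapping.keys p"] l sum_distrib_left mult.assoc)
qed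

lemma eval_free_diff: "eval_free F (p - q) = eval_free F p - eval_free F q"
  using eval_free_add[of F "p - q" q] by simp

lemma eval_free_single: "eval_free F (Poly_Mapping.single t k) = k * F t"
  by (cases "k = 0") (simp_all add: eval_free_def)

lemma eval_free_formal_sum: "eval_free F (formal_sum ts) = (\<Sum>t\<leftarrow>ts. F t)"
proof (induction ts)
  case Nil
  then show ?case by (simp add: formal_sum_def eval_free_def)
next
  case (Cons t ts)
  then show ?case by (simp add: formal_sum_def eval_free_add eval_free_single)
qed

lemma eval_free_span:
  assumes "p \<in> Modules.module.span free_scale R" "\<And>r. r \<in> R \<Longrightarrow> eval_free F r = 0"
  shows "eval_free F p = 0"
proof -
  interpret vector_space "free_scale :: 'b \<Rightarrow> ('a \<Rightarrow>\<^sub>0 'b) \<Rightarrow> _" by (rule vector_space_free_scale)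
  show ?thesis
    using assms(1)
  proof (induction rule: span_induct_alt)
    case base
    then show ?case by (simp add: eval_free_def)
  next
    case (step c x y)
    then show ?case by (simp add: eval_free_add eval_free_scale assms(2))
  qed
qed

lemma eval_slot_relations:
  assumes "r \<in> slot_relations (space_of s) G"
    and "Vector_Spaces.linear s (*) (\<lambda>v. F (G v))"
  shows "eval_free F r = 0"
proof -
  interpret Vector_Spaces.linear s "(*)" "\<lambda>v. F (G v)" by fact
  from assms(1) show ?thesis
    by (auto simp: slot_relations_def space_of_def eval_free_diff eval_free_scale eval_free_single
        add scale)
qed

lemma tensor2_eq_eval:
  assumes "tensor2_eq (space_of s) (space_of s') xs ys"
    and "\<And>v. Vector_Spaces.linear s (*) (\<lambda>u. F (u, v))"
    and "\<And>u. Vector_Spaces.linear s' (*) (\<lambda>v. F (u, v))"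
  shows "(\<Sum>t\<leftarrow>xs. F t) = (\<Sum>t\<leftarrow>ys. F t)"
proof -
  have "eval_free F r = 0" if "r \<in> tensor2_relations (space_of s) (space_of s')" for r
    using that unfolding tensor2_relations_def
    by (elim UnE UN_E) (erule eval_slot_relations[where F = F], rule assms)+
  then have "eval_free F (formal_sum xs - formal_sum ys) = 0"
    using assms(1) unfolding tensor2_eq_def by (rule eval_free_span[rotated])
  then show ?thesis by (simp add: eval_free_diff eval_free_formal_sum)
qed

lemma tensor3_eq_eval:
  assumes "tensor3_eq (space_of s) (space_of s') (space_of s'') xs ys"
    and "\<And>v w. Vector_Spaces.linear s (*) (\<lambda>u. F (u, v, w))"
    and "\<And>u w. Vector_Spaces.linear s' (*) (\<lambda>v. F (u, v, w))"
    and "\<And>u v. Vector_Spaces.linear s'' (*) (\<lambda>w. F (u, v, w))"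
  shows "(\<Sum>t\<leftarrow>xs. F t) = (\<Sum>t\<leftarrow>ys. F t)"
proof -
  have "eval_free F r = 0" if "r \<in> tensor3_relations (space_of s) (space_of s') (space_of s'')" for r
    using that unfolding tensor3_relations_def
    by (elim UnE UN_E) (erule eval_slot_relations[where F = F], rule assms)+
  then have "eval_free F (formal_sum xs - formal_sum ys) = 0"
    using assms(1) unfolding tensor3_eq_def by (rule eval_free_span[rotated])
  then show ?thesis by (simp add: eval_free_diff eval_free_formal_sum)
qed

context coalgebra
begin

lemma linear_iff':
  "Vector_Spaces.linear scale (*) f \<longleftrightarrow>
     (\<forall>x y. f (x + y) = f x + f y) \<and> (\<forall>k x. f (scale k x) = k * f x)"
proof -
  have "vector_space ((*) :: 'k \<Rightarrow> 'k \<Rightarrow> 'k)" by standard (auto simp: algebra_simps)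
  then show ?thesis
    by (auto simp: Vector_Spaces.linear_iff vector_space_axioms)
qed

lemma convolution_linear:
  assumes "Vector_Spaces.linear scale (*) f" "Vector_Spaces.linear scale (*) g"
  shows "Vector_Spaces.linear scale (*) (\<lambda>c. \<Sum>(a, b)\<leftarrow>\<Delta> c. f a * g b)"
proof -
  let ?F = "\<lambda>(a, b). f a * g b"
  have lin: "Vector_Spaces.linear scale (*) (\<lambda>u. ?F (u, v))"
    "Vector_Spaces.linear scale (*) (\<lambda>v. ?F (u, v))" for u v
    using assms by (auto simp: linear_iff' algebra_simps)
  have "(\<Sum>t\<leftarrow>\<Delta> (x + y). ?F t) = (\<Sum>t\<leftarrow>\<Delta> x. ?F t) + (\<Sum>t\<leftarrow>\<Delta> y. ?F t)" for x y
    using tensor2_eq_eval[OF comult_add lin, of x y] by simp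
  moreover have "(\<Sum>t\<leftarrow>\<Delta> (scale k x). ?F t) = k * (\<Sum>t\<leftarrow>\<Delta> x. ?F t)" for k x
  proof -
    have "(\<Sum>t\<leftarrow>\<Delta> (scale k x). ?F t) = (\<Sum>t\<leftarrow>[(scale k a, b). (a, b) \<leftarrow> \<Delta> x]. ?F t)"
      by (rule tensor2_eq_eval[OF comult_scale lin])
    also have "\<dots> = (\<Sum>t\<leftarrow>\<Delta> x. k * ?F t)"
      using assms(1)
      by (auto simp: linear_iff' o_def split_def mult.assoc intro!: arg_cong[where f = sum_list])
    finally show ?thesis by (simp add: sum_list_const_mult)
  qed
  ultimately show ?thesis by (simp add: linear_iff')
qed

lemma convolution_assoc:
  assumes "Vector_Spaces.linear scale (*) f" "Vector_Spaces.linear scale (*) g"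
    "Vector_Spaces.linear scale (*) h"
  shows "(\<Sum>(a, b)\<leftarrow>\<Delta> c. (\<Sum>(a1, a2)\<leftarrow>\<Delta> a. f a1 * g a2) * h b) =
         (\<Sum>(a, b)\<leftarrow>\<Delta> c. f a * (\<Sum>(b1, b2)\<leftarrow>\<Delta> b. g b1 * h b2))"
proof -
  let ?F = "\<lambda>(a, b, c). f a * g b * h c"
  have *: "(\<Sum>t\<leftarrow>[(a1, a2, b). (a, b) \<leftarrow> \<Delta> c, (a1, a2) \<leftarrow> \<Delta> a]. ?F t) =
        (\<Sum>t\<leftarrow>[(a, b1, b2). (a, b) \<leftarrow> \<Delta> c, (b1, b2) \<leftarrow> \<Delta> b]. ?F t)"
    by (rule tensor3_eq_eval[OF coassoc]) (use assms in \<open>auto simp: linear_iff' algebra_simps\<close>)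
  have l: "(\<Sum>t\<leftarrow>[(a1, a2, b). (a, b) \<leftarrow> xs, (a1, a2) \<leftarrow> \<Delta> a]. ?F t) =
        (\<Sum>(a, b)\<leftarrow>xs. (\<Sum>(a1, a2)\<leftarrow>\<Delta> a. f a1 * g a2) * h b)" for xs
    by (induction xs) (auto simp: o_def split_def sum_list_mult_const)
  have r: "(\<Sum>t\<leftarrow>[(a, b1, b2). (a, b) \<leftarrow> xs, (b1, b2) \<leftarrow> \<Delta> b]. ?F t) =
        (\<Sum>(a, b)\<leftarrow>xs. f a * (\<Sum>(b1, b2)\<leftarrow>\<Delta> b. g b1 * h b2))" for xs
    by (induction xs) (auto simp: o_def split_def sum_list_const_mult mult.assoc)
  show ?thesis using * unfolding l r .
qed

lemma linear_sum_list:
  assumes "Vector_Spaces.linear scale (*) f"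
  shows "f (\<Sum>x\<leftarrow>xs. F x) = (\<Sum>x\<leftarrow>xs. f (F x))"
proof -
  have "f 0 = 0" using assms by (metis linear_iff' mult_zero_left scale_zero_left)
  then show ?thesis using assms by (induction xs) (auto simp: linear_iff')
qed

theorem ring_dual_algebra: "ring dual_algebra"
proof -
  have l: "(\<Sum>(a, b)\<leftarrow>\<Delta> c. \<epsilon> a * f b) = f c" "(\<Sum>(a, b)\<leftarrow>\<Delta> c. f a * \<epsilon> b) = f c"
    if "Vector_Spaces.linear scale (*) f" for f c
    using linear_sum_list[OF that, of "\<lambda>(a, b). scale (\<epsilon> a) b" "\<Delta> c"]
      linear_sum_list[OF that, of "\<lambda>(a, b). scale (\<epsilon> b) a" "\<Delta> c"] that
    unfolding counit_left counit_right by (auto simp: linear_iff' split_def mult.commute)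
  have "\<exists>g. Vector_Spaces.linear scale (*) g \<and> (\<lambda>c. g c + f c) = (\<lambda>_. 0) \<and> (\<lambda>c. f c + g c) = (\<lambda>_. 0)"
    if "Vector_Spaces.linear scale (*) f" for f
    using that by (intro exI[of _ "\<lambda>c. - f c"]) (auto simp: linear_iff')
  then have "abelian_group dual_algebra"
    by (intro abelian_groupI) (auto simp: dual_algebra_def linear_iff' algebra_simps)
  moreover have "monoid dual_algebra"
    using counit_linear l convolution_assoc
    by (intro monoidI) (auto simp: dual_algebra_def convolution_linear intro!: ext)
  ultimately show ?thesis
    by (intro ring.intro ring_axioms.intro)
      (auto simp: dual_algebra_def split_def algebra_simps sum_list_addf)
qed

end


section \<open>Every finitely generated module has a copy in the chosen type\<close>

theorem (in coalgebra) finitely_generated_isomorphic_copy: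
  fixes M :: "('c \<Rightarrow> 'k, 'm) module"
  assumes "left_module dual_algebra M" "finitely_generated dual_algebra M"
  obtains M' :: "('c \<Rightarrow> 'k, (nat \<Rightarrow> 'c \<Rightarrow> 'k) set) module" and h
  where "left_module dual_algebra M'" "bij_betw h (carrier M) (carrier M')"
    "\<And>x y. x \<in> carrier M \<Longrightarrow> y \<in> carrier M \<Longrightarrow> h (x \<oplus>\<^bsub>M\<^esub> y) = h x \<oplus>\<^bsub>M'\<^esub> h y"
    "\<And>f x. f \<in> carrier dual_algebra \<Longrightarrow> x \<in> carrier M \<Longrightarrow> h (f \<odot>\<^bsub>M\<^esub> x) = f \<odot>\<^bsub>M'\<^esub> h x"
proof -
  interpret left_module dual_algebra M by fact
  note finitely = assms(2)
  obtain S where S: "finite S" "S \<subseteq> carrier M"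
    "\<And>H. submodule H dual_algebra M \<Longrightarrow> S \<subseteq> H \<Longrightarrow> H = carrier M"
    using finitely unfolding finitely_generated_def by blast
  obtain s and n :: nat where s: "bij_betw s {..<n} S"
    using ex_bij_betw_nat_finite[OF S(1)] by (auto simp: atLeast0LessThan)
  then have sS: "s i \<in> S" "s i \<in> carrier M" if "i < n" for i
    using that S(2) by (auto simp: bij_betw_def)
  define comb where "comb = (\<lambda>x. \<Oplus>\<^bsub>M\<^esub>i\<in>{..<n}. x i \<odot>\<^bsub>M\<^esub> s i)"
  define P where "P = {x :: nat \<Rightarrow> 'c \<Rightarrow> 'k. \<forall>i. x i \<in> carrier dual_algebra}"
  have tc: "x i \<odot>\<^bsub>M\<^esub> s i \<in> carrier M" if "x \<in> P" "i < n" for x i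
    using that sS by (auto simp: P_def)
  have comb_closed: "comb x \<in> carrier M" if "x \<in> P" for x
    unfolding comb_def using tc that by (intro M.finsum_closed) auto
  have comb_add: "comb x \<oplus>\<^bsub>M\<^esub> comb y = comb (\<lambda>i. x i \<oplus>\<^bsub>dual_algebra\<^esub> y i)" if "x \<in> P" "y \<in> P" for x y
  proof -
    have "comb (\<lambda>i. x i \<oplus>\<^bsub>dual_algebra\<^esub> y i) = (\<Oplus>\<^bsub>M\<^esub>i\<in>{..<n}. x i \<odot>\<^bsub>M\<^esub> s i \<oplus>\<^bsub>M\<^esub> y i \<odot>\<^bsub>M\<^esub> s i)"
      unfolding comb_def using that sS tc
      by (intro M.finsum_cong') (auto simp: P_def smult_l_distr)
    also have "\<dots> = comb x \<oplus>\<^bsub>M\<^esub> comb y"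
      unfolding comb_def using that tc by (intro M.finsum_addf) auto
    finally show ?thesis by simp
  qed
  have comb_smult: "f \<odot>\<^bsub>M\<^esub> comb x = comb (\<lambda>i. f \<otimes>\<^bsub>dual_algebra\<^esub> x i)"
    if "x \<in> P" and f: "f \<in> carrier dual_algebra" for x f
  proof -
    have "f \<odot>\<^bsub>M\<^esub> (\<Oplus>\<^bsub>M\<^esub>i\<in>A. x i \<odot>\<^bsub>M\<^esub> s i) = (\<Oplus>\<^bsub>M\<^esub>i\<in>A. (f \<otimes>\<^bsub>dual_algebra\<^esub> x i) \<odot>\<^bsub>M\<^esub> s i)"
      if "finite A" "A \<subseteq> {..<n}" for A
      using that
    proof (induction A)
      case empty
      then show ?case using smult_r_null f by simp
    next
      case (insert a A)
      have m: "x i \<odot>\<^bsub>M\<^esub> s i \<in> carrier M" "f \<otimes>\<^bsub>dual_algebra\<^esub> x i \<in> carrier dual_algebra"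
        "s i \<in> carrier M" "x i \<in> carrier dual_algebra"
        if "i \<in> insert a A" for i
        using that insert.prems \<open>x \<in> P\<close> f tc sS by (auto simp: P_def)
      then have "(\<lambda>i. x i \<odot>\<^bsub>M\<^esub> s i) \<in> A \<rightarrow> carrier M"
        "(\<lambda>i. (f \<otimes>\<^bsub>dual_algebra\<^esub> x i) \<odot>\<^bsub>M\<^esub> s i) \<in> A \<rightarrow> carrier M" by auto
      then show ?case
        using insert m f by (simp add: smult_r_distr smult_assoc1)
    qed
    from this[of "{..<n}"] show ?thesis by (simp add: comb_def)
  qed
  have sub: "submodule (comb ` P) dual_algebra M"
  proof -
    have smult: "f \<odot>\<^bsub>M\<^esub> y \<in> comb ` P" if f: "f \<in> carrier dual_algebra" and y: "y \<in> comb ` P" for f y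
    proof -
      obtain x where "x \<in> P" "y = comb x" using y by auto
      moreover have "(\<lambda>i. f \<otimes>\<^bsub>dual_algebra\<^esub> x i) \<in> P" using \<open>x \<in> P\<close> f by (simp add: P_def)
      ultimately show ?thesis using comb_smult f by simp
    qed
    have "comb ` P \<subseteq> carrier M" using comb_closed by auto
    moreover have "comb ` P \<noteq> {}"
    proof -
      have "(\<lambda>_. \<zero>\<^bsub>dual_algebra\<^esub>) \<in> P" by (simp add: P_def)
      then show ?thesis by blast
    qed
    moreover have "inv\<^bsub>add_monoid M\<^esub> y \<in> comb ` P" if "y \<in> comb ` P" for y
    proof -
      have "y \<in> carrier M" using that comb_closed by auto
      then have "inv\<^bsub>add_monoid M\<^esub> y = (\<ominus>\<^bsub>dual_algebra\<^esub> \<one>\<^bsub>dual_algebra\<^esub>) \<odot>\<^bsub>M\<^esub> y"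
        using minus_eq_smult by (simp add: a_inv_def)
      then show ?thesis using smult that by simp
    qed
    moreover have "x \<otimes>\<^bsub>add_monoid M\<^esub> y \<in> comb ` P" if "x \<in> comb ` P" "y \<in> comb ` P" for x y
    proof -
      obtain u v where uv: "u \<in> P" "x = comb u" "v \<in> P" "y = comb v" using \<open>x \<in> _\<close> \<open>y \<in> _\<close> by auto
      moreover have "(\<lambda>i. u i \<oplus>\<^bsub>dual_algebra\<^esub> v i) \<in> P" using uv by (simp add: P_def)
      ultimately show ?thesis using comb_add by simp
    qed
    ultimately have "subgroup (comb ` P) (add_monoid M)"
      by (intro M.add.subgroupI) (simp_all add: a_inv_def)
    then show ?thesis using smult by (rule submodule.intro[OF _ submodule_axioms.intro])
  qed
  have gen: "S \<subseteq> comb ` P"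
  proof
    fix y assume "y \<in> S"
    then obtain j where j: "j < n" "y = s j" using s by (auto simp: bij_betw_def)
    define x where "x = (\<lambda>i. if i = j then \<one>\<^bsub>dual_algebra\<^esub> else \<zero>\<^bsub>dual_algebra\<^esub>)"
    have "comb x = (\<Oplus>\<^bsub>M\<^esub>i\<in>{..<n}. if j = i then s i else \<zero>\<^bsub>M\<^esub>)"
      unfolding comb_def x_def using sS by (intro M.finsum_cong') (auto simp: smult_l_null)
    also have "\<dots> = s j" using j sS by (intro M.finsum_singleton) auto
    finally have "y = comb x" using j by simp
    moreover have "x \<in> P" by (simp add: P_def x_def)
    ultimately show "y \<in> comb ` P" by blast
  qed
  have surj: "comb ` P = carrier M" by (rule S(3)[OF sub gen])

  define h where "h = (\<lambda>m. {x \<in> P. comb x = m})"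
  have inj: "inj_on h (carrier M)"
  proof (rule inj_onI)
    fix a b assume a: "a \<in> carrier M" and eq: "h a = h b"
    obtain x where "x \<in> P" "comb x = a" using a unfolding surj[symmetric] by auto
    then have "x \<in> h a" by (simp add: h_def)
    then have "comb x = b" unfolding eq by (simp add: h_def)
    then show "a = b" using \<open>comb x = a\<close> by simp
  qed
  define g where "g = the_inv_into (carrier M) h"
  have g: "g (h m) = m" if "m \<in> carrier M" for m
    unfolding g_def using inj that by (rule the_inv_into_f_f)
  define M' :: "('c \<Rightarrow> 'k, (nat \<Rightarrow> 'c \<Rightarrow> 'k) set) module" where
    "M' = \<lparr>carrier = h ` carrier M, monoid.mult = undefined, one = undefined, ring.zero = h \<zero>\<^bsub>M\<^esub>,
       add = (\<lambda>x y. h (g x \<oplus>\<^bsub>M\<^esub> g y)), module.smult = (\<lambda>f x. h (f \<odot>\<^bsub>M\<^esub> g x))\<rparr>"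
  have M': "carrier M' = h ` carrier M" "\<zero>\<^bsub>M'\<^esub> = h \<zero>\<^bsub>M\<^esub>"
    "x \<oplus>\<^bsub>M'\<^esub> y = h (g x \<oplus>\<^bsub>M\<^esub> g y)" "f \<odot>\<^bsub>M'\<^esub> x = h (f \<odot>\<^bsub>M\<^esub> g x)" for x y f
    by (simp_all add: M'_def)
  have "abelian_group M'"
  proof (rule abelian_groupI)
    fix x assume "x \<in> carrier M'"
    then obtain m where m: "m \<in> carrier M" "x = h m" by (auto simp: M')
    then show "\<exists>y\<in>carrier M'. y \<oplus>\<^bsub>M'\<^esub> x = \<zero>\<^bsub>M'\<^esub>"
      by (intro bexI[of _ "h (\<ominus>\<^bsub>M\<^esub> m)"]) (simp_all add: M' g M.l_neg)
  next
    fix x y assume "x \<in> carrier M'" "y \<in> carrier M'"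
    then show "x \<oplus>\<^bsub>M'\<^esub> y = y \<oplus>\<^bsub>M'\<^esub> x" unfolding M' by (elim imageE) (simp add: g M.a_comm)
  next
    fix x y z assume "x \<in> carrier M'" "y \<in> carrier M'" "z \<in> carrier M'"
    then show "x \<oplus>\<^bsub>M'\<^esub> y \<oplus>\<^bsub>M'\<^esub> z = x \<oplus>\<^bsub>M'\<^esub> (y \<oplus>\<^bsub>M'\<^esub> z)"
      unfolding M' by (elim imageE) (simp add: g M.a_assoc)
  next
    fix x y assume "x \<in> carrier M'" "y \<in> carrier M'"
    then show "x \<oplus>\<^bsub>M'\<^esub> y \<in> carrier M'" unfolding M' by (elim imageE) (simp add: g)
  next
    fix x assume "x \<in> carrier M'"
    then show "\<zero>\<^bsub>M'\<^esub> \<oplus>\<^bsub>M'\<^esub> x = x" unfolding M' by (elim imageE) (simp add: g)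
  qed (simp add: M')
  moreover have "left_module_axioms dual_algebra M'"
    unfolding left_module_axioms_def M'
    by (intro conjI allI impI; elim imageE)
      (simp_all add: g smult_l_distr smult_r_distr smult_assoc1)
  ultimately have "left_module dual_algebra M'"
    using ring_dual_algebra by (simp add: left_module_def)
  moreover have "bij_betw h (carrier M) (carrier M')"
    using inj by (simp add: bij_betw_def M')
  ultimately show ?thesis
    by (rule that) (simp_all add: M' g)
qed

end

theory Submission
  imports Defs
begin

text \<open>
  Let \<open>A\<close> be the dual algebra of \<open>C\<close>, let \<open>C\<^sub>0\<close> be the coradical and \<open>J\<close> its annihilator in \<open>A\<close>.  The
  algebra acts on \<open>C\<close> from both sides (\<open>lact\<close> and \<open>ract\<close>), and dualising these actions gives right
  and left multiplication in \<open>A\<close>.  The left subcomodules are the subspaces stable under \<open>ract\<close>,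
  and a subspace is determined by its annihilator, so it suffices that left ideals of \<open>A\<close> are
  comparable.

  Since \<open>C\<close> is colocal, \<open>C\<^sub>0\<close> lies in every nonzero left subcomodule, and therefore \<open>A\<close> is local with
  \<open>J\<close> as its ideal of nonunits (\<open>inverse_exists\<close>).  Two facts connect rationality with \<open>A\<close>: the
  elements of a module killed by \<open>J\<close> are rational (\<open>socle_subset_Rat\<close>), and a rational element is
  killed by all functionals vanishing on some finite set (\<open>Rat_finite_support\<close>).

  The splitting hypothesis is applied to two families of modules.  For \<open>a \<noteq> 0\<close>, the class of \<open>a\<close> in
  \<open>A / J a\<close> is nonzero and rational; as this cyclic module is indecomposable, it is rational
  altogether, which forces the kernel of \<open>lact a\<close> to be finite-dimensional
  (\<open>lact_kernel_finite_dim\<close>).  Because \<open>C\<close> is infinite-dimensional, \<open>A\<close> is a domain.  For nonzero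
  \<open>a\<close> and \<open>b\<close>, the class of \<open>(a, b)\<close> in \<open>A\<^sup>2 / J (a, b)\<close> is rational, but the whole module is not;
  comparing a splitting with the basis it induces on \<open>A\<^sup>2\<close> shows that one of \<open>a\<close>, \<open>b\<close> is a right
  multiple of the other (\<open>right_comparable\<close>).

  It follows that \<open>J = a A\<close> for an \<open>a\<close> whose kernel has least dimension.  The finite dimension of
  \<open>C\<^sub>0\<close> and the local nilpotency of \<open>ract a\<close> turn this into \<open>J = A a\<close>
  (\<open>lact_kernel_of_generator\<close>), every nonzero element of \<open>A\<close> is a unit times a power of \<open>a\<close>
  (\<open>unit_times_power\<close>), and any two left ideals are comparable.
\<close>

section \<open>Functionals and finite-dimensional subspaces\<close>

abbreviation functional :: "('k::field \<Rightarrow> 'v::ab_group_add \<Rightarrow> 'v) \<Rightarrow> ('v \<Rightarrow> 'k) \<Rightarrow> bool" where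
  "functional scale \<equiv> Vector_Spaces.linear scale (*)"

abbreviation endo :: "('k::field \<Rightarrow> 'v::ab_group_add \<Rightarrow> 'v) \<Rightarrow> ('v \<Rightarrow> 'v) \<Rightarrow> bool" where
  "endo scale \<equiv> Vector_Spaces.linear scale scale"

definition finite_dim :: "('k::field \<Rightarrow> 'v::ab_group_add \<Rightarrow> 'v) \<Rightarrow> 'v set \<Rightarrow> bool" where
  "finite_dim scale V \<longleftrightarrow> (\<exists>F. finite F \<and> V \<subseteq> Modules.module.span scale F)"

context vector_space
begin

lemma vector_space_base: "vector_space ((*) :: 'a \<Rightarrow> 'a \<Rightarrow> 'a)"
  by standard (auto simp: algebra_simps)

lemma functional_iff:
  "functional scale f \<longleftrightarrow> (\<forall>x y. f (x + y) = f x + f y) \<and> (\<forall>k x. f (scale k x) = k * f x)"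
  using vector_space_base by (auto simp: Vector_Spaces.linear_iff vector_space_axioms)

lemma endo_iff:
  "endo scale f \<longleftrightarrow> (\<forall>x y. f (x + y) = f x + f y) \<and> (\<forall>k x. f (scale k x) = scale k (f x))"
  by (auto simp: Vector_Spaces.linear_iff vector_space_axioms)

lemma functional_zero: "functional scale f \<Longrightarrow> f 0 = 0"
  unfolding functional_iff by (metis mult_zero_left scale_zero_left)

lemma functional_diff: "functional scale f \<Longrightarrow> f (x - y) = f x - f y"
  unfolding functional_iff by (metis add_diff_cancel_right' diff_add_cancel)

lemma endo_zero: "endo scale f \<Longrightarrow> f 0 = 0"
  unfolding endo_iff by (metis scale_zero_left)

lemma endo_diff: "endo scale f \<Longrightarrow> f (x - y) = f x - f y"
  unfolding endo_iff by (metis add_diff_cancel_right' diff_add_cancel)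

lemma functional_compose: "functional scale h \<Longrightarrow> endo scale f \<Longrightarrow> functional scale (\<lambda>x. h (f x))"
  by (simp add: functional_iff endo_iff)

lemma functional_add: "functional scale f \<Longrightarrow> functional scale g \<Longrightarrow> functional scale (\<lambda>c. f c + g c)"
  by (simp add: functional_iff algebra_simps)

lemma functional_scaled: "functional scale f \<Longrightarrow> functional scale (\<lambda>c. k * f c)"
  by (simp add: functional_iff algebra_simps)

lemma functional_minus:
  "functional scale f \<Longrightarrow> functional scale g \<Longrightarrow> functional scale (\<lambda>c. f c - g c)"
  by (simp add: functional_iff algebra_simps)

lemma functional_const_zero: "functional scale (\<lambda>_. 0)"
  by (simp add: functional_iff)

lemma functional_sum: "functional scale f \<Longrightarrow> f (sum g A) = (\<Sum>a\<in>A. f (g a))"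
  by (induction A rule: infinite_finite_induct) (auto simp: functional_iff functional_zero)

lemma functional_extend:
  assumes "independent B"
  shows "\<exists>f. functional scale f \<and> (\<forall>b\<in>B. f b = g b)"
proof -
  interpret vs2: vector_space "(*) :: 'a \<Rightarrow> 'a \<Rightarrow> 'a" by (rule vector_space_base)
  interpret vector_space_pair scale "(*) :: 'a \<Rightarrow> 'a \<Rightarrow> 'a" ..
  show ?thesis using linear_independent_extend[OF assms, of g] by blast
qed

lemma functional_vanishes_on_span:
  assumes "functional scale f" "\<And>s. s \<in> S \<Longrightarrow> f s = 0" "x \<in> span S"
  shows "f x = 0"
  using assms(3)
proof (induction rule: span_induct_alt)
  case base
  then show ?case using assms(1) by (rule functional_zero)
next
  case (step c x y)
  then show ?case using assms(1,2) by (simp add: functional_iff)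
qed

text \<open>
  The vector can be added to a basis of the subspace as a further independent vector, and a
  functional may be prescribed on an independent set.
\<close>

lemma separating_functional:
  assumes "x \<notin> span S"
  obtains f where "functional scale f" "f x = 1" "\<And>y. y \<in> span S \<Longrightarrow> f y = 0"
proof -
  obtain B where B: "B \<subseteq> span S" "independent B" "span S \<subseteq> span B"
    using maximal_independent_subset by blast
  have sp: "span B = span S"
    using B by (metis span_minimal subspace_span subset_antisym)
  then have "independent (insert x B)" using B assms by (intro independent_insertI) auto
  then obtain f where f: "functional scale f" "\<forall>b\<in>insert x B. f b = (if b = x then 1 else 0)"
    using functional_extend[of "insert x B" "\<lambda>b. if b = x then 1 else 0"] by blast
  have "f b = 0" if "b \<in> B" for b using f that B(1) assms by auto
  then have "f y = 0" if "y \<in> span S" for y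
    using functional_vanishes_on_span[OF f(1)] that sp by auto
  then show ?thesis using that f by auto
qed

lemma separating_functional_subspace:
  assumes "subspace V" "x \<notin> V"
  obtains f where "functional scale f" "f x = 1" "\<And>y. y \<in> V \<Longrightarrow> f y = 0"
  using separating_functional[of x V] assms span_eq_iff[of V] by metis

lemma functionals_separate:
  assumes "\<And>f. functional scale f \<Longrightarrow> f x = f y"
  shows "x = y"
proof (rule ccontr)
  assume "x \<noteq> y"
  then have "x - y \<notin> span {}" by simp
  then obtain f where "functional scale f" "f (x - y) = 1" by (rule separating_functional)
  then show False using assms[of f] by (simp add: functional_diff)
qed

text \<open>
  Dualising turns \<open>f\<close> into \<open>h \<mapsto> h \<circ> f\<close>, and over a field the image of the dual map is the full
  annihilator of the kernel: compose \<open>g\<close> with a linear section of \<open>f\<close>.  This is what makes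
  one-sided principal ideals of the dual algebra computable from kernels.
\<close>

lemma functional_factors:
  assumes "endo scale f" "functional scale g" "\<And>x. f x = 0 \<Longrightarrow> g x = 0"
  obtains h where "functional scale h" "\<And>x. h (f x) = g x"
proof -
  interpret vector_space_pair scale scale ..
  obtain r where r: "endo scale r" "\<forall>v\<in>range f. f (r v) = v"
    using linear_exists_right_inverse_on[OF assms(1) subspace_UNIV] by auto
  have "g (r (f x)) = g x" for x
  proof -
    have "f (r (f x) - x) = 0" using r by (simp add: endo_diff[OF assms(1)])
    then show ?thesis using assms(2,3) functional_diff by fastforce
  qed
  then show ?thesis using that functional_compose[OF assms(2) r(1)] by blast
qed

lemma coordinate_functionals:
  assumes "independent B" "finite B"
  obtains e where "\<And>b. functional scale (e b)"
    "\<And>b b'. b \<in> B \<Longrightarrow> b' \<in> B \<Longrightarrow> e b b' = (if b = b' then 1 else 0)"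
    "\<And>x. x \<in> span B \<Longrightarrow> (\<Sum>b\<in>B. scale (e b x) b) = x"
proof -
  have "\<exists>f. functional scale f \<and> (\<forall>b'\<in>B. f b' = (if b = b' then 1 else 0))" for b
    by (rule functional_extend[OF assms(1)])
  then obtain e where e: "\<And>b. functional scale (e b)"
    "\<And>b b'. b' \<in> B \<Longrightarrow> e b b' = (if b = b' then 1 else 0)" by metis
  have "(\<Sum>b\<in>B. scale (e b x) b) = x" if "x \<in> span B" for x
    using that
  proof (induction rule: span_induct_alt)
    case base
    show ?case using e(1) by (simp add: functional_zero)
  next
    case (step c x y)
    have "e b (scale c x + y) = c * e b x + e b y" for b
      using e(1)[of b] by (simp add: functional_iff)
    then have "(\<Sum>b\<in>B. scale (e b (scale c x + y)) b) =
        scale c (\<Sum>b\<in>B. scale (e b x) b) + (\<Sum>b\<in>B. scale (e b y) b)"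
      by (simp add: scale_left_distrib sum.distrib scale_sum_right)
    also have "(\<Sum>b\<in>B. scale (e b x) b) = (\<Sum>b\<in>B. if b = x then x else 0)"
      using e(2) step by (intro sum.cong) auto
    also have "\<dots> = x" using step assms(2) by simp
    finally show ?case using step by simp
  qed
  then show ?thesis using that e by blast
qed

lemma endo_image_subspace: "endo scale f \<Longrightarrow> subspace V \<Longrightarrow> subspace (f ` V)"
proof -
  assume f: "endo scale f" and V: "subspace V"
  interpret vector_space_pair scale scale ..
  show "subspace (f ` V)" using linear_subspace_image[OF f V] .
qed

lemma endo_vimage_subspace: "endo scale f \<Longrightarrow> subspace V \<Longrightarrow> subspace {x. f x \<in> V}"
  unfolding subspace_def by (auto simp: endo_iff endo_zero)

lemma endo_kernel_subspace: "endo scale f \<Longrightarrow> subspace {x. f x = 0}"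
  using endo_vimage_subspace[of f "{0}"] by auto

lemma endo_image_span:
  assumes "endo scale f"
  shows "f ` span S = span (f ` S)"
proof -
  interpret vector_space_pair scale scale ..
  show ?thesis using linear_span_image[OF assms] by simp
qed

lemma finite_dim_subset: "finite_dim scale W \<Longrightarrow> V \<subseteq> W \<Longrightarrow> finite_dim scale V"
  unfolding finite_dim_def by blast

lemma finite_dim_basis_extend:
  assumes "finite_dim scale V" "subspace V" "S \<subseteq> V" "independent S"
  obtains B where "S \<subseteq> B" "B \<subseteq> V" "independent B" "span B = V" "finite B" "dim V = card B"
proof -
  obtain B where B: "S \<subseteq> B" "B \<subseteq> V" "independent B" "V \<subseteq> span B"
    using maximal_independent_subset_extend[OF assms(3,4)] by blast
  have "span B = V" using B assms(2) by (metis span_minimal subset_antisym)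
  moreover have "finite B"
    using assms(1) B independent_span_bound unfolding finite_dim_def by (meson subset_trans)
  moreover have "dim V = card B" using B basis_card_eq_dim by simp
  ultimately show ?thesis using that B by blast
qed

lemma finite_dim_basis:
  assumes "finite_dim scale V" "subspace V"
  obtains B where "B \<subseteq> V" "independent B" "span B = V" "finite B" "dim V = card B"
  by (rule finite_dim_basis_extend[OF assms, of "{}"]) (use that independent_empty in auto)

lemma dim_less_of_proper_subspace:
  assumes "subspace V" "subspace W" "finite_dim scale W" "V \<subset> W"
  shows "dim V < dim W"
proof -
  obtain B where B: "B \<subseteq> V" "independent B" "span B = V" "finite B" "dim V = card B"
    using finite_dim_basis[OF finite_dim_subset[of W V]] assms by blast
  obtain x where x: "x \<in> W" "x \<notin> V" using assms by auto
  then have "independent (insert x B)" using B by (intro independent_insertI) auto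
  moreover have "insert x B \<subseteq> W" using x B assms(4) by auto
  ultimately obtain E where E: "insert x B \<subseteq> E" "E \<subseteq> W" "independent E" "span E = W"
    "finite E" "dim W = card E"
    using finite_dim_basis_extend[OF assms(3,2)] by metis
  have "x \<notin> B" using B x by (metis span_base)
  then have "card B < card (insert x B)" using B by simp
  also have "\<dots> \<le> card E" using E by (intro card_mono) auto
  finally show ?thesis using B E by simp
qed

text \<open>
  A basis of \<open>V\<close> that contains the kernel vector \<open>k\<close> loses at least that vector under \<open>f\<close>.
  Used with \<open>W = V\<close> it says that a surjective endomorphism of a finite-dimensional space is
  injective; used with different spaces it is the descent that produces a generator of the
  radical.
\<close>

lemma dim_less_of_endo_with_kernel:
  assumes f: "endo scale f" and V: "subspace V" "finite_dim scale V"
    and k: "k \<in> V" "k \<noteq> 0" "f k = 0" and W: "W \<subseteq> f ` V"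
  shows "dim W < dim V"
proof -
  have "independent {k}" using k by simp
  moreover have "{k} \<subseteq> V" using k by simp
  ultimately obtain E where E: "{k} \<subseteq> E" "E \<subseteq> V" "independent E" "span E = V"
    "finite E" "dim V = card E"
    using finite_dim_basis_extend[OF V(2,1)] by metis
  have "f ` E \<subseteq> insert 0 (f ` (E - {k}))" using k by auto
  then have "span (f ` E) \<subseteq> span (f ` (E - {k}))"
    using span_mono[of "f ` E" "insert 0 (f ` (E - {k}))"] by simp
  then have "W \<subseteq> span (f ` (E - {k}))" using W E endo_image_span[OF f, of E] by auto
  then have "dim W \<le> card (f ` (E - {k}))" using E by (intro dim_le_card) auto
  also have "\<dots> \<le> card (E - {k})" using E by (intro card_image_le) auto
  also have "\<dots> < card E" using E by (intro psubset_card_mono) auto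
  finally show ?thesis using E by simp
qed

lemma finite_dim_of_kernel_image:
  assumes f: "endo scale f" and fin: "finite_dim scale {x. f x = 0}" "finite_dim scale (range f)"
  shows "finite_dim scale UNIV"
proof -
  obtain F where F: "finite F" "{x. f x = 0} \<subseteq> span F" using fin unfolding finite_dim_def by blast
  obtain B where B: "B \<subseteq> range f" "independent B" "span B = range f" "finite B"
    "dim (range f) = card B"
    by (rule finite_dim_basis[OF fin(2) endo_image_subspace[OF f subspace_UNIV]])
  obtain G where G: "finite G" "B = f ` G" using finite_subset_image[OF B(4,1)] by blast
  have "x \<in> span (F \<union> G)" for x
  proof -
    have "f x \<in> f ` span G" using B(3) G endo_image_span[OF f] by auto
    then obtain y where y: "y \<in> span G" "f x = f y" by auto
    then have "x - y \<in> span F" using F endo_diff[OF f, of x y] by auto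
    then have "x - y \<in> span (F \<union> G)" "y \<in> span (F \<union> G)" using y span_mono by blast+
    then show ?thesis using span_add by fastforce
  qed
  then show ?thesis unfolding finite_dim_def using F G by (intro exI[of _ "F \<union> G"]) auto
qed

end

section \<open>Tensors are equal when all multilinear maps agree on them\<close>

lemma functional_free_formal_sum:
  fixes L :: "('a \<Rightarrow>\<^sub>0 'b::field) \<Rightarrow> 'b"
  assumes "Vector_Spaces.linear free_scale (*) L"
  shows "L (formal_sum ts) = (\<Sum>t\<leftarrow>ts. L (Poly_Mapping.single t 1))"
proof -
  interpret vector_space "free_scale :: 'b \<Rightarrow> ('a \<Rightarrow>\<^sub>0 'b) \<Rightarrow> _" by (rule vector_space_free_scale)
  show ?thesis
    using assms functional_zero[OF assms]
    by (induction ts) (auto simp: formal_sum_def functional_iff)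
qed

text \<open>
  The restriction to the carrier matters: a functional on the free vector space that kills the
  relations is additive in a slot only for vectors that lie in the carrier.
\<close>

definition linear_in_slot :: "('k::field, 'v) module \<Rightarrow> ('v \<Rightarrow> 'k) \<Rightarrow> bool" where
  "linear_in_slot V F \<longleftrightarrow>
     (\<forall>v\<in>carrier V. \<forall>w\<in>carrier V. F (v \<oplus>\<^bsub>V\<^esub> w) = F v + F w) \<and>
     (\<forall>k. \<forall>v\<in>carrier V. F (k \<odot>\<^bsub>V\<^esub> v) = k * F v)"

text \<open>
  Bridges the two descriptions of a multilinear map: a functional on the free vector space that
  kills the relations of one slot is linear in that slot.
\<close>

lemma linear_in_slot_if_vanishes:
  fixes L :: "('a \<Rightarrow>\<^sub>0 'b::field) \<Rightarrow> 'b"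
  assumes L: "Vector_Spaces.linear free_scale (*) L"
    and van: "\<And>r. r \<in> slot_relations V G \<Longrightarrow> L r = 0"
  shows "linear_in_slot V (\<lambda>v. L (Poly_Mapping.single (G v) 1))"
proof -
  interpret vector_space "free_scale :: 'b \<Rightarrow> ('a \<Rightarrow>\<^sub>0 'b) \<Rightarrow> _" by (rule vector_space_free_scale)
  note d = functional_diff[OF L]
  have a: "L (x + y) = L x + L y" for x y using L by (simp add: functional_iff)
  have s: "L (free_scale k x) = k * L x" for k x using L by (simp add: functional_iff)
  show ?thesis unfolding linear_in_slot_def
  proof (intro conjI ballI allI)
    fix v w assume "v \<in> carrier V" "w \<in> carrier V"
    then have "L (Poly_Mapping.single (G (v \<oplus>\<^bsub>V\<^esub> w)) 1 - Poly_Mapping.single (G v) 1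
        - Poly_Mapping.single (G w) 1) = 0"
      by (intro van) (auto simp: slot_relations_def)
    then show "L (Poly_Mapping.single (G (v \<oplus>\<^bsub>V\<^esub> w)) 1) =
        L (Poly_Mapping.single (G v) 1) + L (Poly_Mapping.single (G w) 1)"
      by (simp add: d a algebra_simps)
  next
    fix k v assume "v \<in> carrier V"
    then have "L (Poly_Mapping.single (G (k \<odot>\<^bsub>V\<^esub> v)) 1 - free_scale k (Poly_Mapping.single (G v) 1)) = 0"
      by (intro van) (auto simp: slot_relations_def)
    then show "L (Poly_Mapping.single (G (k \<odot>\<^bsub>V\<^esub> v)) 1) = k * L (Poly_Mapping.single (G v) 1)"
      by (simp add: d s)
  qed
qed

text \<open>
  The universal property of the tensor product, read backwards.  If the difference were outside
  the span of the relations, a functional separating it from that span would be a bilinear map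
  that tells the two tensors apart.
\<close>

lemma tensor2_eqI:
  fixes U :: "('k::field, 'u) module" and V :: "('k, 'v) module"
  assumes "\<And>F. (\<And>v. v \<in> carrier V \<Longrightarrow> linear_in_slot U (\<lambda>u. F (u, v))) \<Longrightarrow>
      (\<And>u. u \<in> carrier U \<Longrightarrow> linear_in_slot V (\<lambda>v. F (u, v))) \<Longrightarrow>
      (\<Sum>t\<leftarrow>xs. F t) = (\<Sum>t\<leftarrow>ys. F t)"
  shows "tensor2_eq U V xs ys"
proof (rule ccontr)
  interpret vector_space "free_scale :: 'k \<Rightarrow> ('u \<times> 'v \<Rightarrow>\<^sub>0 'k) \<Rightarrow> _"
    by (rule vector_space_free_scale)
  assume "\<not> tensor2_eq U V xs ys"
  then obtain L where L: "functional free_scale L" "L (formal_sum xs - formal_sum ys) = 1"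
    "\<And>y. y \<in> span (tensor2_relations U V) \<Longrightarrow> L y = 0"
    unfolding tensor2_eq_def using separating_functional by blast
  have van: "L r = 0" if "r \<in> tensor2_relations U V" for r using L(3) that span_base by blast
  have "(\<Sum>t\<leftarrow>xs. L (Poly_Mapping.single t 1)) = (\<Sum>t\<leftarrow>ys. L (Poly_Mapping.single t 1))"
    by (rule assms; rule linear_in_slot_if_vanishes[OF L(1) van])
      (auto simp: tensor2_relations_def)
  then show False using L(2) by (simp add: functional_diff[OF L(1)] functional_free_formal_sum[OF L(1)])
qed

lemma tensor3_eqI:
  fixes U :: "('k::field, 'u) module" and V :: "('k, 'v) module" and W :: "('k, 'w) module"
  assumes "\<And>F. (\<And>v w. v \<in> carrier V \<Longrightarrow> w \<in> carrier W \<Longrightarrow> linear_in_slot U (\<lambda>u. F (u, v, w))) \<Longrightarrow>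
      (\<And>u w. u \<in> carrier U \<Longrightarrow> w \<in> carrier W \<Longrightarrow> linear_in_slot V (\<lambda>v. F (u, v, w))) \<Longrightarrow>
      (\<And>u v. u \<in> carrier U \<Longrightarrow> v \<in> carrier V \<Longrightarrow> linear_in_slot W (\<lambda>w. F (u, v, w))) \<Longrightarrow>
      (\<Sum>t\<leftarrow>xs. F t) = (\<Sum>t\<leftarrow>ys. F t)"
  shows "tensor3_eq U V W xs ys"
proof (rule ccontr)
  interpret vector_space "free_scale :: 'k \<Rightarrow> ('u \<times> 'v \<times> 'w \<Rightarrow>\<^sub>0 'k) \<Rightarrow> _"
    by (rule vector_space_free_scale)
  assume "\<not> tensor3_eq U V W xs ys"
  then obtain L where L: "functional free_scale L" "L (formal_sum xs - formal_sum ys) = 1"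
    "\<And>y. y \<in> span (tensor3_relations U V W) \<Longrightarrow> L y = 0"
    unfolding tensor3_eq_def using separating_functional by blast
  have van: "L r = 0" if "r \<in> tensor3_relations U V W" for r using L(3) that span_base by blast
  have "(\<Sum>t\<leftarrow>xs. L (Poly_Mapping.single t 1)) = (\<Sum>t\<leftarrow>ys. L (Poly_Mapping.single t 1))"
    by (rule assms; rule linear_in_slot_if_vanishes[OF L(1) van])
      (auto simp: tensor3_relations_def)
  then show False using L(2) by (simp add: functional_diff[OF L(1)] functional_free_formal_sum[OF L(1)])
qed

lemma (in vector_space) linear_in_slot_space_of: "linear_in_slot (space_of scale) F \<longleftrightarrow> functional scale F"
  by (simp add: linear_in_slot_def space_of_def functional_iff)

section \<open>The two actions of the dual algebra on the coalgebra\<close>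

lemma sum_list_over_sum: "(\<Sum>x\<leftarrow>xs. \<Sum>a\<in>A. F x a) = (\<Sum>a\<in>A. \<Sum>x\<leftarrow>xs. F x a)"
  by (induction xs) (auto simp: sum.distrib)

context coalgebra
begin

definition conv :: "('c \<Rightarrow> 'k) \<Rightarrow> ('c \<Rightarrow> 'k) \<Rightarrow> 'c \<Rightarrow> 'k" where
  "conv f g c = (\<Sum>(a, b)\<leftarrow>\<Delta> c. f a * g b)"

text \<open>
  In Sweedler notation \<open>lact f c\<close> is \<open>f(c\<^sub>2) c\<^sub>1\<close>, usually written \<open>f \<rightharpoonup> c\<close>, and \<open>ract f c\<close> below is
  \<open>f(c\<^sub>1) c\<^sub>2\<close>, usually written \<open>c \<leftharpoonup> f\<close>.
\<close>

definition lact :: "('c \<Rightarrow> 'k) \<Rightarrow> 'c \<Rightarrow> 'c" where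
  "lact f c = (\<Sum>(a, b)\<leftarrow>\<Delta> c. scale (f b) a)"

definition ract :: "('c \<Rightarrow> 'k) \<Rightarrow> 'c \<Rightarrow> 'c" where
  "ract f c = (\<Sum>(a, b)\<leftarrow>\<Delta> c. scale (f a) b)"

lemma conv_functional: "functional scale f \<Longrightarrow> functional scale g \<Longrightarrow> functional scale (conv f g)"
  using convolution_linear by (simp add: conv_def[abs_def])

text \<open>
  Hence the dual of the map \<open>lact f\<close> is right multiplication by \<open>f\<close> in the dual algebra, and by
  the next lemma the dual of \<open>ract f\<close> is left multiplication.  Since functionals separate
  vectors, every identity between the two actions is an identity in the dual algebra.
\<close>

lemma functional_lact: "functional scale h \<Longrightarrow> h (lact f c) = conv h f c"
  unfolding lact_def conv_def using linear_sum_list[of h "\<lambda>(a, b). scale (f b) a" "\<Delta> c"]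
  by (simp add: functional_iff split_def mult.commute)

lemma functional_ract: "functional scale h \<Longrightarrow> h (ract f c) = conv f h c"
  unfolding ract_def conv_def using linear_sum_list[of h "\<lambda>(a, b). scale (f a) b" "\<Delta> c"]
  by (simp add: functional_iff split_def)

lemma conv_assoc:
  "functional scale f \<Longrightarrow> functional scale g \<Longrightarrow> functional scale h \<Longrightarrow>
   conv (conv f g) h = conv f (conv g h)"
  using convolution_assoc by (auto simp: conv_def[abs_def])

lemma conv_counit:
  assumes "functional scale f"
  shows "conv \<epsilon> f = f" "conv f \<epsilon> = f"
proof -
  have "ract \<epsilon> c = c" "lact \<epsilon> c = c" for c
    unfolding ract_def lact_def by (rule counit_left counit_right)+
  then show "conv \<epsilon> f = f" "conv f \<epsilon> = f"
    using functional_ract[OF assms] functional_lact[OF assms] by (metis ext)+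
qed

lemma ract_counit: "ract \<epsilon> c = c"
  unfolding ract_def by (rule counit_left)

lemma lact_endo:
  assumes "functional scale f"
  shows "endo scale (lact f)"
  unfolding endo_iff
proof (intro conjI allI; rule functionals_separate)
  fix h x y k assume h: "functional scale h"
  show "h (lact f (x + y)) = h (lact f x + lact f y)"
    using h conv_functional[OF h assms] functional_lact[OF h] by (simp add: functional_iff)
  show "h (lact f (scale k x)) = h (scale k (lact f x))"
    using h conv_functional[OF h assms] functional_lact[OF h] by (simp add: functional_iff)
qed

lemma ract_endo:
  assumes "functional scale f"
  shows "endo scale (ract f)"
  unfolding endo_iff
proof (intro conjI allI; rule functionals_separate)
  fix h x y k assume h: "functional scale h"
  show "h (ract f (x + y)) = h (ract f x + ract f y)"
    using h conv_functional[OF assms h] functional_ract[OF h] by (simp add: functional_iff)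
  show "h (ract f (scale k x)) = h (scale k (ract f x))"
    using h conv_functional[OF assms h] functional_ract[OF h] by (simp add: functional_iff)
qed

lemma lact_conv:
  assumes "functional scale f" "functional scale g"
  shows "lact (conv f g) c = lact f (lact g c)"
  by (rule functionals_separate)
    (use assms in \<open>simp add: functional_lact conv_functional conv_assoc\<close>)

lemma ract_conv:
  assumes "functional scale f" "functional scale g"
  shows "ract (conv f g) c = ract g (ract f c)"
  by (rule functionals_separate)
    (use assms in \<open>simp add: functional_ract conv_functional conv_assoc\<close>)

lemma lact_ract:
  assumes "functional scale f" "functional scale g"
  shows "lact f (ract g c) = ract g (lact f c)"
  by (rule functionals_separate)
    (use assms in \<open>simp add: functional_lact functional_ract conv_functional conv_assoc\<close>)

lemma counit_lact: "functional scale f \<Longrightarrow> \<epsilon> (lact f c) = f c"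
  using functional_lact[OF counit_linear] conv_counit by simp

lemma ract_add: "ract (\<lambda>c. f c + g c) c = ract f c + ract g c"
  by (simp add: ract_def split_def scale_left_distrib sum_list_addf)

lemma ract_zero: "ract (\<lambda>_. 0) c = 0"
  by (simp add: ract_def split_def)

lemma lact_zero: "lact (\<lambda>_. 0) c = 0"
  by (simp add: lact_def split_def)

lemma ract_scaled: "ract (\<lambda>c. k * f c) c = scale k (ract f c)"
proof -
  have "(\<Sum>(a, b)\<leftarrow>xs. scale (k * f a) b) = scale k (\<Sum>(a, b)\<leftarrow>xs. scale (f a) b)" for xs
    by (induction xs) (auto simp: scale_right_distrib)
  then show ?thesis by (simp add: ract_def)
qed

lemma ract_in_span: "ract f c \<in> span (snd ` set (\<Delta> c))"
proof -
  have "(\<Sum>(a, b)\<leftarrow>xs. scale (f a) b) \<in> span (snd ` set (\<Delta> c))" if "set xs \<subseteq> set (\<Delta> c)" for xs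
    using that
    by (induction xs) (force intro: span_add[OF span_scale[OF span_base]] span_zero)+
  then show ?thesis unfolding ract_def by blast
qed

definition ract_stable :: "'c set \<Rightarrow> bool" where
  "ract_stable Y \<longleftrightarrow> subspace Y \<and> (\<forall>f y. functional scale f \<longrightarrow> y \<in> Y \<longrightarrow> ract f y \<in> Y)"

lemma tensor2_eq_bilinear:
  assumes "tensor2_eq (space_of scale) (space_of scale) xs ys"
    and "\<And>b. functional scale (\<lambda>a. G a b)" "\<And>a. functional scale (G a)"
  shows "(\<Sum>(a, b)\<leftarrow>xs. G a b) = (\<Sum>(a, b)\<leftarrow>ys. G a b)"
  using tensor2_eq_eval[OF assms(1), of "\<lambda>(a, b). G a b"] assms(2,3) by simp

lemma tensor2_eqI_bilinear:
  assumes "\<And>G. (\<And>b. functional scale (\<lambda>a. G a b)) \<Longrightarrow> (\<And>a. functional scale (G a)) \<Longrightarrow>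
    (\<Sum>(a, b)\<leftarrow>xs. G a b) = (\<Sum>(a, b)\<leftarrow>ys. G a b)"
  shows "tensor2_eq (space_of scale) (space_of scale) xs ys"
proof (rule tensor2_eqI)
  fix F :: "'c \<times> 'c \<Rightarrow> 'k"
  assume "\<And>v. v \<in> carrier (space_of scale) \<Longrightarrow> linear_in_slot (space_of scale) (\<lambda>u. F (u, v))"
    "\<And>u. u \<in> carrier (space_of scale) \<Longrightarrow> linear_in_slot (space_of scale) (\<lambda>v. F (u, v))"
  then have "(\<Sum>(a, b)\<leftarrow>xs. F (a, b)) = (\<Sum>(a, b)\<leftarrow>ys. F (a, b))"
    by (intro assms) (auto simp: linear_in_slot_space_of space_of_def[of scale, THEN arg_cong, of carrier])
  then show "(\<Sum>t\<leftarrow>xs. F t) = (\<Sum>t\<leftarrow>ys. F t)" by (simp add: split_def)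
qed

lemma left_subcomodule_ract_stable:
  assumes "left_subcomodule Y"
  shows "ract_stable Y"
  unfolding ract_stable_def
proof (intro conjI allI impI)
  show Y: "subspace Y" using assms by (simp add: left_subcomodule_def)
  fix f y assume f: "functional scale f" and y: "y \<in> Y"
  obtain t where t: "set t \<subseteq> UNIV \<times> Y" "tensor2_eq (space_of scale) (space_of scale) (\<Delta> y) t"
    using assms y unfolding left_subcomodule_def by blast
  have "ract f y = (\<Sum>(a, b)\<leftarrow>t. scale (f a) b)"
  proof (rule functionals_separate)
    fix h assume h: "functional scale h"
    have "h (ract f y) = (\<Sum>(a, b)\<leftarrow>\<Delta> y. f a * h b)"
      using functional_ract[OF h] by (simp add: conv_def)
    also have "\<dots> = (\<Sum>(a, b)\<leftarrow>t. f a * h b)"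
      by (rule tensor2_eq_bilinear[OF t(2)]) (use f h in \<open>auto simp: functional_iff algebra_simps\<close>)
    also have "\<dots> = h (\<Sum>(a, b)\<leftarrow>t. scale (f a) b)"
      using linear_sum_list[OF h, of "\<lambda>(a, b). scale (f a) b" t] h
      by (simp add: functional_iff split_def)
    finally show "h (ract f y) = h (\<Sum>(a, b)\<leftarrow>t. scale (f a) b)" .
  qed
  also have "\<dots> \<in> Y"
    using t(1) Y by (induction t) (auto intro!: subspace_add subspace_scale subspace_0)
  finally show "ract f y \<in> Y" .
qed

text \<open>
  Expanding the left tensor factors of \<open>\<Delta> y\<close> in finitely many independent vectors \<open>x\<close>, the
  coefficient of \<open>x\<close> is \<open>ract\<close> of \<open>y\<close> by the coordinate functional of \<open>x\<close>.  These coefficients lie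
  in \<open>Y\<close>, so applying a projection onto \<open>Y\<close> to the right factors does not change the tensor.
\<close>

lemma ract_stable_left_subcomodule:
  assumes "ract_stable Y"
  shows "left_subcomodule Y"
  unfolding left_subcomodule_def
proof (intro conjI ballI)
  show Y: "subspace Y" using assms by (simp add: ract_stable_def)
  fix y assume y: "y \<in> Y"
  interpret vector_space_pair scale scale ..
  obtain P where P: "endo scale P" "P ` UNIV \<subseteq> Y" "\<And>v. v \<in> Y \<Longrightarrow> P v = v"
  proof -
    obtain g where g: "range g \<subseteq> Y" "endo scale g" "\<forall>v\<in>id ` Y. id (g v) = v"
      using linear_exists_right_inverse_on[of id Y] Y linear_id by blast
    then show ?thesis using that by auto
  qed
  define t where "t = map (\<lambda>(a, b). (a, P b)) (\<Delta> y)"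
  have "tensor2_eq (space_of scale) (space_of scale) (\<Delta> y) t"
  proof (rule tensor2_eqI_bilinear)
    fix G assume G: "\<And>b. functional scale (\<lambda>a. G a b)" "\<And>a. functional scale (G a)"
    define A where "A = fst ` set (\<Delta> y)"
    obtain E where E: "E \<subseteq> span A" "independent E" "span E = span A" "finite E"
      by (rule finite_dim_basis[of "span A"]) (auto simp: finite_dim_def A_def)
    obtain e where e: "\<And>b. functional scale (e b)"
      "\<And>x. x \<in> span E \<Longrightarrow> (\<Sum>b\<in>E. scale (e b x) b) = x"
      using coordinate_functionals[OF E(2,4)] by metis
    have expand: "G a b = (\<Sum>x\<in>E. e x a * G x b)" if "a \<in> A" for a b
    proof -
      have "a \<in> span E" using that E(3) span_base by auto
      then have "G a b = G (\<Sum>x\<in>E. scale (e x a) x) b" using e(2) by simp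
      also have "\<dots> = (\<Sum>x\<in>E. e x a * G x b)"
        using G(1)[of b] by (simp add: functional_sum[OF G(1)[of b]] functional_iff)
      finally show ?thesis .
    qed
    have key: "(\<Sum>(a, b)\<leftarrow>\<Delta> y. G a (H b)) = (\<Sum>x\<in>E. G x (H (ract (e x) y)))" if H: "endo scale H" for H
    proof -
      have "(\<Sum>(a, b)\<leftarrow>\<Delta> y. G a (H b)) = (\<Sum>(a, b)\<leftarrow>\<Delta> y. \<Sum>x\<in>E. e x a * G x (H b))"
        by (intro arg_cong[where f = sum_list] map_cong) (force simp: A_def intro!: expand)+
      also have "\<dots> = (\<Sum>x\<in>E. \<Sum>(a, b)\<leftarrow>\<Delta> y. e x a * G x (H b))"
        by (simp add: split_def sum_list_over_sum)
      also have "\<dots> = (\<Sum>x\<in>E. G x (H (ract (e x) y)))"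
        using functional_ract[OF functional_compose[OF G(2) H]]
        by (simp add: conv_def)
      finally show ?thesis .
    qed
    have "(\<Sum>(a, b)\<leftarrow>\<Delta> y. G a b) = (\<Sum>x\<in>E. G x (ract (e x) y))"
      using key[OF linear_id] by simp
    also have "\<dots> = (\<Sum>x\<in>E. G x (P (ract (e x) y)))"
      using P(3) assms y e(1) by (simp add: ract_stable_def)
    also have "\<dots> = (\<Sum>(a, b)\<leftarrow>\<Delta> y. G a (P b))" using key[OF P(1)] by simp
    also have "\<dots> = (\<Sum>(a, b)\<leftarrow>t. G a b)" by (simp add: t_def split_def o_def)
    finally show "(\<Sum>(a, b)\<leftarrow>\<Delta> y. G a b) = (\<Sum>(a, b)\<leftarrow>t. G a b)" .
  qed
  moreover have "set t \<subseteq> UNIV \<times> Y" using P(2) by (auto simp: t_def)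
  ultimately show "\<exists>t. set t \<subseteq> UNIV \<times> Y \<and> tensor2_eq (space_of scale) (space_of scale) (\<Delta> y) t" by blast
qed

lemma left_subcomodule_iff: "left_subcomodule Y \<longleftrightarrow> ract_stable Y"
  using left_subcomodule_ract_stable ract_stable_left_subcomodule by blast

definition ract_orbit :: "'c \<Rightarrow> 'c set" where
  "ract_orbit c = {ract f c | f. functional scale f}"

lemma ract_orbit_stable: "ract_stable (ract_orbit c)"
  unfolding ract_stable_def
proof (intro conjI allI impI)
  show "subspace (ract_orbit c)"
    unfolding subspace_def
  proof (intro conjI allI ballI)
    show "0 \<in> ract_orbit c"
      using ract_zero functional_const_zero unfolding ract_orbit_def by (metis (mono_tags, lifting) mem_Collect_eq)
    fix x y assume "x \<in> ract_orbit c" "y \<in> ract_orbit c"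
    then show "x + y \<in> ract_orbit c"
      unfolding ract_orbit_def by (auto simp: ract_add[symmetric] intro: functional_add)
  next
    fix k x assume "x \<in> ract_orbit c"
    then show "scale k x \<in> ract_orbit c"
      unfolding ract_orbit_def by (auto simp: ract_scaled[symmetric] intro: functional_scaled)
  qed
  fix f y assume "functional scale f" "y \<in> ract_orbit c"
  then show "ract f y \<in> ract_orbit c"
    unfolding ract_orbit_def by (auto simp: ract_conv[symmetric] intro: conv_functional)
qed

lemma ract_orbit_self: "c \<in> ract_orbit c"
  unfolding ract_orbit_def using ract_counit counit_linear by (metis (mono_tags, lifting) mem_Collect_eq)

lemma ract_orbit_minimal: "ract_stable Y \<Longrightarrow> c \<in> Y \<Longrightarrow> ract_orbit c \<subseteq> Y"
  by (auto simp: ract_orbit_def ract_stable_def)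

lemma ract_orbit_finite_dim: "finite_dim scale (ract_orbit c)"
  unfolding finite_dim_def
  by (rule exI[of _ "snd ` set (\<Delta> c)"]) (auto simp: ract_orbit_def ract_in_span)

text \<open>
  Orbits are finite-dimensional, because \<open>ract f c\<close> is a combination of the finitely many right
  factors of \<open>\<Delta> c\<close>.  A nonzero stable subspace of least dimension inside an orbit is simple.
\<close>

lemma contains_simple:
  assumes "ract_stable Y" "Y \<noteq> {0}"
  obtains S where "simple_left_subcomodule S" "S \<subseteq> Y" "finite_dim scale S"
proof -
  have "0 \<in> Y" using assms subspace_0 by (auto simp: ract_stable_def)
  then obtain c where c: "c \<in> Y" "c \<noteq> 0" using assms(2) by blast
  let ?P = "\<lambda>Z. ract_stable Z \<and> Z \<noteq> {0} \<and> Z \<subseteq> ract_orbit c"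
  have "?P (ract_orbit c)" using ract_orbit_stable ract_orbit_self c by blast
  then obtain S where S: "?P S" and min: "\<And>Z. ?P Z \<Longrightarrow> dim S \<le> dim Z"
    using ex_has_least_nat[of ?P "ract_orbit c" dim] by blast
  have fin: "finite_dim scale S" using S ract_orbit_finite_dim finite_dim_subset by blast
  have "Z = {0} \<or> Z = S" if "ract_stable Z" "Z \<subseteq> S" for Z
  proof (rule ccontr)
    assume "\<not> ?thesis"
    then have "dim S \<le> dim Z" "Z \<subset> S" using that S by (auto intro!: min)
    then show False
      using dim_less_of_proper_subspace[of Z S] that S fin by (auto simp: ract_stable_def)
  qed
  then have "simple_left_subcomodule S"
    unfolding simple_left_subcomodule_def left_subcomodule_iff using S by blast
  then show ?thesis using that S fin ract_orbit_minimal[OF assms(1) c(1)] by blast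
qed

end

section \<open>The dual algebra of a colocal coalgebra is local\<close>

locale colocal_coalgebra = coalgebra scale \<Delta> \<epsilon>
  for scale :: "'k::field \<Rightarrow> 'c::ab_group_add \<Rightarrow> 'c"
    and \<Delta> :: "'c \<Rightarrow> ('c \<times> 'c) list" and \<epsilon> :: "'c \<Rightarrow> 'k" +
  assumes colocal: colocal
begin

lemma coradical_simple: "simple_left_subcomodule coradical"
  using colocal by (simp add: colocal_def)

lemma coradical_stable: "ract_stable coradical"
  using coradical_simple by (simp add: simple_left_subcomodule_def left_subcomodule_iff)

lemma coradical_nonzero: "coradical \<noteq> {0}"
  using coradical_simple by (simp add: simple_left_subcomodule_def)

lemma simple_is_coradical:
  assumes "simple_left_subcomodule S"
  shows "S = coradical"
proof -
  have "S \<subseteq> \<Union>{Y. simple_left_subcomodule Y}" using assms by auto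
  then have "S \<subseteq> coradical" unfolding coradical_def using span_superset by (rule subset_trans)
  then show ?thesis
    using assms coradical_simple by (auto simp: simple_left_subcomodule_def)
qed

text \<open>
  A simple left subcomodule lies in the coradical, which is itself simple, so the coradical is
  the only one; and every nonzero left subcomodule contains a simple one.
\<close>

lemma coradical_least:
  assumes "ract_stable Y" "Y \<noteq> {0}"
  shows "coradical \<subseteq> Y"
  by (rule contains_simple[OF assms]) (drule simple_is_coradical, simp)

lemma coradical_finite_dim: "finite_dim scale coradical"
  by (rule contains_simple[OF coradical_stable coradical_nonzero]) (drule simple_is_coradical, simp)

lemma lact_kernel_stable:
  assumes "functional scale f"
  shows "ract_stable {c. lact f c = 0}"
  unfolding ract_stable_def
proof (intro conjI allI impI)
  show "subspace {c. lact f c = 0}" by (rule endo_kernel_subspace[OF lact_endo[OF assms]])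
  fix g y assume "functional scale g" "y \<in> {c. lact f c = 0}"
  then show "ract g y \<in> {c. lact f c = 0}"
    using lact_ract[OF assms] endo_zero[OF ract_endo] by simp
qed

text \<open>
  The two actions commute, so both the image of the coradical under \<open>lact f\<close> and its preimage are
  left subcomodules.  If the image is nonzero it contains the coradical; a nonzero vector of the
  coradical then has a preimage in the coradical, hence the subcomodule \<open>?Y\<close> is nonzero and
  contains the coradical as well.
\<close>

lemma lact_coradical:
  assumes f: "functional scale f" and c: "c \<in> coradical"
  shows "lact f c \<in> coradical"
proof -
  let ?Y = "{c. lact f c \<in> coradical}" and ?T = "lact f ` coradical"
  have sub: "subspace coradical" using coradical_stable by (simp add: ract_stable_def)
  have Y: "ract_stable ?Y"
    using coradical_stable lact_ract[OF f] endo_vimage_subspace[OF lact_endo[OF f] sub]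
    by (auto simp: ract_stable_def)
  have T: "ract_stable ?T"
    unfolding ract_stable_def
  proof (intro conjI allI impI)
    show "subspace ?T" by (rule endo_image_subspace[OF lact_endo[OF f] sub])
    fix g y assume g: "functional scale g" and "y \<in> ?T"
    then obtain c where "c \<in> coradical" "y = lact f c" by blast
    then show "ract g y \<in> ?T"
      using lact_ract[OF f g] coradical_stable g unfolding ract_stable_def by (metis image_eqI)
  qed
  show ?thesis
  proof (cases "?T = {0}")
    case True
    then show ?thesis using c subspace_0[OF sub] by (metis imageI singletonD)
  next
    case False
    obtain u where u: "u \<in> coradical" "u \<noteq> 0"
      using coradical_nonzero subspace_0[OF sub] by blast
    then obtain d where d: "u = lact f d" using coradical_least[OF T False] by blast
    then have "d \<in> ?Y" "d \<noteq> 0" using u endo_zero[OF lact_endo[OF f]] by auto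
    then have "?Y \<noteq> {0}" by blast
    then show ?thesis using coradical_least[OF Y] c by blast
  qed
qed

text \<open>
  The annihilator of the coradical.  By \<open>inverse_exists\<close> below it consists of the nonunits, so it
  is the Jacobson radical of the dual algebra.
\<close>

definition J :: "('c \<Rightarrow> 'k) set" where
  "J = {f. functional scale f \<and> (\<forall>c\<in>coradical. f c = 0)}"

lemma J_functional: "f \<in> J \<Longrightarrow> functional scale f"
  by (simp add: J_def)

lemma J_conv_left: "f \<in> J \<Longrightarrow> functional scale h \<Longrightarrow> conv h f \<in> J"
  using coradical_stable functional_ract[of f h]
  by (auto simp: J_def conv_functional ract_stable_def) metis

lemma J_conv_right: "f \<in> J \<Longrightarrow> functional scale h \<Longrightarrow> conv f h \<in> J"
  using lact_coradical functional_lact[of f h]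
  by (auto simp: J_def conv_functional) metis

lemma J_add: "f \<in> J \<Longrightarrow> g \<in> J \<Longrightarrow> (\<lambda>c. f c + g c) \<in> J"
  by (simp add: J_def functional_add)

lemma counit_notin_J: "\<epsilon> \<notin> J"
proof
  assume "\<epsilon> \<in> J"
  then have *: "f c = 0" if "functional scale f" "c \<in> coradical" for f c
  proof -
    have "f \<in> J" using J_conv_left[OF \<open>\<epsilon> \<in> J\<close> that(1)] conv_counit(2)[OF that(1)] by simp
    then show ?thesis using that(2) by (simp add: J_def)
  qed
  have "c = 0" if "c \<in> coradical" for c
    by (rule functionals_separate) (simp add: * that functional_zero)
  then show False using coradical_nonzero coradical_stable subspace_0 by (auto simp: ract_stable_def)
qed

text \<open>
  The kernel of \<open>lact f\<close> is a left subcomodule.  It does not contain the coradical, so it is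
  zero.  Dualising, \<open>h \<mapsto> conv h f\<close> is onto.
\<close>

lemma left_inverse_exists:
  assumes f: "functional scale f" "f \<notin> J"
  obtains h where "functional scale h" "conv h f = \<epsilon>"
proof -
  have "\<not> coradical \<subseteq> {c. lact f c = 0}"
  proof
    assume "coradical \<subseteq> {c. lact f c = 0}"
    then have "f c = 0" if "c \<in> coradical" for c
      using counit_lact[OF f(1), of c] that functional_zero[OF counit_linear] by auto
    then show False using f by (simp add: J_def)
  qed
  then have inj: "{c. lact f c = 0} = {0}" using coradical_least[OF lact_kernel_stable[OF f(1)]] by blast
  have "\<epsilon> x = 0" if "lact f x = 0" for x
  proof -
    have "x \<in> {c. lact f c = 0}" using that by simp
    then have "x = 0" unfolding inj by simp
    then show ?thesis using functional_zero[OF counit_linear] by simp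
  qed
  then obtain h where h: "functional scale h" "\<And>x. h (lact f x) = \<epsilon> x"
    using functional_factors[OF lact_endo[OF f(1)] counit_linear] by blast
  have "conv h f = \<epsilon>" using h(2) functional_lact[OF h(1)] by auto
  then show ?thesis using that h(1) by blast
qed

lemma inverse_exists:
  assumes f: "functional scale f" "f \<notin> J"
  obtains h where "functional scale h" "conv h f = \<epsilon>" "conv f h = \<epsilon>" "h \<notin> J"
proof -
  obtain h where h: "functional scale h" "conv h f = \<epsilon>" by (rule left_inverse_exists[OF f])
  then have "h \<notin> J" using J_conv_right[OF _ f(1)] counit_notin_J by metis
  then obtain g where g: "functional scale g" "conv g h = \<epsilon>" using left_inverse_exists h(1) by blast
  have "g = conv g (conv h f)" using h g conv_counit by simp
  also have "\<dots> = f" using conv_assoc[of g h f] g h f conv_counit by simp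
  finally show ?thesis using that h g \<open>h \<notin> J\<close> by simp
qed

lemma ract_fixed_by_J:
  assumes f: "f \<in> J" and fixed: "ract f d = d"
  shows "d = 0"
proof -
  let ?u = "\<lambda>c. \<epsilon> c + (- 1) * f c"
  have u: "functional scale ?u" by (intro functional_add functional_scaled counit_linear J_functional f)
  have "?u \<notin> J" using f counit_notin_J by (auto simp: J_def counit_linear)
  then obtain v where v: "functional scale v" "conv ?u v = \<epsilon>" by (rule inverse_exists[OF u])
  have "ract ?u d = 0"
    using fixed ract_add[of \<epsilon> "\<lambda>c. (- 1) * f c" d] ract_scaled[of "- 1" f d] ract_counit by simp
  then have "ract \<epsilon> d = 0" using ract_conv[OF u v(1), of d] v(2) endo_zero[OF ract_endo[OF v(1)]] by simp
  then show ?thesis by (simp add: ract_counit)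
qed

text \<open>
  The orbits of the iterates \<open>(ract f ^^ n) c\<close> decrease inside a finite-dimensional space.  Where
  they become stationary, the vector \<open>d\<close> is reproduced by \<open>ract\<close> with an element of the radical,
  which is possible only for zero.
\<close>

lemma ract_locally_nilpotent:
  assumes f: "f \<in> J"
  obtains n where "(ract f ^^ n) c = 0"
proof -
  obtain n where n: "\<And>m. dim (ract_orbit ((ract f ^^ n) c)) \<le> dim (ract_orbit ((ract f ^^ m) c))"
    using ex_has_least_nat[of "\<lambda>_. True" 0 "\<lambda>n. dim (ract_orbit ((ract f ^^ n) c))"] by auto
  define d where "d = (ract f ^^ n) c"
  have fd: "ract f d \<in> ract_orbit d" using J_functional[OF f] by (auto simp: ract_orbit_def)
  have "ract_orbit (ract f d) = ract_orbit d"
  proof (rule ccontr)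
    assume "\<not> ?thesis"
    then have "ract_orbit (ract f d) \<subset> ract_orbit d"
      using ract_orbit_minimal[OF ract_orbit_stable fd] by blast
    then have "dim (ract_orbit (ract f d)) < dim (ract_orbit d)"
      using ract_orbit_stable ract_orbit_finite_dim
      by (intro dim_less_of_proper_subspace) (auto simp: ract_stable_def)
    then show False using n[of "Suc n"] by (simp add: d_def)
  qed
  then obtain g where g: "functional scale g" "d = ract g (ract f d)"
    using ract_orbit_self[of d] by (auto simp: ract_orbit_def)
  then have "ract (conv f g) d = d" using ract_conv[OF J_functional[OF f] g(1)] by simp
  then have "d = 0" using ract_fixed_by_J J_conv_right[OF f g(1)] by blast
  then show ?thesis using that[of n] by (simp add: d_def)
qed

end

section \<open>The socle consists of rational elements\<close>

lemma (in left_module) left_submoduleI: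
  assumes "H \<subseteq> carrier M" "\<zero>\<^bsub>M\<^esub> \<in> H"
    and "\<And>x y. x \<in> H \<Longrightarrow> y \<in> H \<Longrightarrow> x \<oplus>\<^bsub>M\<^esub> y \<in> H"
    and smult: "\<And>a x. a \<in> carrier R \<Longrightarrow> x \<in> H \<Longrightarrow> a \<odot>\<^bsub>M\<^esub> x \<in> H"
  shows "submodule H R M"
proof -
  have "\<ominus>\<^bsub>M\<^esub> x \<in> H" if "x \<in> H" for x
    using that assms(1) smult[of "\<ominus>\<^bsub>R\<^esub> \<one>\<^bsub>R\<^esub>"] by (auto simp: minus_eq_smult)
  then have "subgroup H (add_monoid M)"
    using assms by (intro M.add.subgroupI) (auto simp: a_inv_def)
  then show ?thesis using smult by (rule submodule.intro[OF _ submodule_axioms.intro])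
qed

lemma submodule_subset: "submodule H R M \<Longrightarrow> H \<subseteq> carrier M"
  by (metis submodule.axioms(1) subgroup.subset partial_object.select_convs(1) monoid.simps(1))

lemma submodule_add: "submodule H R M \<Longrightarrow> x \<in> H \<Longrightarrow> y \<in> H \<Longrightarrow> x \<oplus>\<^bsub>M\<^esub> y \<in> H"
  using subgroup.m_closed[OF submodule.axioms(1)] by fastforce

lemma submodule_zero: "submodule H R M \<Longrightarrow> \<zero>\<^bsub>M\<^esub> \<in> H"
  using subgroup.one_closed[OF submodule.axioms(1)] by fastforce

lemma submodule_smult: "submodule H R M \<Longrightarrow> a \<in> carrier R \<Longrightarrow> x \<in> H \<Longrightarrow> a \<odot>\<^bsub>M\<^esub> x \<in> H"
  by (rule submodule.smult_closed)

lemma list_sum_simps [simp]: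
  "list_sum M [] = \<zero>\<^bsub>M\<^esub>" "list_sum M (x # xs) = x \<oplus>\<^bsub>M\<^esub> list_sum M xs"
  by (simp_all add: list_sum_def)

lemma (in abelian_group) list_sum_closed: "set xs \<subseteq> carrier G \<Longrightarrow> list_sum G xs \<in> carrier G"
  by (induction xs) auto

lemma linear_in_slot_list_sum:
  assumes "abelian_group V" "linear_in_slot V F" "set xs \<subseteq> carrier V"
  shows "F (list_sum V xs) = (\<Sum>x\<leftarrow>xs. F x)"
proof -
  interpret abelian_group V by fact
  have "F (\<zero>\<^bsub>V\<^esub> \<oplus>\<^bsub>V\<^esub> \<zero>\<^bsub>V\<^esub>) = F \<zero>\<^bsub>V\<^esub> + F \<zero>\<^bsub>V\<^esub>"
    using assms(2) zero_closed unfolding linear_in_slot_def by blast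
  then have "F \<zero>\<^bsub>V\<^esub> = F \<zero>\<^bsub>V\<^esub> + F \<zero>\<^bsub>V\<^esub>" unfolding r_zero[OF zero_closed] .
  then have "F \<zero>\<^bsub>V\<^esub> = 0" by (rule add_cancel_right_right[THEN iffD1])
  then show ?thesis
    using assms(2,3) list_sum_closed by (induction xs) (auto simp: linear_in_slot_def)
qed

context coalgebra
begin

lemma dual_algebra_simps [simp]:
  "carrier dual_algebra = {f. functional scale f}" "x \<otimes>\<^bsub>dual_algebra\<^esub> y = conv x y"
  "\<one>\<^bsub>dual_algebra\<^esub> = \<epsilon>" "\<zero>\<^bsub>dual_algebra\<^esub> = (\<lambda>_. 0)" "x \<oplus>\<^bsub>dual_algebra\<^esub> y = (\<lambda>c. x c + y c)"
  by (simp_all add: dual_algebra_def conv_def[abs_def])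

text \<open>
  The base field inside the dual algebra.  It turns a module over the dual algebra into a vector
  space, the one on which a comodule structure has to be found.
\<close>

definition embed :: "'k \<Rightarrow> 'c \<Rightarrow> 'k" where
  "embed k = (\<lambda>c. k * \<epsilon> c)"

lemma embed_functional: "functional scale (embed k)"
  unfolding embed_def by (intro functional_scaled counit_linear)

lemma conv_scaled:
  "conv (\<lambda>c. k * f c) g = (\<lambda>c. k * conv f g c)" "conv f (\<lambda>c. k * g c) = (\<lambda>c. k * conv f g c)"
  by (auto simp: conv_def[abs_def] split_def mult.assoc sum_list_const_mult[symmetric] mult.left_commute)

lemma conv_embed:
  assumes "functional scale f"
  shows "conv (embed k) f = (\<lambda>c. k * f c)" "conv f (embed k) = (\<lambda>c. k * f c)"
  using conv_counit[OF assms] by (simp_all add: embed_def conv_scaled)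

lemma embed_simps:
  "embed (k + l) = (\<lambda>c. embed k c + embed l c)" "conv (embed k) (embed l) = embed (k * l)"
  "embed 1 = \<epsilon>"
  by (auto simp: conv_embed[OF embed_functional]) (auto simp: embed_def algebra_simps)

text \<open>
  A rational element has a finite coaction \<open>\<Sum> u \<otimes> c\<close>, and a functional that vanishes on the
  finitely many \<open>c\<close> kills it.  The property passes to sums of rational elements.
\<close>

lemma Rat_finite_support:
  assumes "left_module dual_algebra M" "m \<in> Rat M"
  obtains S where "finite S" "\<And>f. functional scale f \<Longrightarrow> (\<And>s. s \<in> S \<Longrightarrow> f s = 0) \<Longrightarrow> f \<odot>\<^bsub>M\<^esub> m = \<zero>\<^bsub>M\<^esub>"
proof -
  interpret left_module dual_algebra M by fact
  let ?P = "\<lambda>m. m \<in> carrier M \<and> (\<exists>S. finite S \<and>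
    (\<forall>f. functional scale f \<longrightarrow> (\<forall>s\<in>S. f s = 0) \<longrightarrow> f \<odot>\<^bsub>M\<^esub> m = \<zero>\<^bsub>M\<^esub>))"
  have rational: "?P m" if N: "submodule N dual_algebra M" "rational (M\<lparr>carrier := N\<rparr>)" "m \<in> N" for N m
  proof -
    obtain V \<rho> where V: "right_comodule V \<rho>" "carrier V = N" "add V = add M" "\<zero>\<^bsub>V\<^esub> = \<zero>\<^bsub>M\<^esub>"
      "\<And>f m. functional scale f \<Longrightarrow> m \<in> N \<Longrightarrow> f \<odot>\<^bsub>M\<^esub> m = list_sum V [f c \<odot>\<^bsub>V\<^esub> u. (u, c) \<leftarrow> \<rho> m]"
      using N(2) unfolding rational_def by auto
    have mod: "Module.module ring_of_type_algebra V" and \<rho>: "set (\<rho> m) \<subseteq> N \<times> UNIV"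
      using V(1,2) N(3) unfolding right_comodule_def by auto
    interpret V: Module.module ring_of_type_algebra V by (rule mod)
    have null: "0 \<odot>\<^bsub>V\<^esub> u = \<zero>\<^bsub>V\<^esub>" if "u \<in> N" for u
      using V.smult_l_null[of u] that V(2) by (simp add: ring_of_type_algebra_def)
    have "list_sum V [f c \<odot>\<^bsub>V\<^esub> u. (u, c) \<leftarrow> xs] = \<zero>\<^bsub>V\<^esub>"
      if "\<And>s. s \<in> snd ` set (\<rho> m) \<Longrightarrow> f s = 0" "set xs \<subseteq> set (\<rho> m)" for f xs
      using that(2)
    proof (induction xs)
      case (Cons x xs)
      obtain u c where x: "x = (u, c)" by (cases x)
      have "u \<in> N" "f c = 0" using Cons.prems \<rho> that(1)[of c] x by force+
      then show ?case using Cons null x by simp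
    qed simp
    then have "f \<odot>\<^bsub>M\<^esub> m = \<zero>\<^bsub>M\<^esub>" if "functional scale f" "\<And>s. s \<in> snd ` set (\<rho> m) \<Longrightarrow> f s = 0" for f
      using that V(4,5) N(3) by auto
    moreover have "finite (snd ` set (\<rho> m))" by simp
    moreover have "m \<in> carrier M" using submodule_subset[OF N(1)] N(3) by blast
    ultimately show ?thesis by blast
  qed
  have add: "?P (x \<oplus>\<^bsub>M\<^esub> y)" if x: "?P x" and y: "?P y" for x y
  proof -
    obtain S where S: "finite S"
      "\<And>f. functional scale f \<Longrightarrow> \<forall>s\<in>S. f s = 0 \<Longrightarrow> f \<odot>\<^bsub>M\<^esub> x = \<zero>\<^bsub>M\<^esub>" using x by blast
    obtain T where T: "finite T"
      "\<And>f. functional scale f \<Longrightarrow> \<forall>s\<in>T. f s = 0 \<Longrightarrow> f \<odot>\<^bsub>M\<^esub> y = \<zero>\<^bsub>M\<^esub>" using y by blast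
    have "f \<odot>\<^bsub>M\<^esub> (x \<oplus>\<^bsub>M\<^esub> y) = \<zero>\<^bsub>M\<^esub>" if "functional scale f" "\<forall>s\<in>S \<union> T. f s = 0" for f
      using that S(2) T(2) x y by (simp add: smult_r_distr)
    moreover have "finite (S \<union> T)" using S T by simp
    ultimately show ?thesis using x y by blast
  qed
  have zero: "?P \<zero>\<^bsub>M\<^esub>" using smult_r_null by (auto intro!: exI[of _ "{}"])
  obtain xs where xs: "m = list_sum M xs"
    "set xs \<subseteq> \<Union>{N. submodule N dual_algebra M \<and> rational (M\<lparr>carrier := N\<rparr>)}"
    using assms(2) unfolding Rat_def by blast
  have "?P (list_sum M xs)" using xs(2)
  proof (induction xs)
    case Nil
    then show ?case using zero by simp
  next
    case (Cons x xs)
    then obtain N where "submodule N dual_algebra M" "rational (M\<lparr>carrier := N\<rparr>)" "x \<in> N" by auto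
    then have "?P x" by (rule rational)
    moreover have "?P (list_sum M xs)" using Cons by auto
    ultimately have "?P (x \<oplus>\<^bsub>M\<^esub> list_sum M xs)" by (rule add)
    then show ?case by (simp only: list_sum_simps)
  qed
  then show ?thesis using that xs(1) by blast
qed

end

context colocal_coalgebra
begin

definition socle :: "('c \<Rightarrow> 'k, 'm) module \<Rightarrow> 'm set" where
  "socle M = {m \<in> carrier M. \<forall>f\<in>J. f \<odot>\<^bsub>M\<^esub> m = \<zero>\<^bsub>M\<^esub>}"

lemma socle_submodule:
  assumes "left_module dual_algebra M"
  shows "submodule (socle M) dual_algebra M"
proof -
  interpret left_module dual_algebra M by fact
  show ?thesis
  proof (rule left_submoduleI)
    fix a x assume a: "a \<in> carrier dual_algebra" and x: "x \<in> socle M"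
    have "f \<odot>\<^bsub>M\<^esub> (a \<odot>\<^bsub>M\<^esub> x) = \<zero>\<^bsub>M\<^esub>" if "f \<in> J" for f
      using that smult_assoc1[of f a x] a x J_conv_right[OF that] J_functional[OF that]
      by (simp add: socle_def)
    then show "a \<odot>\<^bsub>M\<^esub> x \<in> socle M" using a x by (simp add: socle_def)
  qed (auto simp: socle_def smult_r_distr smult_r_null J_functional)
qed

lemma coradical_coordinates:
  obtains bs e where "distinct bs" "set bs \<subseteq> coradical" "\<And>b. functional scale (e b)"
    "\<And>x. x \<in> coradical \<Longrightarrow> (\<Sum>b\<in>set bs. scale (e b x) b) = x"
proof -
  obtain B where B: "B \<subseteq> coradical" "independent B" "span B = coradical" "finite B"
    by (rule finite_dim_basis[OF coradical_finite_dim coradical_stable[unfolded ract_stable_def, THEN conjunct1]])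
  obtain e where e: "\<And>b. functional scale (e b)"
    "\<And>x. x \<in> coradical \<Longrightarrow> (\<Sum>b\<in>B. scale (e b x) b) = x"
    using coordinate_functionals[OF B(2,4)] B(3) by metis
  obtain bs where "set bs = B" "distinct bs" using finite_distinct_list[OF B(4)] by blast
  then show ?thesis using that[of bs e] B(1) e by simp
qed

text \<open>
  The coradical is stable under both actions, so its comultiplication lands in the tensor square
  of the coradical; in the coordinates \<open>e\<close> the coefficients of \<open>\<Delta> x\<close> are the values of products of
  coordinate functionals.  Here this is expressed after applying a bilinear form.
\<close>

lemma comult_coradical:
  assumes e: "\<And>b. functional scale (e b)" "\<And>x. x \<in> coradical \<Longrightarrow> (\<Sum>b\<in>B. scale (e b x) b) = x"
    and G: "\<And>b. functional scale (\<lambda>a. G a b)" "\<And>a. functional scale (G a)"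
    and x: "x \<in> coradical"
  shows "(\<Sum>(y, z)\<leftarrow>\<Delta> x. G y z) = (\<Sum>b\<in>B. \<Sum>b'\<in>B. conv (e b') (e b) x * G b' b)"
proof -
  obtain t where t: "set t \<subseteq> UNIV \<times> coradical" "tensor2_eq (space_of scale) (space_of scale) (\<Delta> x) t"
    using coradical_simple x unfolding simple_left_subcomodule_def left_subcomodule_def by blast
  have expand: "F z = (\<Sum>b\<in>B. e b z * F b)" if "functional scale F" "z \<in> coradical" for F z
  proof -
    have "F z = F (\<Sum>b\<in>B. scale (e b z) b)" using e(2)[OF that(2)] by simp
    also have "\<dots> = (\<Sum>b\<in>B. e b z * F b)"
      using that(1) by (simp add: functional_sum[OF that(1)] functional_iff)
    finally show ?thesis .
  qed
  have "(\<Sum>(y, z)\<leftarrow>\<Delta> x. G y z) = (\<Sum>(y, z)\<leftarrow>t. G y z)"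
    by (rule tensor2_eq_bilinear[OF t(2) G])
  also have "\<dots> = (\<Sum>(y, z)\<leftarrow>t. \<Sum>b\<in>B. e b z * G y b)"
    using t(1) by (intro arg_cong[where f = sum_list] map_cong) (auto intro!: expand G)
  also have "\<dots> = (\<Sum>b\<in>B. \<Sum>(y, z)\<leftarrow>t. e b z * G y b)"
    by (simp add: split_def sum_list_over_sum)
  also have "\<dots> = (\<Sum>b\<in>B. \<Sum>(y, z)\<leftarrow>\<Delta> x. e b z * G y b)"
  proof (rule sum.cong[OF refl])
    fix b
    show "(\<Sum>(y, z)\<leftarrow>t. e b z * G y b) = (\<Sum>(y, z)\<leftarrow>\<Delta> x. e b z * G y b)"
      by (rule tensor2_eq_bilinear[OF t(2), symmetric])
        (use e(1)[of b] G(1)[of b] in \<open>auto simp: functional_iff algebra_simps\<close>)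
  qed
  also have "\<dots> = (\<Sum>b\<in>B. G (lact (e b) x) b)"
    using functional_lact[OF G(1)] by (simp add: conv_def mult.commute)
  also have "\<dots> = (\<Sum>b\<in>B. \<Sum>b'\<in>B. e b' (lact (e b) x) * G b' b)"
    by (intro sum.cong refl expand[OF G(1)] lact_coradical e x)
  also have "\<dots> = (\<Sum>b\<in>B. \<Sum>b'\<in>B. conv (e b') (e b) x * G b' b)"
    by (simp add: functional_lact e)
  finally show ?thesis .
qed

text \<open>
  The functional \<open>g\<close> agrees on the coradical with the combination of the coordinate functionals
  with coefficients \<open>g b\<close>, and the difference, being in \<open>J\<close>, kills the socle.
\<close>

lemma socle_action:
  assumes "left_module dual_algebra M" "m \<in> socle M"
    and B: "distinct bs" "set bs \<subseteq> coradical"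
    and e: "\<And>b. functional scale (e b)" "\<And>x. x \<in> coradical \<Longrightarrow> (\<Sum>b\<in>set bs. scale (e b x) b) = x"
    and g: "functional scale g"
  shows "g \<odot>\<^bsub>M\<^esub> m = list_sum M [embed (g b) \<odot>\<^bsub>M\<^esub> (e b \<odot>\<^bsub>M\<^esub> m). b \<leftarrow> bs]"
proof -
  interpret left_module dual_algebra M by fact
  have m: "m \<in> carrier M" using assms(2) by (simp add: socle_def)
  define h where "h xs = (\<lambda>c. \<Sum>b\<leftarrow>xs. g b * e b c)" for xs
  have h: "functional scale (h xs)" for xs
    using e(1) by (induction xs) (auto simp: h_def functional_iff algebra_simps)
  have act: "h xs \<odot>\<^bsub>M\<^esub> m = list_sum M [embed (g b) \<odot>\<^bsub>M\<^esub> (e b \<odot>\<^bsub>M\<^esub> m). b \<leftarrow> xs]" for xs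
  proof (induction xs)
    case Nil
    then show ?case using smult_l_null[OF m] by (simp add: h_def)
  next
    case (Cons b xs)
    have *: "conv (embed (g b)) (e b) \<odot>\<^bsub>M\<^esub> m = embed (g b) \<odot>\<^bsub>M\<^esub> (e b \<odot>\<^bsub>M\<^esub> m)"
      using smult_assoc1[of "embed (g b)" "e b" m] m e embed_functional by simp
    have "h (b # xs) = (\<lambda>c. conv (embed (g b)) (e b) c + h xs c)"
      using conv_embed[OF e(1)] by (simp add: h_def)
    then have "h (b # xs) \<odot>\<^bsub>M\<^esub> m = conv (embed (g b)) (e b) \<odot>\<^bsub>M\<^esub> m \<oplus>\<^bsub>M\<^esub> h xs \<odot>\<^bsub>M\<^esub> m"
      using smult_l_distr[of "conv (embed (g b)) (e b)" "h xs" m] m h e embed_functional conv_functional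
      by simp
    then show ?case using Cons * by simp
  qed
  let ?r = "\<lambda>c. g c - h bs c"
  have "g c = h bs c" if "c \<in> coradical" for c
  proof -
    have "g c = g (\<Sum>b\<in>set bs. scale (e b c) b)" using e(2) that by simp
    also have "\<dots> = (\<Sum>b\<in>set bs. g b * e b c)"
      using g by (simp add: functional_sum[OF g] functional_iff mult.commute)
    also have "\<dots> = h bs c" using B(1) by (simp add: h_def sum_list_distinct_conv_sum_set)
    finally show ?thesis .
  qed
  then have "?r \<in> J" using functional_minus[OF g h] by (simp add: J_def)
  then have "?r \<odot>\<^bsub>M\<^esub> m = \<zero>\<^bsub>M\<^esub>" using assms(2) by (simp add: socle_def)
  then have "g \<odot>\<^bsub>M\<^esub> m = h bs \<odot>\<^bsub>M\<^esub> m"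
    using smult_l_distr[of ?r "h bs" m] m h functional_minus[OF g h] by simp
  then show ?thesis using act by simp
qed

text \<open>
  The coaction is \<open>\<rho> v = \<Sum> (e b \<cdot> v) \<otimes> b\<close> over a basis of the coradical; \<open>socle_action\<close> says that
  it induces the module structure.  Coassociativity compares the products \<open>e b' \<cdot> (e b \<cdot> v)\<close> with
  the comultiplication of the basis vectors, which is \<open>comult_coradical\<close>.
\<close>

lemma socle_rational:
  fixes M :: "('c \<Rightarrow> 'k, 'm) module"
  assumes "left_module dual_algebra M"
  shows "rational (M\<lparr>carrier := socle M\<rparr>)"
proof -
  interpret left_module dual_algebra M by fact
  interpret S: submodule "socle M" dual_algebra M by (rule socle_submodule[OF assms])
  have N: "x \<in> carrier M" if "x \<in> socle M" for x using that by (simp add: socle_def)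
  obtain bs e where bs: "distinct bs" "set bs \<subseteq> coradical" and e: "\<And>b. functional scale (e b)"
    "\<And>x. x \<in> coradical \<Longrightarrow> (\<Sum>b\<in>set bs. scale (e b x) b) = x"
    using coradical_coordinates by metis
  define B where "B = set bs"
  define V :: "('k, 'm) module" where
    "V = \<lparr>carrier = socle M, monoid.mult = undefined, one = undefined, ring.zero = \<zero>\<^bsub>M\<^esub>,
       add = add M, module.smult = (\<lambda>k m. embed k \<odot>\<^bsub>M\<^esub> m)\<rparr>"
  define \<rho> where "\<rho> m = map (\<lambda>b. (e b \<odot>\<^bsub>M\<^esub> m, b)) bs" for m
  have V: "carrier V = socle M" "\<zero>\<^bsub>V\<^esub> = \<zero>\<^bsub>M\<^esub>" "add V = add M" "k \<odot>\<^bsub>V\<^esub> m = embed k \<odot>\<^bsub>M\<^esub> m" for k m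
    by (simp_all add: V_def)
  have ls: "list_sum V = list_sum M" by (auto simp: list_sum_def V)
  have cl: "f \<odot>\<^bsub>M\<^esub> m \<in> socle M" if "functional scale f" "m \<in> socle M" for f m
    using S.smult_closed that by simp
  have ab: "abelian_group V"
  proof (rule abelian_groupI)
    fix x assume x: "x \<in> carrier V"
    have "\<ominus>\<^bsub>M\<^esub> x \<in> socle M"
      using cl[of "\<ominus>\<^bsub>dual_algebra\<^esub> \<one>\<^bsub>dual_algebra\<^esub>" x] x R.a_inv_closed[OF R.one_closed] N
      by (simp add: minus_eq_smult V del: R.a_inv_closed)
    then show "\<exists>y\<in>carrier V. y \<oplus>\<^bsub>V\<^esub> x = \<zero>\<^bsub>V\<^esub>" using x N[of x] by (intro bexI[of _ "\<ominus>\<^bsub>M\<^esub> x"]) (simp_all add: V M.l_neg)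
  next
    fix x y z assume "x \<in> carrier V" "y \<in> carrier V" "z \<in> carrier V"
    then show "x \<oplus>\<^bsub>V\<^esub> y \<oplus>\<^bsub>V\<^esub> z = x \<oplus>\<^bsub>V\<^esub> (y \<oplus>\<^bsub>V\<^esub> z)" using N by (simp add: V M.a_assoc)
  next
    fix x y assume "x \<in> carrier V" "y \<in> carrier V"
    then show "x \<oplus>\<^bsub>V\<^esub> y = y \<oplus>\<^bsub>V\<^esub> x" "x \<oplus>\<^bsub>V\<^esub> y \<in> carrier V"
      using N M.a_comm submodule_add[OF S.submodule_axioms] by (simp_all add: V)
  qed (use N submodule_zero[OF S.submodule_axioms] in \<open>simp_all add: V\<close>)
  have K: "carrier (ring_of_type_algebra :: 'k ring) = UNIV" "\<one>\<^bsub>ring_of_type_algebra\<^esub> = (1 :: 'k)"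
    "x \<oplus>\<^bsub>ring_of_type_algebra\<^esub> y = (x + y :: 'k)" "x \<otimes>\<^bsub>ring_of_type_algebra\<^esub> y = (x * y :: 'k)" for x y
    by (simp_all add: ring_of_type_algebra_def)
  have mod: "Module.module (ring_of_type_algebra :: 'k ring) V"
  proof (rule moduleI[OF cring_from_type_algebra ab])
    fix a b :: 'k and x y assume x: "x \<in> carrier V"
    note [simp] = embed_functional
    show "a \<odot>\<^bsub>V\<^esub> x \<in> carrier V" using x cl by (simp add: V)
    show "(a \<oplus>\<^bsub>ring_of_type_algebra\<^esub> b) \<odot>\<^bsub>V\<^esub> x = a \<odot>\<^bsub>V\<^esub> x \<oplus>\<^bsub>V\<^esub> b \<odot>\<^bsub>V\<^esub> x"
      using x N smult_l_distr[of "embed a" "embed b" x] by (simp add: V K embed_simps)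
    show "(a \<otimes>\<^bsub>ring_of_type_algebra\<^esub> b) \<odot>\<^bsub>V\<^esub> x = a \<odot>\<^bsub>V\<^esub> (b \<odot>\<^bsub>V\<^esub> x)"
      using x N smult_assoc1[of "embed a" "embed b" x] by (simp add: V K embed_simps)
    show "\<one>\<^bsub>ring_of_type_algebra\<^esub> \<odot>\<^bsub>V\<^esub> x = x"
      using x N smult_one[of x] by (simp add: V K embed_simps)
    assume "y \<in> carrier V"
    then show "a \<odot>\<^bsub>V\<^esub> (x \<oplus>\<^bsub>V\<^esub> y) = a \<odot>\<^bsub>V\<^esub> x \<oplus>\<^bsub>V\<^esub> a \<odot>\<^bsub>V\<^esub> y"
      using x N smult_r_distr[of "embed a" x y] by (simp add: V)
  qed
  have act: "g \<odot>\<^bsub>M\<^esub> m = list_sum V [g b \<odot>\<^bsub>V\<^esub> (e b \<odot>\<^bsub>M\<^esub> m). b \<leftarrow> bs]"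
    if "functional scale g" "m \<in> socle M" for g m
    using socle_action[OF assms that(2) bs e that(1)] by (simp add: ls V)
  have set\<rho>: "set (\<rho> v) \<subseteq> carrier V \<times> UNIV" if "v \<in> carrier V" for v
    using cl e that by (auto simp: \<rho>_def V)
  have sum\<rho>: "(\<Sum>t\<leftarrow>\<rho> v. F t) = (\<Sum>b\<in>B. F (e b \<odot>\<^bsub>M\<^esub> v, b))" for F :: "_ \<Rightarrow> 'k" and v
    using bs by (simp add: B_def \<rho>_def o_def sum_list_distinct_conv_sum_set)
  have "tensor2_eq V (space_of scale) (\<rho> (v \<oplus>\<^bsub>V\<^esub> w)) (\<rho> v @ \<rho> w)"
    if "v \<in> carrier V" "w \<in> carrier V" for v w
  proof (rule tensor2_eqI)
    fix F :: "'m \<times> 'c \<Rightarrow> 'k"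
    assume F: "\<And>c. c \<in> carrier (space_of scale) \<Longrightarrow> linear_in_slot V (\<lambda>u. F (u, c))"
    have "F (e b \<odot>\<^bsub>M\<^esub> (v \<oplus>\<^bsub>V\<^esub> w), b) = F (e b \<odot>\<^bsub>M\<^esub> v, b) + F (e b \<odot>\<^bsub>M\<^esub> w, b)" for b
      using F[of b] cl[OF e(1)] that N e(1)
      by (simp add: V smult_r_distr space_of_def linear_in_slot_def)
    then show "(\<Sum>t\<leftarrow>\<rho> (v \<oplus>\<^bsub>V\<^esub> w). F t) = (\<Sum>t\<leftarrow>\<rho> v @ \<rho> w. F t)"
      by (simp add: sum\<rho> sum.distrib)
  qed
  moreover have "tensor2_eq V (space_of scale) (\<rho> (k \<odot>\<^bsub>V\<^esub> v)) [(k \<odot>\<^bsub>V\<^esub> u, c). (u, c) \<leftarrow> \<rho> v]"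
    if v: "v \<in> carrier V" for k v
  proof (rule tensor2_eqI)
    fix F :: "'m \<times> 'c \<Rightarrow> 'k"
    have "e b \<odot>\<^bsub>M\<^esub> (embed k \<odot>\<^bsub>M\<^esub> v) = embed k \<odot>\<^bsub>M\<^esub> (e b \<odot>\<^bsub>M\<^esub> v)" for b
      using smult_assoc1[of "e b" "embed k" v] smult_assoc1[of "embed k" "e b" v] e(1) v N
        embed_functional conv_embed[OF e(1)] by (simp add: V)
    then have "\<rho> (k \<odot>\<^bsub>V\<^esub> v) = [(k \<odot>\<^bsub>V\<^esub> u, c). (u, c) \<leftarrow> \<rho> v]" by (simp add: \<rho>_def V)
    then show "(\<Sum>t\<leftarrow>\<rho> (k \<odot>\<^bsub>V\<^esub> v). F t) = (\<Sum>t\<leftarrow>[(k \<odot>\<^bsub>V\<^esub> u, c). (u, c) \<leftarrow> \<rho> v]. F t)" by simp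
  qed
  moreover have "tensor3_eq V (space_of scale) (space_of scale)
        [(u0, u1, c). (u, c) \<leftarrow> \<rho> v, (u0, u1) \<leftarrow> \<rho> u]
        [(u, c1, c2). (u, c) \<leftarrow> \<rho> v, (c1, c2) \<leftarrow> \<Delta> c]"
    if v: "v \<in> carrier V" for v
  proof (rule tensor3_eqI)
    fix F :: "'m \<times> 'c \<times> 'c \<Rightarrow> 'k"
    assume F1: "\<And>x y. x \<in> carrier (space_of scale) \<Longrightarrow> y \<in> carrier (space_of scale) \<Longrightarrow>
        linear_in_slot V (\<lambda>u. F (u, x, y))"
      and F2: "\<And>u y. u \<in> carrier V \<Longrightarrow> y \<in> carrier (space_of scale) \<Longrightarrow>
        linear_in_slot (space_of scale) (\<lambda>x. F (u, x, y))"
      and F3: "\<And>u x. u \<in> carrier V \<Longrightarrow> x \<in> carrier (space_of scale) \<Longrightarrow>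
        linear_in_slot (space_of scale) (\<lambda>y. F (u, x, y))"
    have uni: "carrier (space_of scale) = UNIV" by (simp add: space_of_def)
    have Fe: "F (g \<odot>\<^bsub>M\<^esub> v, x, y) = (\<Sum>d\<in>B. g d * F (e d \<odot>\<^bsub>M\<^esub> v, x, y))"
      if "functional scale g" for g x y
    proof -
      have lin: "linear_in_slot V (\<lambda>u. F (u, x, y))" using F1 uni by simp
      have in_V: "set [g b \<odot>\<^bsub>V\<^esub> (e b \<odot>\<^bsub>M\<^esub> v). b \<leftarrow> bs] \<subseteq> carrier V"
        using v cl e(1) embed_functional by (auto simp: V)
      have "F (g \<odot>\<^bsub>M\<^esub> v, x, y) = (\<Sum>u\<leftarrow>[g b \<odot>\<^bsub>V\<^esub> (e b \<odot>\<^bsub>M\<^esub> v). b \<leftarrow> bs]. F (u, x, y))"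
        unfolding act[OF that v[unfolded V]] by (rule linear_in_slot_list_sum[OF ab lin in_V])
      also have "\<dots> = (\<Sum>b\<in>B. F (g b \<odot>\<^bsub>V\<^esub> (e b \<odot>\<^bsub>M\<^esub> v), x, y))"
        using bs by (simp add: B_def o_def sum_list_distinct_conv_sum_set)
      also have "\<dots> = (\<Sum>d\<in>B. g d * F (e d \<odot>\<^bsub>M\<^esub> v, x, y))"
        using lin cl[OF e(1)] v unfolding linear_in_slot_def V by (intro sum.cong) auto
      finally show ?thesis .
    qed
    have nest: "e b' \<odot>\<^bsub>M\<^esub> (e b \<odot>\<^bsub>M\<^esub> v) = conv (e b') (e b) \<odot>\<^bsub>M\<^esub> v" for b b'
      using smult_assoc1[of "e b'" "e b" v] e(1) v N by (simp add: V)
    have concat: "(\<Sum>t\<leftarrow>[(u0, u1, c). (u, c) \<leftarrow> xs, (u0, u1) \<leftarrow> \<rho> u]. F t) =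
        (\<Sum>(u, c)\<leftarrow>xs. \<Sum>(u0, u1)\<leftarrow>\<rho> u. F (u0, u1, c))"
      "(\<Sum>t\<leftarrow>[(u, c1, c2). (u, c) \<leftarrow> xs, (c1, c2) \<leftarrow> \<Delta> c]. F t) =
        (\<Sum>(u, c)\<leftarrow>xs. \<Sum>(c1, c2)\<leftarrow>\<Delta> c. F (u, c1, c2))" for xs
      by (induction xs) (auto simp: o_def split_def)
    have "(\<Sum>t\<leftarrow>[(u0, u1, c). (u, c) \<leftarrow> \<rho> v, (u0, u1) \<leftarrow> \<rho> u]. F t) =
        (\<Sum>b\<in>B. \<Sum>b'\<in>B. F (conv (e b') (e b) \<odot>\<^bsub>M\<^esub> v, b', b))"
      unfolding concat by (simp add: sum\<rho> nest)
    also have "\<dots> = (\<Sum>b\<in>B. \<Sum>b'\<in>B. \<Sum>d\<in>B. conv (e b') (e b) d * F (e d \<odot>\<^bsub>M\<^esub> v, b', b))"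
      by (intro sum.cong refl Fe conv_functional e)
    also have "\<dots> = (\<Sum>b\<in>B. \<Sum>d\<in>B. \<Sum>b'\<in>B. conv (e b') (e b) d * F (e d \<odot>\<^bsub>M\<^esub> v, b', b))"
      by (rule sum.cong[OF refl sum.swap])
    also have "\<dots> = (\<Sum>d\<in>B. \<Sum>b\<in>B. \<Sum>b'\<in>B. conv (e b') (e b) d * F (e d \<odot>\<^bsub>M\<^esub> v, b', b))"
      by (rule sum.swap)
    also have "\<dots> = (\<Sum>d\<in>B. \<Sum>(x, y)\<leftarrow>\<Delta> d. F (e d \<odot>\<^bsub>M\<^esub> v, x, y))"
    proof (rule sum.cong[OF refl])
      fix d assume "d \<in> B"
      then have d: "d \<in> coradical" using bs B_def by auto
      have u: "e d \<odot>\<^bsub>M\<^esub> v \<in> carrier V" using cl e(1) v by (simp add: V)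
      show "(\<Sum>b\<in>B. \<Sum>b'\<in>B. conv (e b') (e b) d * F (e d \<odot>\<^bsub>M\<^esub> v, b', b)) =
          (\<Sum>(x, y)\<leftarrow>\<Delta> d. F (e d \<odot>\<^bsub>M\<^esub> v, x, y))"
        using F2[OF u] F3[OF u] uni
        by (intro comult_coradical[OF e[folded B_def] _ _ d, symmetric]) (auto simp: linear_in_slot_space_of)
    qed
    also have "\<dots> = (\<Sum>t\<leftarrow>[(u, c1, c2). (u, c) \<leftarrow> \<rho> v, (c1, c2) \<leftarrow> \<Delta> c]. F t)"
      unfolding concat by (simp add: sum\<rho>)
    finally show "(\<Sum>t\<leftarrow>[(u0, u1, c). (u, c) \<leftarrow> \<rho> v, (u0, u1) \<leftarrow> \<rho> u]. F t) =
        (\<Sum>t\<leftarrow>[(u, c1, c2). (u, c) \<leftarrow> \<rho> v, (c1, c2) \<leftarrow> \<Delta> c]. F t)" .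
  qed
  moreover have "list_sum V [g c \<odot>\<^bsub>V\<^esub> u. (u, c) \<leftarrow> \<rho> m] = g \<odot>\<^bsub>M\<^esub> m"
    if "functional scale g" "m \<in> socle M" for g m
    using act[OF that] by (simp add: \<rho>_def o_def)
  moreover from this have "list_sum V [\<epsilon> c \<odot>\<^bsub>V\<^esub> u. (u, c) \<leftarrow> \<rho> v] = v" if "v \<in> carrier V" for v
    using that N smult_one[of v] counit_linear by (simp add: V)
  ultimately have "right_comodule V \<rho>" using mod set\<rho> unfolding right_comodule_def by blast
  then show ?thesis
    unfolding rational_def using V act \<open>\<And>m g. functional scale g \<Longrightarrow> m \<in> socle M \<Longrightarrow> list_sum V [g c \<odot>\<^bsub>V\<^esub> u. (u, c) \<leftarrow> \<rho> m] = g \<odot>\<^bsub>M\<^esub> m\<close>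
    by (intro exI[of _ V] exI[of _ \<rho>]) simp
qed

lemma socle_subset_Rat:
  fixes M :: "('c \<Rightarrow> 'k, 'm) module"
  assumes "left_module dual_algebra M"
  shows "socle M \<subseteq> Rat M"
proof
  interpret left_module dual_algebra M by fact
  fix m assume m: "m \<in> socle M"
  have "m = list_sum M [m]" using m by (simp add: socle_def)
  then show "m \<in> Rat M"
    using m socle_submodule[OF assms] socle_rational[OF assms] unfolding Rat_def
    by (intro CollectI exI[of _ "[m]"]) auto
qed

end

section \<open>Splitting the quotients of a free module of rank two\<close>

definition pair_module :: "('r, 'y) ring_scheme \<Rightarrow> ('r, 'r \<times> 'r) module" where
  "pair_module R = \<lparr>carrier = carrier R \<times> carrier R, monoid.mult = undefined, one = undefined,
     ring.zero = (\<zero>\<^bsub>R\<^esub>, \<zero>\<^bsub>R\<^esub>), add = (\<lambda>(a, b) (c, d). (a \<oplus>\<^bsub>R\<^esub> c, b \<oplus>\<^bsub>R\<^esub> d)),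
     module.smult = (\<lambda>f (a, b). (f \<otimes>\<^bsub>R\<^esub> a, f \<otimes>\<^bsub>R\<^esub> b))\<rparr>"

lemma pair_module_simps [simp]:
  "carrier (pair_module R) = carrier R \<times> carrier R"
  "\<zero>\<^bsub>pair_module R\<^esub> = (\<zero>\<^bsub>R\<^esub>, \<zero>\<^bsub>R\<^esub>)"
  "(a, b) \<oplus>\<^bsub>pair_module R\<^esub> (c, d) = (a \<oplus>\<^bsub>R\<^esub> c, b \<oplus>\<^bsub>R\<^esub> d)"
  "f \<odot>\<^bsub>pair_module R\<^esub> (a, b) = (f \<otimes>\<^bsub>R\<^esub> a, f \<otimes>\<^bsub>R\<^esub> b)"
  by (simp_all add: pair_module_def)

lemma left_module_pair_module:
  assumes "ring R"
  shows "left_module R (pair_module R)"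
proof -
  interpret ring R by fact
  have "abelian_group (pair_module R)"
  proof (rule abelian_groupI)
    fix x assume "x \<in> carrier (pair_module R)"
    then obtain a b where "x = (a, b)" "a \<in> carrier R" "b \<in> carrier R" by auto
    then show "\<exists>y\<in>carrier (pair_module R). y \<oplus>\<^bsub>pair_module R\<^esub> x = \<zero>\<^bsub>pair_module R\<^esub>"
      by (intro bexI[of _ "(\<ominus>\<^bsub>R\<^esub> a, \<ominus>\<^bsub>R\<^esub> b)"]) (auto simp: l_neg)
  next
    fix x y assume "x \<in> carrier (pair_module R)" "y \<in> carrier (pair_module R)"
    then show "x \<oplus>\<^bsub>pair_module R\<^esub> y = y \<oplus>\<^bsub>pair_module R\<^esub> x"
      by (cases x; cases y) (simp add: a_comm)
  qed (auto simp: a_assoc)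
  moreover have "left_module_axioms R (pair_module R)"
    by unfold_locales (auto simp: l_distr r_distr m_assoc)
  ultimately show ?thesis using assms by (simp add: left_module_def)
qed

text \<open>
  The quotient is given by any map \<open>q\<close> whose fibres are the cosets of \<open>L\<close>, so that the type in
  which the quotient lives can be chosen freely.
\<close>

lemma quotient_left_module:
  fixes M :: "('r, 'm, 'z) module_scheme" and q :: "'m \<Rightarrow> 'q"
  assumes M: "left_module R M" and L: "submodule L R M"
    and q: "\<And>x y. x \<in> carrier M \<Longrightarrow> y \<in> carrier M \<Longrightarrow> q x = q y \<longleftrightarrow> x \<ominus>\<^bsub>M\<^esub> y \<in> L"
  obtains Q :: "('r, 'q) module" where "left_module R Q" "carrier Q = q ` carrier M"
    "\<zero>\<^bsub>Q\<^esub> = q \<zero>\<^bsub>M\<^esub>"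
    "\<And>x y. x \<in> carrier M \<Longrightarrow> y \<in> carrier M \<Longrightarrow> q (x \<oplus>\<^bsub>M\<^esub> y) = q x \<oplus>\<^bsub>Q\<^esub> q y"
    "\<And>f x. f \<in> carrier R \<Longrightarrow> x \<in> carrier M \<Longrightarrow> q (f \<odot>\<^bsub>M\<^esub> x) = f \<odot>\<^bsub>Q\<^esub> q x"
proof -
  interpret left_module R M by fact
  define g where "g y = (SOME x. x \<in> carrier M \<and> q x = y)" for y
  have g: "g (q x) \<in> carrier M" "q (g (q x)) = q x" if "x \<in> carrier M" for x
    using someI_ex[of "\<lambda>x'. x' \<in> carrier M \<and> q x' = q x"] that unfolding g_def by blast+
  have cong_add: "q (x \<oplus>\<^bsub>M\<^esub> y) = q (x' \<oplus>\<^bsub>M\<^esub> y')"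
    if "x \<in> carrier M" "y \<in> carrier M" "x' \<in> carrier M" "y' \<in> carrier M" "q x = q x'" "q y = q y'"
    for x y x' y'
  proof -
    have "(x \<oplus>\<^bsub>M\<^esub> y) \<ominus>\<^bsub>M\<^esub> (x' \<oplus>\<^bsub>M\<^esub> y') = (x \<ominus>\<^bsub>M\<^esub> x') \<oplus>\<^bsub>M\<^esub> (y \<ominus>\<^bsub>M\<^esub> y')"
      using that by (simp add: M.minus_eq M.minus_add M.a_ac)
    then show ?thesis using q that submodule_add[OF L] by simp
  qed
  have cong_smult: "q (f \<odot>\<^bsub>M\<^esub> x) = q (f \<odot>\<^bsub>M\<^esub> x')"
    if "x \<in> carrier M" "x' \<in> carrier M" "q x = q x'" "f \<in> carrier R" for f x x'
  proof -
    have "f \<odot>\<^bsub>M\<^esub> (\<ominus>\<^bsub>M\<^esub> x') \<oplus>\<^bsub>M\<^esub> f \<odot>\<^bsub>M\<^esub> x' = \<zero>\<^bsub>M\<^esub>"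
      using that by (simp add: smult_r_distr[symmetric] M.l_neg smult_r_null)
    then have "\<ominus>\<^bsub>M\<^esub> (f \<odot>\<^bsub>M\<^esub> x') = f \<odot>\<^bsub>M\<^esub> (\<ominus>\<^bsub>M\<^esub> x')" using that by (intro M.minus_equality) auto
    then have "f \<odot>\<^bsub>M\<^esub> x \<ominus>\<^bsub>M\<^esub> f \<odot>\<^bsub>M\<^esub> x' = f \<odot>\<^bsub>M\<^esub> (x \<ominus>\<^bsub>M\<^esub> x')"
      using that by (simp add: M.minus_eq smult_r_distr)
    then show ?thesis using q that submodule.smult_closed[OF L] by simp
  qed
  define Q :: "('r, 'q) module" where
    "Q = \<lparr>carrier = q ` carrier M, monoid.mult = undefined, one = undefined, ring.zero = q \<zero>\<^bsub>M\<^esub>,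
       add = (\<lambda>x y. q (g x \<oplus>\<^bsub>M\<^esub> g y)), module.smult = (\<lambda>f x. q (f \<odot>\<^bsub>M\<^esub> g x))\<rparr>"
  have Q: "carrier Q = q ` carrier M" "\<zero>\<^bsub>Q\<^esub> = q \<zero>\<^bsub>M\<^esub>" by (simp_all add: Q_def)
  have add: "q x \<oplus>\<^bsub>Q\<^esub> q y = q (x \<oplus>\<^bsub>M\<^esub> y)" if "x \<in> carrier M" "y \<in> carrier M" for x y
    using that g cong_add[of "g (q x)" "g (q y)" x y] by (simp add: Q_def)
  have smult: "f \<odot>\<^bsub>Q\<^esub> q x = q (f \<odot>\<^bsub>M\<^esub> x)" if "f \<in> carrier R" "x \<in> carrier M" for f x
    using that g cong_smult[of "g (q x)" x f] by (simp add: Q_def)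
  have "abelian_group Q"
  proof (rule abelian_groupI)
    fix x assume "x \<in> carrier Q"
    then obtain m where m: "m \<in> carrier M" "x = q m" by (auto simp: Q)
    then show "\<exists>y\<in>carrier Q. y \<oplus>\<^bsub>Q\<^esub> x = \<zero>\<^bsub>Q\<^esub>"
      by (intro bexI[of _ "q (\<ominus>\<^bsub>M\<^esub> m)"]) (simp_all add: Q add M.l_neg)
  next
    fix x y assume "x \<in> carrier Q" "y \<in> carrier Q"
    then show "x \<oplus>\<^bsub>Q\<^esub> y = y \<oplus>\<^bsub>Q\<^esub> x" unfolding Q by (elim imageE) (simp add: add M.a_comm)
  next
    fix x y z assume "x \<in> carrier Q" "y \<in> carrier Q" "z \<in> carrier Q"
    then show "x \<oplus>\<^bsub>Q\<^esub> y \<oplus>\<^bsub>Q\<^esub> z = x \<oplus>\<^bsub>Q\<^esub> (y \<oplus>\<^bsub>Q\<^esub> z)"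
      unfolding Q by (elim imageE) (simp add: add M.a_assoc)
  next
    fix x y assume "x \<in> carrier Q" "y \<in> carrier Q"
    then show "x \<oplus>\<^bsub>Q\<^esub> y \<in> carrier Q" unfolding Q by (elim imageE) (simp add: add)
  next
    fix x assume "x \<in> carrier Q"
    then show "\<zero>\<^bsub>Q\<^esub> \<oplus>\<^bsub>Q\<^esub> x = x" unfolding Q by (elim imageE) (simp add: add)
  qed (simp add: Q)
  moreover have "left_module_axioms R Q"
    unfolding left_module_axioms_def Q
    by (intro conjI allI impI; (elim imageE)?)
      (simp_all add: add smult smult_l_distr smult_r_distr smult_assoc1)
  ultimately have "left_module R Q" using R.ring_axioms by (simp add: left_module_def)
  then show ?thesis using that[of Q] Q add smult by simp
qed

context colocal_coalgebra
begin

text \<open>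
  The splitting of the rational part of \<open>(A \<times> A) / L\<close>, pulled back to \<open>A \<times> A\<close> for the dual algebra
  \<open>A\<close>: \<open>T\<close> is the preimage of the rational part and \<open>N\<close> that of a complement.  The last two
  properties bound \<open>T\<close> from above and below; they are all that is needed about rationality.
\<close>

lemma splitting_of_pairs:
  assumes split: left_finite_Rat_splitting
    and L: "submodule L dual_algebra (pair_module dual_algebra)"
  obtains T N where
    "submodule T dual_algebra (pair_module dual_algebra)"
    "submodule N dual_algebra (pair_module dual_algebra)"
    "T \<inter> N \<subseteq> L" "L \<subseteq> N"
    "\<And>v. v \<in> carrier (pair_module dual_algebra) \<Longrightarrow>
       \<exists>t\<in>T. \<exists>n\<in>N. v = t \<oplus>\<^bsub>pair_module dual_algebra\<^esub> n"
    "\<And>v. v \<in> T \<Longrightarrow> \<exists>S. finite S \<and>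
       (\<forall>f. functional scale f \<longrightarrow> (\<forall>s\<in>S. f s = 0) \<longrightarrow> f \<odot>\<^bsub>pair_module dual_algebra\<^esub> v \<in> L)"
    "\<And>v. v \<in> carrier (pair_module dual_algebra) \<Longrightarrow>
       (\<And>f. f \<in> J \<Longrightarrow> f \<odot>\<^bsub>pair_module dual_algebra\<^esub> v \<in> L) \<Longrightarrow> v \<in> T"
proof -
  define P where "P = pair_module dual_algebra"
  have P: "left_module dual_algebra P" unfolding P_def by (rule left_module_pair_module[OF ring_dual_algebra])
  interpret left_module dual_algebra P by (rule P)
  have LP: "submodule L dual_algebra P" using L by (simp add: P_def)
  \<comment> \<open>Cosets of pairs, coded as sets of sequences; only the terms 0 and 1 carry information.\<close>
  define code :: "('c \<Rightarrow> 'k) \<times> ('c \<Rightarrow> 'k) \<Rightarrow> nat \<Rightarrow> 'c \<Rightarrow> 'k" where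
    "code v = (\<lambda>i. if i = 0 then fst v else snd v)" for v
  have inj: "inj code"
  proof (rule injI)
    fix v w assume eq: "code v = code w"
    show "v = w" using fun_cong[OF eq, of 0] fun_cong[OF eq, of 1] by (simp add: code_def prod_eq_iff)
  qed
  define coset where "coset v = {w \<in> carrier P. w \<ominus>\<^bsub>P\<^esub> v \<in> L}" for v
  define q where "q v = code ` coset v" for v
  have q: "q v = q w \<longleftrightarrow> v \<ominus>\<^bsub>P\<^esub> w \<in> L" if v: "v \<in> carrier P" and w: "w \<in> carrier P" for v w
  proof -
    have neg: "\<ominus>\<^bsub>P\<^esub> x \<in> L" if "x \<in> L" for x
      using submodule.smult_closed[OF LP, of "\<ominus>\<^bsub>dual_algebra\<^esub> \<one>\<^bsub>dual_algebra\<^esub>" x] that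
        submodule_subset[OF LP] minus_eq_smult[of x] R.a_inv_closed[OF R.one_closed] by auto
    have "coset v = coset w \<longleftrightarrow> v \<ominus>\<^bsub>P\<^esub> w \<in> L"
    proof
      assume "coset v = coset w"
      moreover have "v \<in> coset v"
        using v submodule_zero[OF LP] by (simp add: coset_def M.minus_eq M.r_neg)
      ultimately show "v \<ominus>\<^bsub>P\<^esub> w \<in> L" by (auto simp: coset_def)
    next
      assume vw: "v \<ominus>\<^bsub>P\<^esub> w \<in> L"
      have wv: "w \<ominus>\<^bsub>P\<^esub> v \<in> L"
        using neg[OF vw] v w by (simp add: M.minus_eq M.minus_add M.a_comm)
      have "x \<ominus>\<^bsub>P\<^esub> z = (x \<ominus>\<^bsub>P\<^esub> y) \<oplus>\<^bsub>P\<^esub> (y \<ominus>\<^bsub>P\<^esub> z)"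
        if "x \<in> carrier P" "y \<in> carrier P" "z \<in> carrier P" for x y z
        using that by (simp add: M.minus_eq M.a_assoc M.r_neg1 M.r_neg2)
      then have "x \<ominus>\<^bsub>P\<^esub> w \<in> L \<longleftrightarrow> x \<ominus>\<^bsub>P\<^esub> v \<in> L" if "x \<in> carrier P" for x
        using that v w vw wv submodule_add[OF LP] by metis
      then show "coset v = coset w" unfolding coset_def by auto
    qed
    then show ?thesis using inj by (simp add: q_def inj_image_eq_iff)
  qed
  obtain Q :: "('c \<Rightarrow> 'k, (nat \<Rightarrow> 'c \<Rightarrow> 'k) set) module"
    where Q: "left_module dual_algebra Q" "carrier Q = q ` carrier P" "\<zero>\<^bsub>Q\<^esub> = q \<zero>\<^bsub>P\<^esub>"
    and q_add: "\<And>x y. x \<in> carrier P \<Longrightarrow> y \<in> carrier P \<Longrightarrow> q (x \<oplus>\<^bsub>P\<^esub> y) = q x \<oplus>\<^bsub>Q\<^esub> q y"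
    and q_smult: "\<And>f x. f \<in> carrier dual_algebra \<Longrightarrow> x \<in> carrier P \<Longrightarrow>
       q (f \<odot>\<^bsub>P\<^esub> x) = f \<odot>\<^bsub>Q\<^esub> q x"
    using quotient_left_module[OF P LP q] by blast
  have q_zero: "q v = \<zero>\<^bsub>Q\<^esub> \<longleftrightarrow> v \<in> L" if "v \<in> carrier P" for v
  proof -
    have "\<ominus>\<^bsub>P\<^esub> \<zero>\<^bsub>P\<^esub> = \<zero>\<^bsub>P\<^esub>" by (rule M.minus_equality) simp_all
    then have "v \<ominus>\<^bsub>P\<^esub> \<zero>\<^bsub>P\<^esub> = v" unfolding M.minus_eq by (simp only: M.r_zero[OF that])
    then show ?thesis using q[OF that M.zero_closed] Q(3) by simp
  qed
  have "finitely_generated dual_algebra Q"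
    unfolding finitely_generated_def
  proof (intro exI conjI allI impI)
    let ?S = "{q (\<epsilon>, \<lambda>_. 0), q (\<lambda>_. 0, \<epsilon>)}"
    show "finite ?S" by simp
    have e: "(\<epsilon>, \<lambda>_. 0) \<in> carrier P" "(\<lambda>_. 0, \<epsilon>) \<in> carrier P"
      by (simp_all add: P_def counit_linear functional_const_zero)
    then show "?S \<subseteq> carrier Q" using Q by auto
    fix H assume H: "submodule H dual_algebra Q \<and> ?S \<subseteq> H"
    have "q (a, b) \<in> H" if "(a, b) \<in> carrier P" for a b
    proof -
      have ab: "functional scale a" "functional scale b" using that by (simp_all add: P_def)
      have "(a, b) = a \<odot>\<^bsub>P\<^esub> (\<epsilon>, \<lambda>_. 0) \<oplus>\<^bsub>P\<^esub> b \<odot>\<^bsub>P\<^esub> (\<lambda>_. 0, \<epsilon>)"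
        using ab conv_counit by (simp add: P_def conv_def[of _ "\<lambda>_. 0", abs_def] split_def)
      then have "q (a, b) = a \<odot>\<^bsub>Q\<^esub> q (\<epsilon>, \<lambda>_. 0) \<oplus>\<^bsub>Q\<^esub> b \<odot>\<^bsub>Q\<^esub> q (\<lambda>_. 0, \<epsilon>)"
        using e ab q_add q_smult smult_closed by simp
      then show ?thesis
        using H ab submodule_add[of H dual_algebra Q] submodule.smult_closed[of H dual_algebra Q] by simp
    qed
    then show "H = carrier Q" using submodule_subset[of H dual_algebra Q] H Q(2) by auto
  qed
  then have ds: "direct_summand dual_algebra Q (Rat Q)"
    using split Q(1) unfolding left_finite_Rat_splitting_def by blast
  then obtain B where B: "submodule B dual_algebra Q" "Rat Q \<inter> B = {\<zero>\<^bsub>Q\<^esub>}"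
    "Rat Q <+>\<^bsub>Q\<^esub> B = carrier Q" and RQ: "submodule (Rat Q) dual_algebra Q"
    unfolding direct_summand_def by blast
  define pre where "pre H = {v \<in> carrier P. q v \<in> H}" for H
  have pre: "submodule (pre H) dual_algebra P" if H: "submodule H dual_algebra Q" for H
    by (rule left_submoduleI)
      (use H submodule_zero[OF H] submodule_add[OF H] submodule.smult_closed[OF H] Q(3) in
        \<open>auto simp: pre_def q_add q_smult\<close>)
  have sum: "\<exists>t\<in>pre (Rat Q). \<exists>n\<in>pre B. v = t \<oplus>\<^bsub>P\<^esub> n" if v: "v \<in> carrier P" for v
  proof -
    have "q v \<in> Rat Q <+>\<^bsub>Q\<^esub> B" using v B(3) Q(2) by simp
    then obtain x y where xy: "x \<in> Rat Q" "y \<in> B" "q v = x \<oplus>\<^bsub>Q\<^esub> y"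
      unfolding set_add_def' by blast
    have "x \<in> q ` carrier P" "y \<in> q ` carrier P"
      using xy submodule_subset[OF RQ] submodule_subset[OF B(1)] unfolding Q(2) by auto
    then obtain t n where t: "t \<in> carrier P" "x = q t" and n: "n \<in> carrier P" "y = q n"
      by (elim imageE)
    have L': "v \<ominus>\<^bsub>P\<^esub> (t \<oplus>\<^bsub>P\<^esub> n) \<in> L" using q[of v "t \<oplus>\<^bsub>P\<^esub> n"] v t n xy(3) q_add by simp
    \<comment> \<open>The decomposition holds only modulo \<open>L\<close>; the error term is absorbed into \<open>N\<close>.\<close>
    let ?n = "n \<oplus>\<^bsub>P\<^esub> (v \<ominus>\<^bsub>P\<^esub> (t \<oplus>\<^bsub>P\<^esub> n))"
    have "?n \<in> pre B"
    proof -
      have "q (v \<ominus>\<^bsub>P\<^esub> (t \<oplus>\<^bsub>P\<^esub> n)) = \<zero>\<^bsub>Q\<^esub>" using q_zero L' v t n by simp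
      then have "q ?n \<in> B"
        using q_add[of n "v \<ominus>\<^bsub>P\<^esub> (t \<oplus>\<^bsub>P\<^esub> n)"] v t n xy(2) submodule_add[OF B(1)] submodule_zero[OF B(1)] by simp
      then show ?thesis using v t n by (simp add: pre_def)
    qed
    moreover have "t \<in> pre (Rat Q)" using t xy by (simp add: pre_def)
    moreover have "v = t \<oplus>\<^bsub>P\<^esub> ?n"
    proof -
      have "t \<oplus>\<^bsub>P\<^esub> ?n = (t \<oplus>\<^bsub>P\<^esub> n) \<oplus>\<^bsub>P\<^esub> (v \<ominus>\<^bsub>P\<^esub> (t \<oplus>\<^bsub>P\<^esub> n))"
        using v t n by (simp add: M.a_assoc)
      also have "\<dots> = v \<oplus>\<^bsub>P\<^esub> ((t \<oplus>\<^bsub>P\<^esub> n) \<oplus>\<^bsub>P\<^esub> (\<ominus>\<^bsub>P\<^esub> (t \<oplus>\<^bsub>P\<^esub> n)))"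
        unfolding M.minus_eq using v t n by (intro M.a_lcomm) auto
      also have "\<dots> = v" using M.r_neg[OF M.a_closed[OF t(1) n(1)]] v by simp
      finally show ?thesis by simp
    qed
    ultimately show ?thesis by blast
  qed
  show ?thesis
  proof (rule that[of "pre (Rat Q)" "pre B"], unfold P_def[symmetric])
    show "submodule (pre (Rat Q)) dual_algebra P" "submodule (pre B) dual_algebra P"
      using pre RQ B(1) by blast+
    show "pre (Rat Q) \<inter> pre B \<subseteq> L"
    proof
      fix v assume "v \<in> pre (Rat Q) \<inter> pre B"
      then have "v \<in> carrier P" "q v \<in> Rat Q \<inter> B" by (simp_all add: pre_def)
      then show "v \<in> L" unfolding B(2) by (simp add: q_zero)
    qed
    show "L \<subseteq> pre B"
    proof
      fix v assume v: "v \<in> L"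
      then have "v \<in> carrier P" using submodule_subset[OF LP] by blast
      moreover from this have "q v = \<zero>\<^bsub>Q\<^esub>" using q_zero v by simp
      ultimately show "v \<in> pre B" using submodule_zero[OF B(1)] by (simp add: pre_def)
    qed
    show "\<exists>t\<in>pre (Rat Q). \<exists>n\<in>pre B. v = t \<oplus>\<^bsub>P\<^esub> n" if "v \<in> carrier P" for v by (rule sum[OF that])
    show "\<exists>S. finite S \<and> (\<forall>f. functional scale f \<longrightarrow> (\<forall>s\<in>S. f s = 0) \<longrightarrow> f \<odot>\<^bsub>P\<^esub> v \<in> L)"
      if v: "v \<in> pre (Rat Q)" for v
    proof -
      have vP: "v \<in> carrier P" "q v \<in> Rat Q" using v by (simp_all add: pre_def)
      obtain S where S: "finite S"
        "\<And>f. functional scale f \<Longrightarrow> (\<And>s. s \<in> S \<Longrightarrow> f s = 0) \<Longrightarrow> f \<odot>\<^bsub>Q\<^esub> q v = \<zero>\<^bsub>Q\<^esub>"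
        by (rule Rat_finite_support[OF Q(1) vP(2)]) blast
      have "f \<odot>\<^bsub>P\<^esub> v \<in> L" if "functional scale f" "\<forall>s\<in>S. f s = 0" for f
        using S(2)[of f] that q_smult[of f v] q_zero[of "f \<odot>\<^bsub>P\<^esub> v"] vP by simp
      then show ?thesis using S(1) by blast
    qed
    show "v \<in> pre (Rat Q)" if v: "v \<in> carrier P" and L: "\<And>f. f \<in> J \<Longrightarrow> f \<odot>\<^bsub>P\<^esub> v \<in> L" for v
    proof -
      have "f \<odot>\<^bsub>Q\<^esub> q v = \<zero>\<^bsub>Q\<^esub>" if "f \<in> J" for f
        using L[OF that] v q_smult[of f v] q_zero[of "f \<odot>\<^bsub>P\<^esub> v"] J_functional[OF that] by simp
      then have "q v \<in> socle Q" using v Q(2) by (simp add: socle_def)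
      then show ?thesis using v socle_subset_Rat[OF Q(1)] by (auto simp: pre_def)
    qed
  qed
qed

end

section \<open>Split quotients over a local ring\<close>

text \<open>
  A local ring, with its maximal ideal \<open>J\<close> as a parameter.
\<close>

locale ring_with_nonunit_ideal = ring R for R (structure) +
  fixes J
  assumes J_closed: "x \<in> J \<Longrightarrow> x \<in> carrier R"
    and J_zero: "\<zero> \<in> J"
    and J_plus: "x \<in> J \<Longrightarrow> y \<in> J \<Longrightarrow> x \<oplus> y \<in> J"
    and J_left: "a \<in> carrier R \<Longrightarrow> x \<in> J \<Longrightarrow> a \<otimes> x \<in> J"
    and J_right: "a \<in> carrier R \<Longrightarrow> x \<in> J \<Longrightarrow> x \<otimes> a \<in> J"
    and Units_off_J: "x \<in> carrier R \<Longrightarrow> x \<notin> J \<Longrightarrow> x \<in> Units R"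
    and one_notin_J: "\<one> \<notin> J"
begin

lemma one_minus_Units:
  assumes "j \<in> J"
  shows "\<one> \<ominus> j \<in> Units R"
proof (rule Units_off_J)
  have j: "j \<in> carrier R" using assms by (rule J_closed)
  then show "\<one> \<ominus> j \<in> carrier R" by simp
  have "(\<one> \<ominus> j) \<oplus> j = \<one>" using j by algebra
  then show "\<one> \<ominus> j \<notin> J" using J_plus[OF _ assms] one_notin_J by metis
qed

lemma J_minus: "x \<in> J \<Longrightarrow> \<ominus> x \<in> J"
  using J_left[of "\<ominus> \<one>" x] J_closed[of x] by (simp add: l_minus)

text \<open>
  The instance of the lemma of Nakayama for a cyclic module: \<open>\<one> \<ominus> j\<close> is invertible.
\<close>

lemma eq_J_mult_self:
  assumes "j \<in> J" "a \<in> carrier R" "a = j \<otimes> a"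
  shows "a = \<zero>"
proof -
  have j: "j \<in> carrier R" using assms by (simp add: J_closed)
  have u: "\<one> \<ominus> j \<in> Units R" using assms(1) by (rule one_minus_Units)
  have "(\<one> \<ominus> j) \<otimes> a = a \<ominus> j \<otimes> a" using j assms(2) by algebra
  also have "\<dots> = \<zero>" using assms j by (metis m_closed r_right_minus_eq)
  finally have z: "(\<one> \<ominus> j) \<otimes> a = \<zero>" .
  have "a = (inv (\<one> \<ominus> j) \<otimes> (\<one> \<ominus> j)) \<otimes> a" unfolding Units_l_inv[OF u] using assms(2) by simp
  also have "\<dots> = inv (\<one> \<ominus> j) \<otimes> ((\<one> \<ominus> j) \<otimes> a)"
    by (rule m_assoc[OF Units_inv_closed[OF u] Units_closed[OF u] assms(2)])
  also have "\<dots> = \<zero>" unfolding z using Units_inv_closed[OF u] by simp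
  finally show ?thesis .
qed

lemma pair_submodule_eq_carrier:
  assumes H: "submodule H R (pair_module R)" and p: "p \<in> carrier R"
    and "(\<one>, p) \<in> H" "(\<zero>, u) \<in> H" "u \<in> Units R"
  shows "H = carrier (pair_module R)"
proof -
  have "inv u \<odot>\<^bsub>pair_module R\<^esub> (\<zero>, u) \<in> H" using submodule_smult[OF H] assms by blast
  then have e2: "(\<zero>, \<one>) \<in> H" using assms by simp
  have "(x, y) \<in> H" if xy: "x \<in> carrier R" "y \<in> carrier R" for x y
  proof -
    have "x \<odot>\<^bsub>pair_module R\<^esub> (\<one>, p) \<oplus>\<^bsub>pair_module R\<^esub> (y \<ominus> x \<otimes> p) \<odot>\<^bsub>pair_module R\<^esub> (\<zero>, \<one>) \<in> H"
      using xy p assms e2 by (intro submodule_add[OF H] submodule_smult[OF H]) auto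
    moreover have "x \<otimes> p \<oplus> (y \<ominus> x \<otimes> p) = y" using xy p by algebra
    ultimately show ?thesis using xy p by simp
  qed
  then show ?thesis using submodule_subset[OF H] by auto
qed

lemma scaled_J_submodule:
  assumes a: "a \<in> carrier R" "b \<in> carrier R"
  shows "submodule {(j \<otimes> a, j \<otimes> b) | j. j \<in> J} R (pair_module R)"
proof -
  interpret P: left_module R "pair_module R" by (rule left_module_pair_module) (rule ring_axioms)
  show ?thesis
  proof (rule P.left_submoduleI)
    show "\<zero>\<^bsub>pair_module R\<^esub> \<in> {(j \<otimes> a, j \<otimes> b) | j. j \<in> J}" using J_zero a by force
  next
    fix x y assume "x \<in> {(j \<otimes> a, j \<otimes> b) | j. j \<in> J}" "y \<in> {(j \<otimes> a, j \<otimes> b) | j. j \<in> J}"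
    then obtain j k where "j \<in> J" "k \<in> J" "x = (j \<otimes> a, j \<otimes> b)" "y = (k \<otimes> a, k \<otimes> b)" by blast
    then show "x \<oplus>\<^bsub>pair_module R\<^esub> y \<in> {(j \<otimes> a, j \<otimes> b) | j. j \<in> J}"
      using a J_closed J_plus by (auto simp: l_distr intro!: exI[of _ "j \<oplus> k"])
  next
    fix r x assume "r \<in> carrier R" "x \<in> {(j \<otimes> a, j \<otimes> b) | j. j \<in> J}"
    then show "r \<odot>\<^bsub>pair_module R\<^esub> x \<in> {(j \<otimes> a, j \<otimes> b) | j. j \<in> J}"
      using a J_closed J_left by (auto simp: m_assoc[symmetric])
  qed (use a J_closed in auto)
qed

lemma first_scaled_J_submodule:
  assumes a: "a \<in> carrier R"
  shows "submodule ({j \<otimes> a | j. j \<in> J} \<times> carrier R) R (pair_module R)"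
proof -
  interpret P: left_module R "pair_module R" by (rule left_module_pair_module) (rule ring_axioms)
  show ?thesis
  proof (rule P.left_submoduleI)
    show "\<zero>\<^bsub>pair_module R\<^esub> \<in> {j \<otimes> a | j. j \<in> J} \<times> carrier R" using J_zero a by force
  next
    fix x y assume "x \<in> {j \<otimes> a | j. j \<in> J} \<times> carrier R" "y \<in> {j \<otimes> a | j. j \<in> J} \<times> carrier R"
    then obtain j k p q where "j \<in> J" "k \<in> J" "x = (j \<otimes> a, p)" "y = (k \<otimes> a, q)"
      "p \<in> carrier R" "q \<in> carrier R" by blast
    then show "x \<oplus>\<^bsub>pair_module R\<^esub> y \<in> {j \<otimes> a | j. j \<in> J} \<times> carrier R"
      using a J_closed J_plus by (auto simp: l_distr intro!: exI[of _ "j \<oplus> k"])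
  next
    fix r x assume "r \<in> carrier R" "x \<in> {j \<otimes> a | j. j \<in> J} \<times> carrier R"
    then obtain j p where "j \<in> J" "x = (j \<otimes> a, p)" "p \<in> carrier R" by blast
    then show "r \<odot>\<^bsub>pair_module R\<^esub> x \<in> {j \<otimes> a | j. j \<in> J} \<times> carrier R"
      using a J_closed J_left \<open>r \<in> carrier R\<close>
      by (auto simp: m_assoc[symmetric] intro!: exI[of _ "r \<otimes> j"])
  qed (use a J_closed in auto)
qed

text \<open>
  A cyclic module over a local ring is indecomposable.  The module is \<open>R / J a\<close>, written as a
  quotient of \<open>R \<times> R\<close> by a submodule containing the second factor.  The generator \<open>(\<one>, \<zero>)\<close> is the
  sum of its two components, one of which is a unit multiple of it modulo the second factor.  It
  cannot be the one in \<open>N\<close>: the class of \<open>a\<close> is a nonzero element of the other summand.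
\<close>

lemma cyclic_quotient_indecomposable:
  assumes T: "submodule T R (pair_module R)" and N: "submodule N R (pair_module R)"
    and sum: "\<And>v. v \<in> carrier (pair_module R) \<Longrightarrow> \<exists>t\<in>T. \<exists>n\<in>N. v = t \<oplus>\<^bsub>pair_module R\<^esub> n"
    and int: "T \<inter> N \<subseteq> {j \<otimes> a | j. j \<in> J} \<times> carrier R"
    and second: "{\<zero>} \<times> carrier R \<subseteq> T" "{\<zero>} \<times> carrier R \<subseteq> N"
    and a: "a \<in> carrier R" "a \<noteq> \<zero>" "(a, \<zero>) \<in> T"
  shows "(\<one>, \<zero>) \<in> T"
proof -
  have first: "(\<one>, \<zero>) \<in> H"
    if H: "submodule H R (pair_module R)" "{\<zero>} \<times> carrier R \<subseteq> H" and u: "(u, v) \<in> H" "u \<in> Units R"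
    for H u v
  proof -
    have v: "v \<in> carrier R" using submodule_subset[OF H(1)] u by auto
    have "inv u \<odot>\<^bsub>pair_module R\<^esub> (u, v) \<oplus>\<^bsub>pair_module R\<^esub> (\<zero>, \<ominus> (inv u \<otimes> v)) \<in> H"
      using H u v by (intro submodule_add[OF H(1)] submodule_smult[OF H(1)]) auto
    then show ?thesis using u v by (simp add: r_neg)
  qed
  obtain t1 t2 n1 n2 where tn: "(t1, t2) \<in> T" "(n1, n2) \<in> N"
    "(\<one>, \<zero>) = (t1, t2) \<oplus>\<^bsub>pair_module R\<^esub> (n1, n2)"
    using sum[of "(\<one>, \<zero>)"] by auto
  have c: "t1 \<in> carrier R" "n1 \<in> carrier R"
    using submodule_subset[OF T] submodule_subset[OF N] tn by auto
  show ?thesis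
  proof (cases "t1 \<in> J")
    case False
    then show ?thesis using first[OF T second(1) tn(1)] c Units_off_J by simp
  next
    case True
    have "n1 = (t1 \<oplus> n1) \<ominus> t1" using c by algebra
    then have "n1 = \<one> \<ominus> t1" using tn(3) by simp
    then have "(\<one>, \<zero>) \<in> N" using first[OF N second(2) tn(2)] one_minus_Units[OF True] by simp
    then have "a \<odot>\<^bsub>pair_module R\<^esub> (\<one>, \<zero>) \<in> N" using submodule_smult[OF N] a by blast
    then have "(a, \<zero>) \<in> T \<inter> N" using a by simp
    then obtain j where "j \<in> J" "a = j \<otimes> a" using int by auto
    then show ?thesis using eq_J_mult_self a by blast
  qed
qed

text \<open>
  After scaling, \<open>T\<close> contains some \<open>(\<one>, s)\<close>.  As \<open>T\<close> is proper, some \<open>(n1, n2)\<close> in \<open>N\<close> is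
  independent of \<open>(\<one>, s)\<close> modulo \<open>J\<close>, so the two form a basis of \<open>R \<times> R\<close>.  The component of
  \<open>(a, b)\<close> along \<open>(n1, n2)\<close> lies in both \<open>T\<close> and \<open>N\<close>, hence in \<open>J (a, b)\<close>; by \<open>eq_J_mult_self\<close> it
  vanishes, and \<open>(a, b)\<close> is a multiple of \<open>(\<one>, s)\<close>.
\<close>

lemma right_multiple_of_unit_coordinate:
  assumes T: "submodule T R (pair_module R)" and N: "submodule N R (pair_module R)"
    and sum: "\<And>v. v \<in> carrier (pair_module R) \<Longrightarrow> \<exists>t\<in>T. \<exists>n\<in>N. v = t \<oplus>\<^bsub>pair_module R\<^esub> n"
    and int: "T \<inter> N \<subseteq> {(j \<otimes> a, j \<otimes> b) | j. j \<in> J}"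
    and ab: "(a, b) \<in> T" and proper: "T \<noteq> carrier (pair_module R)"
    and t: "(t1, t2) \<in> T" "t1 \<notin> J"
  shows "\<exists>s\<in>carrier R. b = a \<otimes> s"
proof -
  have c: "a \<in> carrier R" "b \<in> carrier R" "t1 \<in> carrier R" "t2 \<in> carrier R"
    using submodule_subset[OF T] ab t by auto
  have u: "t1 \<in> Units R" using Units_off_J c t by simp
  define s where "s = inv t1 \<otimes> t2"
  have s: "s \<in> carrier R" using u c by (simp add: s_def)
  have "inv t1 \<odot>\<^bsub>pair_module R\<^esub> (t1, t2) \<in> T" using u t by (intro submodule_smult[OF T]) auto
  then have sT: "(\<one>, s) \<in> T" using u by (simp add: s_def)
  \<comment> \<open>The determinant of \<open>(\<one>, s)\<close> and \<open>(n1, n2)\<close> is a unit for the component of \<open>(\<zero>, \<one>)\<close> in \<open>N\<close>.\<close>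
  obtain n1 n2 where n: "(n1, n2) \<in> N" "n2 \<ominus> n1 \<otimes> s \<notin> J"
  proof -
    obtain p1 p2 n1 n2 where pn: "(p1, p2) \<in> T" "(n1, n2) \<in> N"
      "(\<zero>, \<one>) = (p1, p2) \<oplus>\<^bsub>pair_module R\<^esub> (n1, n2)"
      using sum[of "(\<zero>, \<one>)"] by auto
    have d: "p1 \<in> carrier R" "p2 \<in> carrier R" "n1 \<in> carrier R" "n2 \<in> carrier R"
      using submodule_subset[OF T] submodule_subset[OF N] pn by auto
    have "n2 \<ominus> n1 \<otimes> s \<notin> J"
    proof
      assume J: "n2 \<ominus> n1 \<otimes> s \<in> J"
      have "(p1, p2) \<oplus>\<^bsub>pair_module R\<^esub> n1 \<odot>\<^bsub>pair_module R\<^esub> (\<one>, s) \<in> T"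
        using pn sT d by (intro submodule_add[OF T] submodule_smult[OF T])
      moreover have "p2 \<oplus> n1 \<otimes> s = (p2 \<oplus> n2) \<ominus> (n2 \<ominus> n1 \<otimes> s)" using d s by algebra
      ultimately have "(\<zero>, \<one> \<ominus> (n2 \<ominus> n1 \<otimes> s)) \<in> T" using pn(3) d by simp
      then have "T = carrier (pair_module R)"
        using pair_submodule_eq_carrier[OF T s sT] one_minus_Units[OF J] by blast
      then show False using proper by simp
    qed
    then show ?thesis using that pn by blast
  qed
  have nc: "n1 \<in> carrier R" "n2 \<in> carrier R" using submodule_subset[OF N] n by auto
  define w where "w = n2 \<ominus> n1 \<otimes> s"
  have w: "w \<in> Units R" "w \<in> carrier R" using n nc s Units_off_J by (simp_all add: w_def)
  \<comment> \<open>The coefficient \<open>y\<close> of \<open>(n1, n2)\<close> in the expansion of \<open>(a, b)\<close> is found from \<open>y \<otimes> w = d\<close>.\<close>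
  define d where "d = b \<ominus> a \<otimes> s"
  define y where "y = d \<otimes> inv w"
  have d: "d \<in> carrier R" and y: "y \<in> carrier R" using c s w by (simp_all add: d_def y_def)
  have yw: "y \<otimes> w = d" using w d by (simp add: y_def m_assoc)
  have yn2: "y \<otimes> n2 = d \<oplus> y \<otimes> n1 \<otimes> s"
  proof -
    have "y \<otimes> n2 = y \<otimes> w \<oplus> y \<otimes> n1 \<otimes> s" unfolding w_def using y nc s by algebra
    then show ?thesis by (simp add: yw)
  qed
  have "(a, b) \<oplus>\<^bsub>pair_module R\<^esub> (y \<otimes> n1 \<ominus> a) \<odot>\<^bsub>pair_module R\<^esub> (\<one>, s) \<in> T"
    using ab sT y nc c by (intro submodule_add[OF T] submodule_smult[OF T]) auto
  moreover have "a \<oplus> (y \<otimes> n1 \<ominus> a) = y \<otimes> n1" using y nc c by algebra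
  moreover have "b \<oplus> (y \<otimes> n1 \<ominus> a) \<otimes> s = y \<otimes> n2"
    unfolding yn2 d_def using y nc c s by algebra
  ultimately have "(y \<otimes> n1, y \<otimes> n2) \<in> T" using y nc c by simp
  moreover have "(y \<otimes> n1, y \<otimes> n2) \<in> N" using submodule_smult[OF N y n(1)] by simp
  ultimately obtain j where j: "j \<in> J" "y \<otimes> n1 = j \<otimes> a" "y \<otimes> n2 = j \<otimes> b" using int by blast
  have jc: "j \<in> carrier R" using j J_closed by blast
  have "d = y \<otimes> n2 \<ominus> y \<otimes> n1 \<otimes> s"
    unfolding yn2 using d y nc s by algebra
  also have "\<dots> = j \<otimes> d" unfolding j d_def using jc c s by algebra
  finally have "d = \<zero>" using eq_J_mult_self[OF j(1) d] by blast
  then have "b = a \<otimes> s" using c s unfolding d_def by (metis m_closed r_right_minus_eq)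
  then show ?thesis using s by blast
qed

lemma swap_submodule:
  assumes T: "submodule T R (pair_module R)"
  shows "submodule (prod.swap ` T) R (pair_module R)"
proof -
  interpret P: left_module R "pair_module R" by (rule left_module_pair_module) (rule ring_axioms)
  show ?thesis
  proof (rule P.left_submoduleI)
    show "prod.swap ` T \<subseteq> carrier (pair_module R)" using submodule_subset[OF T] by auto
    show "\<zero>\<^bsub>pair_module R\<^esub> \<in> prod.swap ` T" using submodule_zero[OF T] by force
  next
    fix x y assume "x \<in> prod.swap ` T" "y \<in> prod.swap ` T"
    then obtain a b c d where "x = (b, a)" "(a, b) \<in> T" "y = (d, c)" "(c, d) \<in> T" by auto
    then show "x \<oplus>\<^bsub>pair_module R\<^esub> y \<in> prod.swap ` T"
      using submodule_add[OF T, of "(a, b)" "(c, d)"] by force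
  next
    fix r x assume "r \<in> carrier R" "x \<in> prod.swap ` T"
    then obtain a b where "x = (b, a)" "(a, b) \<in> T" by auto
    then show "r \<odot>\<^bsub>pair_module R\<^esub> x \<in> prod.swap ` T"
      using submodule_smult[OF T \<open>r \<in> _\<close>, of "(a, b)"] by force
  qed
qed

text \<open>
  If \<open>T\<close> contained no vector with a unit coordinate, then \<open>N\<close> would generate \<open>R \<times> R\<close> modulo \<open>J\<close>
  and so be everything, and \<open>(a, b)\<close> would lie in \<open>J (a, b)\<close>.  So some coordinate is a unit, and
  exchanging the two factors makes it the first one.
\<close>

lemma right_comparable_of_splitting:
  assumes T: "submodule T R (pair_module R)" and N: "submodule N R (pair_module R)"
    and sum: "\<And>v. v \<in> carrier (pair_module R) \<Longrightarrow> \<exists>t\<in>T. \<exists>n\<in>N. v = t \<oplus>\<^bsub>pair_module R\<^esub> n"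
    and int: "T \<inter> N \<subseteq> {(j \<otimes> a, j \<otimes> b) | j. j \<in> J}"
    and ab: "(a, b) \<in> T" and a: "a \<noteq> \<zero>" and proper: "T \<noteq> carrier (pair_module R)"
  shows "(\<exists>s\<in>carrier R. b = a \<otimes> s) \<or> (\<exists>s\<in>carrier R. a = b \<otimes> s)"
proof -
  have "\<not> T \<subseteq> J \<times> J"
  proof
    assume TJ: "T \<subseteq> J \<times> J"
    obtain p1 p2 n1 n2 where pn: "(p1, p2) \<in> T" "(n1, n2) \<in> N"
      "(\<one>, \<zero>) = (p1, p2) \<oplus>\<^bsub>pair_module R\<^esub> (n1, n2)"
      using sum[of "(\<one>, \<zero>)"] by auto
    obtain q1 q2 m1 m2 where qm: "(q1, q2) \<in> T" "(m1, m2) \<in> N"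
      "(\<zero>, \<one>) = (q1, q2) \<oplus>\<^bsub>pair_module R\<^esub> (m1, m2)"
      using sum[of "(\<zero>, \<one>)"] by auto
    have J: "p1 \<in> J" "p2 \<in> J" "q1 \<in> J" "q2 \<in> J" using TJ pn qm by auto
    have c: "p1 \<in> carrier R" "p2 \<in> carrier R" "n1 \<in> carrier R" "n2 \<in> carrier R"
      "q1 \<in> carrier R" "q2 \<in> carrier R" "m1 \<in> carrier R" "m2 \<in> carrier R"
      using submodule_subset[OF T] submodule_subset[OF N] pn qm by auto
    have "n1 = (p1 \<oplus> n1) \<ominus> p1" using c by algebra
    then have n1: "n1 = \<one> \<ominus> p1" using pn(3) by simp
    then have u: "n1 \<in> Units R" using one_minus_Units J by simp
    have "\<ominus> p2 = n2" using pn(3) c by (intro minus_equality) (simp_all add: a_comm)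
    then have n2: "n2 \<in> J" using J_minus J by blast
    define p where "p = inv n1 \<otimes> n2"
    have p: "p \<in> J" "p \<in> carrier R" using u n2 J_left c by (simp_all add: p_def)
    have "inv n1 \<odot>\<^bsub>pair_module R\<^esub> (n1, n2) \<in> N" using u pn by (intro submodule_smult[OF N]) auto
    then have pN: "(\<one>, p) \<in> N" using u by (simp add: p_def)
    have "(m1, m2) \<oplus>\<^bsub>pair_module R\<^esub> q1 \<odot>\<^bsub>pair_module R\<^esub> (\<one>, p) \<in> N"
      using qm pN c by (intro submodule_add[OF N] submodule_smult[OF N])
    moreover have "m1 \<oplus> q1 = \<zero>" using qm(3) c by (simp add: a_comm)
    moreover have "m2 \<oplus> q1 \<otimes> p = (q2 \<oplus> m2) \<ominus> (q2 \<ominus> q1 \<otimes> p)" using c p by algebra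
    ultimately have "(\<zero>, \<one> \<ominus> (q2 \<ominus> q1 \<otimes> p)) \<in> N" using qm(3) c by simp
    moreover have "q2 \<ominus> q1 \<otimes> p \<in> J"
      using J p c J_plus J_minus J_right by (simp add: minus_eq)
    ultimately have "N = carrier (pair_module R)"
      using pair_submodule_eq_carrier[OF N p(2) pN] one_minus_Units by blast
    then have "(a, b) \<in> T \<inter> N" using ab submodule_subset[OF T] by auto
    then obtain j where "j \<in> J" "a = j \<otimes> a" using int by auto
    then show False using eq_J_mult_self a ab submodule_subset[OF T] by auto
  qed
  then obtain t1 t2 where t: "(t1, t2) \<in> T" "t1 \<notin> J \<or> t2 \<notin> J" by auto
  show ?thesis
  proof (cases "t1 \<in> J")
    case False
    then show ?thesis
      using right_multiple_of_unit_coordinate[OF T N sum int ab proper t(1)] by blast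
  next
    case True
    let ?T = "prod.swap ` T" and ?N = "prod.swap ` N"
    have "\<exists>t\<in>?T. \<exists>n\<in>?N. v = t \<oplus>\<^bsub>pair_module R\<^esub> n" if v: "v \<in> carrier (pair_module R)" for v
    proof -
      obtain p1 p2 n1 n2 where "(p1, p2) \<in> T" "(n1, n2) \<in> N"
        "prod.swap v = (p1, p2) \<oplus>\<^bsub>pair_module R\<^esub> (n1, n2)"
        using sum[of "prod.swap v"] v by (cases v) auto
      then have "(p2, p1) \<in> ?T" "(n2, n1) \<in> ?N" "v = (p2, p1) \<oplus>\<^bsub>pair_module R\<^esub> (n2, n1)"
        by (force, force, cases v, simp)
      then show ?thesis by blast
    qed
    moreover have "?T \<inter> ?N \<subseteq> {(j \<otimes> b, j \<otimes> a) | j. j \<in> J}" using int by auto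
    moreover have "(b, a) \<in> ?T" "(t2, t1) \<in> ?T" using ab t by force+
    moreover have "?T \<noteq> carrier (pair_module R)"
    proof
      assume eq: "?T = carrier (pair_module R)"
      have "v \<in> T" if "v \<in> carrier (pair_module R)" for v
      proof -
        have "prod.swap v \<in> ?T" unfolding eq using that by auto
        then show ?thesis by (cases v) auto
      qed
      then show False using proper submodule_subset[OF T] by auto
    qed
    moreover have "t2 \<notin> J" using t True by simp
    ultimately show ?thesis
      using right_multiple_of_unit_coordinate[OF swap_submodule[OF T] swap_submodule[OF N]] by blast
  qed
qed

end

section \<open>The dual algebra is a domain with comparable right ideals\<close>

locale splitting_colocal_coalgebra = colocal_coalgebra scale \<Delta> \<epsilon>
  for scale :: "'k::field \<Rightarrow> 'c::ab_group_add \<Rightarrow> 'c"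
    and \<Delta> :: "'c \<Rightarrow> ('c \<times> 'c) list" and \<epsilon> :: "'c \<Rightarrow> 'k" +
  assumes infinite: infinite_dimensional and splitting: left_finite_Rat_splitting
begin

lemma not_finite_dim: "\<not> finite_dim scale UNIV"
  using infinite unfolding infinite_dimensional_def finite_dim_def by auto

lemma nonzero_functional_vanishing_on_finite:
  assumes "finite_dim scale V"
  obtains f where "functional scale f" "f \<noteq> (\<lambda>_. 0)" "\<And>v. v \<in> V \<Longrightarrow> f v = 0"
proof -
  obtain F where F: "finite F" "V \<subseteq> span F" using assms unfolding finite_dim_def by blast
  then obtain x where "x \<notin> span F" using not_finite_dim unfolding finite_dim_def by blast
  then obtain f where "functional scale f" "f x = 1" "\<And>y. y \<in> span F \<Longrightarrow> f y = 0"
    using separating_functional by blast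
  then show ?thesis using that[of f] F by (metis subsetD zero_neq_one)
qed

sublocale A: ring_with_nonunit_ideal dual_algebra J
proof (intro ring_with_nonunit_ideal.intro ring_with_nonunit_ideal_axioms.intro ring_dual_algebra)
  fix x assume "x \<in> carrier dual_algebra" "x \<notin> J"
  then obtain h where "functional scale h" "conv h x = \<epsilon>" "conv x h = \<epsilon>"
    using inverse_exists[of x] by auto
  then show "x \<in> Units dual_algebra" using \<open>x \<in> carrier dual_algebra\<close> by (auto simp: Units_def)
next
  show "\<zero>\<^bsub>dual_algebra\<^esub> \<in> J" by (simp add: J_def functional_const_zero)
qed (simp_all add: J_functional J_add J_conv_left J_conv_right counit_notin_J)

lemma conv_zero: "conv (\<lambda>_. 0) f = (\<lambda>_. 0)" "conv f (\<lambda>_. 0) = (\<lambda>_. 0)"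
  by (simp_all add: conv_def[abs_def] split_def)

text \<open>
  In \<open>A / J a\<close> the class of \<open>a\<close> is nonzero and killed by \<open>J\<close>, hence rational.  The rational part
  is a direct summand of this indecomposable module, so it is everything, and the class of the
  unit is killed by all functionals vanishing on a finite set \<open>S\<close>.  Those functionals lie in
  \<open>A a\<close> and therefore vanish on the kernel of \<open>lact a\<close>, which confines the kernel to the span of
  \<open>S\<close>.
\<close>

lemma lact_kernel_finite_dim:
  assumes a: "functional scale a" "a \<noteq> (\<lambda>_. 0)"
  shows "finite_dim scale {c. lact a c = 0}"
proof -
  let ?P = "pair_module dual_algebra"
  define L where "L = {conv j a | j. j \<in> J} \<times> carrier dual_algebra"
  have L: "submodule L dual_algebra ?P"
    using A.first_scaled_J_submodule[of a] a by (simp add: L_def)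
  obtain T N where T: "submodule T dual_algebra ?P" and N: "submodule N dual_algebra ?P"
    and int: "T \<inter> N \<subseteq> L" and LN: "L \<subseteq> N"
    and sum: "\<And>v. v \<in> carrier ?P \<Longrightarrow> \<exists>t\<in>T. \<exists>n\<in>N. v = t \<oplus>\<^bsub>?P\<^esub> n"
    and fin: "\<And>v. v \<in> T \<Longrightarrow> \<exists>S. finite S \<and>
       (\<forall>f. functional scale f \<longrightarrow> (\<forall>s\<in>S. f s = 0) \<longrightarrow> f \<odot>\<^bsub>?P\<^esub> v \<in> L)"
    and soc: "\<And>v. v \<in> carrier ?P \<Longrightarrow> (\<And>f. f \<in> J \<Longrightarrow> f \<odot>\<^bsub>?P\<^esub> v \<in> L) \<Longrightarrow> v \<in> T"
    by (rule splitting_of_pairs[OF splitting L]) blast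
  have zero_J: "(\<lambda>_. 0) \<in> J" using A.J_zero by simp
  then have zero_L: "((\<lambda>_. 0), y) \<in> L" if "functional scale y" for y
    using that conv_zero(1)[of a] by (force simp: L_def)
  have aT: "(a, \<lambda>_. 0) \<in> T"
  proof (rule soc)
    fix f assume "f \<in> J"
    then show "f \<odot>\<^bsub>?P\<^esub> (a, \<lambda>_. 0) \<in> L" by (auto simp: L_def conv_zero functional_const_zero)
  qed (use a functional_const_zero in simp)
  have second_T: "((\<lambda>_. 0), y) \<in> T" if "functional scale y" for y
  proof (rule soc)
    fix f assume "f \<in> J"
    then show "f \<odot>\<^bsub>?P\<^esub> (\<lambda>_. 0, y) \<in> L"
      using that zero_L[of "conv f y"] by (simp add: conv_zero conv_functional J_functional)
  qed (use that functional_const_zero in simp)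
  have "(\<epsilon>, \<lambda>_. 0) \<in> T"
    using A.cyclic_quotient_indecomposable[OF T N sum, of a] int LN zero_L second_T aT a
    unfolding L_def by auto
  then obtain S where S: "finite S"
    "\<And>f. functional scale f \<Longrightarrow> \<forall>s\<in>S. f s = 0 \<Longrightarrow> f \<odot>\<^bsub>?P\<^esub> (\<epsilon>, \<lambda>_. 0) \<in> L"
    using fin by blast
  have "c \<in> span S" if c: "lact a c = 0" for c
  proof (rule ccontr)
    assume "c \<notin> span S"
    then obtain f where f: "functional scale f" "f c = 1" "\<And>y. y \<in> span S \<Longrightarrow> f y = 0"
      using separating_functional by blast
    then have "f \<odot>\<^bsub>?P\<^esub> (\<epsilon>, \<lambda>_. 0) \<in> L" using S(2) span_base by blast
    then obtain j where j: "j \<in> J" "f = conv j a" using conv_counit[OF f(1)] by (auto simp: L_def)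
    then have "f c = j (lact a c)" using functional_lact[OF J_functional[OF j(1)]] by simp
    then show False using c f(2) functional_zero[OF J_functional[OF j(1)]] by simp
  qed
  then show ?thesis using S(1) unfolding finite_dim_def by blast
qed

text \<open>
  If both factors were nonzero, \<open>lact y\<close> would have finite-dimensional kernel, and its image would
  lie in the finite-dimensional kernel of \<open>lact x\<close>.
\<close>

lemma conv_eq_zero:
  assumes "functional scale x" "functional scale y" "conv x y = (\<lambda>_. 0)"
  shows "x = (\<lambda>_. 0) \<or> y = (\<lambda>_. 0)"
proof (rule ccontr)
  assume "\<not> ?thesis"
  then have fin: "finite_dim scale {c. lact x c = 0}" "finite_dim scale {c. lact y c = 0}"
    using lact_kernel_finite_dim assms by auto
  have "range (lact y) \<subseteq> {c. lact x c = 0}"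
    using lact_conv[OF assms(1,2)] assms(3) lact_zero by auto
  then have "finite_dim scale (range (lact y))" using fin(1) finite_dim_subset by blast
  then show False
    using finite_dim_of_kernel_image[OF lact_endo[OF assms(2)] fin(2)] not_finite_dim by blast
qed

lemma lact_surj:
  assumes a: "functional scale a" "a \<noteq> (\<lambda>_. 0)"
  shows "surj (lact a)"
proof (rule ccontr)
  assume "\<not> surj (lact a)"
  then obtain x where "x \<notin> range (lact a)" by blast
  then obtain f where f: "functional scale f" "f x = 1" "\<And>y. y \<in> range (lact a) \<Longrightarrow> f y = 0"
    using separating_functional_subspace[OF endo_image_subspace[OF lact_endo[OF a(1)] subspace_UNIV]] by blast
  have "conv f a c = 0" for c using f(3)[of "lact a c"] functional_lact[OF f(1), of a c] by simp
  then have "conv f a = (\<lambda>_. 0)" by (rule ext)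
  then show False using conv_eq_zero[OF f(1) a(1)] a(2) f(2) by auto
qed

lemma ract_surj:
  assumes a: "functional scale a" "a \<noteq> (\<lambda>_. 0)"
  shows "surj (ract a)"
proof (rule ccontr)
  assume "\<not> surj (ract a)"
  then obtain x where "x \<notin> range (ract a)" by blast
  then obtain f where f: "functional scale f" "f x = 1" "\<And>y. y \<in> range (ract a) \<Longrightarrow> f y = 0"
    using separating_functional_subspace[OF endo_image_subspace[OF ract_endo[OF a(1)] subspace_UNIV]] by blast
  have "conv a f c = 0" for c using f(3)[of "ract a c"] functional_ract[OF f(1), of a c] by simp
  then have "conv a f = (\<lambda>_. 0)" by (rule ext)
  then show False using conv_eq_zero[OF a(1) f(1)] a(2) f(2) by auto
qed

text \<open>
  The splitting of \<open>A\<^sup>2 / J (a, b)\<close>.  The class of \<open>(a, b)\<close> is killed by \<open>J\<close>, hence rational.  The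
  quotient is not rational: otherwise \<open>(f, 0)\<close> would lie in \<open>J (a, b)\<close> for some \<open>f \<noteq> 0\<close>, which is
  impossible in a domain.
\<close>

lemma right_comparable:
  assumes a: "functional scale a" "a \<noteq> (\<lambda>_. 0)" and b: "functional scale b" "b \<noteq> (\<lambda>_. 0)"
  shows "(\<exists>s. functional scale s \<and> b = conv a s) \<or> (\<exists>s. functional scale s \<and> a = conv b s)"
proof -
  let ?P = "pair_module dual_algebra"
  define L where "L = {(conv j a, conv j b) | j. j \<in> J}"
  have L: "submodule L dual_algebra ?P"
    using A.scaled_J_submodule[of a b] a b by (simp add: L_def)
  obtain T N where T: "submodule T dual_algebra ?P" and N: "submodule N dual_algebra ?P"
    and int: "T \<inter> N \<subseteq> L"
    and sum: "\<And>v. v \<in> carrier ?P \<Longrightarrow> \<exists>t\<in>T. \<exists>n\<in>N. v = t \<oplus>\<^bsub>?P\<^esub> n"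
    and fin: "\<And>v. v \<in> T \<Longrightarrow> \<exists>S. finite S \<and>
       (\<forall>f. functional scale f \<longrightarrow> (\<forall>s\<in>S. f s = 0) \<longrightarrow> f \<odot>\<^bsub>?P\<^esub> v \<in> L)"
    and soc: "\<And>v. v \<in> carrier ?P \<Longrightarrow> (\<And>f. f \<in> J \<Longrightarrow> f \<odot>\<^bsub>?P\<^esub> v \<in> L) \<Longrightarrow> v \<in> T"
    by (rule splitting_of_pairs[OF splitting L]) blast
  have ab: "(a, b) \<in> T"
    by (rule soc) (use a b in \<open>auto simp: L_def\<close>)
  have "T \<noteq> carrier ?P"
  proof
    assume "T = carrier ?P"
    then have "(\<epsilon>, \<lambda>_. 0) \<in> T" using counit_linear functional_const_zero by simp
    then obtain S where S: "finite S"
      "\<And>f. functional scale f \<Longrightarrow> \<forall>s\<in>S. f s = 0 \<Longrightarrow> f \<odot>\<^bsub>?P\<^esub> (\<epsilon>, \<lambda>_. 0) \<in> L"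
      using fin by blast
    have "finite_dim scale S" using S(1) span_superset unfolding finite_dim_def by blast
    then obtain f where f: "functional scale f" "f \<noteq> (\<lambda>_. 0)" "\<And>s. s \<in> S \<Longrightarrow> f s = 0"
      by (rule nonzero_functional_vanishing_on_finite) blast
    then have "f \<odot>\<^bsub>?P\<^esub> (\<epsilon>, \<lambda>_. 0) \<in> L" using S(2) by blast
    then obtain j where j: "j \<in> J" "f = conv j a" "conv j b = (\<lambda>_. 0)"
      using conv_counit[OF f(1)] by (auto simp: L_def conv_zero)
    then have "j = (\<lambda>_. 0)" using conv_eq_zero[OF J_functional[OF j(1)] b(1)] b(2) by blast
    then show False using j(2) f(2) conv_zero by simp
  qed
  then show ?thesis
    using A.right_comparable_of_splitting[OF T N sum, of a b] int ab a(2) unfolding L_def by auto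
qed

lemma lact_J_coradical:
  assumes "x \<in> J" "k \<in> coradical"
  shows "lact x k = 0"
proof (rule functionals_separate)
  fix h assume h: "functional scale h"
  then have "conv h x \<in> J" using J_conv_left assms by blast
  then show "h (lact x k) = h 0"
    using assms(2) functional_lact[OF h] functional_zero[OF h] by (simp add: J_def)
qed

text \<open>
  Choose a nonzero \<open>a\<close> in \<open>J\<close> for which the kernel of \<open>lact a\<close> has least dimension.  If some nonzero \<open>y\<close> in \<open>J\<close> were
  not a right multiple of \<open>a\<close>, then \<open>a = y r\<close> with \<open>r\<close> in \<open>J\<close>, and \<open>lact r\<close> would map the kernel of
  \<open>lact a\<close> onto that of \<open>lact y\<close> while killing the coradical, so the latter would be smaller.
\<close>

lemma J_right_principal:
  obtains a where "a \<in> J" "a \<noteq> (\<lambda>_. 0)" "\<And>y. y \<in> J \<Longrightarrow> \<exists>s. functional scale s \<and> y = conv a s"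
proof -
  let ?K = "\<lambda>a. {c. lact a c = 0}"
  obtain f where f: "functional scale f" "f \<noteq> (\<lambda>_. 0)" "\<And>c. c \<in> coradical \<Longrightarrow> f c = 0"
    by (rule nonzero_functional_vanishing_on_finite[OF coradical_finite_dim]) blast
  then have "f \<in> J \<and> f \<noteq> (\<lambda>_. 0)" by (simp add: J_def)
  then obtain a where a: "a \<in> J" "a \<noteq> (\<lambda>_. 0)"
    and min: "\<And>y. y \<in> J \<Longrightarrow> y \<noteq> (\<lambda>_. 0) \<Longrightarrow> dim (?K a) \<le> dim (?K y)"
    using ex_has_least_nat[of "\<lambda>a. a \<in> J \<and> a \<noteq> (\<lambda>_. 0)" f "\<lambda>a. dim (?K a)"] by blast
  have af: "functional scale a" using a by (simp add: J_functional)
  have "\<exists>s. functional scale s \<and> y = conv a s" if y: "y \<in> J" for y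
  proof (cases "y = (\<lambda>_. 0)")
    case True
    then show ?thesis using conv_zero functional_const_zero by metis
  next
    case False
    have yf: "functional scale y" using y by (rule J_functional)
    consider s where "functional scale s" "y = conv a s" | r where "functional scale r" "a = conv y r"
      using right_comparable[OF af a(2) yf False] by blast
    then show ?thesis
    proof cases
      case 1
      then show ?thesis by blast
    next
      case r: 2
      have "r \<notin> J"
      proof
        assume rJ: "r \<in> J"
        obtain k where k: "k \<in> coradical" "k \<noteq> 0"
          using coradical_nonzero coradical_stable subspace_0 by (auto simp: ract_stable_def)
        have r0: "r \<noteq> (\<lambda>_. 0)" using r a(2) conv_zero by metis
        have "?K y \<subseteq> lact r ` ?K a"
        proof
          fix w assume w: "w \<in> ?K y"
          obtain v where v: "w = lact r v" using lact_surj[OF r(1) r0] by (metis surjD)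
          then have "v \<in> ?K a" using w lact_conv[OF yf r(1)] r(2) by simp
          then show "w \<in> lact r ` ?K a" using v by blast
        qed
        then have "dim (?K y) < dim (?K a)"
          using lact_J_coradical a rJ k lact_kernel_finite_dim[OF af a(2)] endo_kernel_subspace[OF lact_endo[OF af]]
          by (intro dim_less_of_endo_with_kernel[OF lact_endo[OF r(1)], of _ k]) auto
        then show False using min[OF y False] by simp
      qed
      then obtain h where h: "functional scale h" "conv r h = \<epsilon>" by (rule inverse_exists[OF r(1)])
      then have "conv a h = y" using r yf conv_assoc[OF yf r(1) h(1)] conv_counit[OF yf] by simp
      then show ?thesis using h by blast
    qed
  qed
  then show ?thesis using that a by blast
qed

section \<open>Exchanging left and right\<close>

lemma ract_kernel_of_generator:
  assumes a: "a \<in> J" and gen: "\<And>y. y \<in> J \<Longrightarrow> \<exists>s. functional scale s \<and> y = conv a s"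
  shows "ract a c = 0 \<longleftrightarrow> c \<in> coradical"
proof
  assume c: "c \<in> coradical"
  show "ract a c = 0"
  proof (rule functionals_separate)
    fix h assume h: "functional scale h"
    then have "conv a h \<in> J" using J_conv_right a by blast
    then show "h (ract a c) = h 0"
      using c functional_ract[OF h] functional_zero[OF h] by (simp add: J_def)
  qed
next
  assume c: "ract a c = 0"
  show "c \<in> coradical"
  proof (rule ccontr)
    assume "c \<notin> coradical"
    then obtain f where f: "functional scale f" "f c = 1" "\<And>y. y \<in> coradical \<Longrightarrow> f y = 0"
      using separating_functional_subspace coradical_stable unfolding ract_stable_def by blast
    then have "f \<in> J" by (simp add: J_def)
    then obtain s where s: "functional scale s" "f = conv a s" using gen by blast
    then show False using c f(2) functional_ract[OF s(1), of a c] functional_zero[OF s(1)] by simp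
  qed
qed

text \<open>
  The passage from \<open>J = a A\<close> to \<open>J = A a\<close>.  The kernel of \<open>ract a\<close> is the coradical, which \<open>lact a\<close>
  kills, so there is a linear map \<open>\<Phi>\<close> with \<open>\<Phi> (ract a x) = lact a x\<close>.  Dually \<open>x \<circ> \<Phi>\<close> is the element
  \<open>z\<close> with \<open>x a = a z\<close>, and \<open>z\<close> is in \<open>J\<close> only if \<open>x\<close> is; this makes \<open>\<Phi>\<close> map the coradical onto a
  space containing it.  The coradical being finite-dimensional, \<open>\<Phi>\<close> is injective on it.
  The kernel of \<open>\<Phi>\<close> is stable under the locally nilpotent map \<open>ract a\<close>, and a nonzero vector in
  it would produce a nonzero vector in the coradical killed by \<open>\<Phi>\<close>.  So \<open>\<Phi>\<close> is injective, and
  \<open>lact a c = 0\<close> forces \<open>ract a c = 0\<close>.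
\<close>

lemma lact_kernel_of_generator:
  assumes a: "a \<in> J" "a \<noteq> (\<lambda>_. 0)"
    and gen: "\<And>y. y \<in> J \<Longrightarrow> \<exists>s. functional scale s \<and> y = conv a s"
    and c: "lact a c = 0"
  shows "c \<in> coradical"
proof -
  have af: "functional scale a" using a by (simp add: J_functional)
  have sub: "subspace coradical" using coradical_stable by (simp add: ract_stable_def)
  note ker = ract_kernel_of_generator[OF a(1) gen]
  interpret vector_space_pair scale scale ..
  obtain r where r: "endo scale r" "ract a \<circ> r = id"
    using linear_surjective_right_inverse[OF ract_endo[OF af] ract_surj[OF af a(2)]] by blast
  define \<Phi> where "\<Phi> x = lact a (r x)" for x
  have endo: "endo scale \<Phi>"
    using r(1) lact_endo[OF af] by (simp add: endo_iff \<Phi>_def)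
  have \<Phi>: "\<Phi> (ract a x) = lact a x" for x
  proof -
    have "ract a (r (ract a x) - x) = 0"
      using r(2) endo_diff[OF ract_endo[OF af]] by (simp add: fun_eq_iff)
    then have "lact a (r (ract a x) - x) = 0" using ker lact_J_coradical[OF a(1)] by blast
    then show ?thesis using endo_diff[OF lact_endo[OF af]] by (simp add: \<Phi>_def)
  qed
  have onto: "coradical \<subseteq> \<Phi> ` coradical"
  proof (rule ccontr)
    assume "\<not> ?thesis"
    then obtain k where k: "k \<in> coradical" "k \<notin> \<Phi> ` coradical" by blast
    obtain x where x: "functional scale x" "x k = 1" "\<And>y. y \<in> \<Phi> ` coradical \<Longrightarrow> x y = 0"
      using separating_functional_subspace[OF endo_image_subspace[OF endo sub] k(2)] by blast
    have xJ: "x \<notin> J"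
    proof
      assume "x \<in> J"
      then have "x k = 0" using k(1) by (simp add: J_def)
      then show False using x(2) by simp
    qed
    define z where "z y = x (\<Phi> y)" for y
    have z: "functional scale z" unfolding z_def[abs_def] by (rule functional_compose[OF x(1) endo])
    have zJ: "z \<in> J" using z x(3) by (auto simp: J_def z_def)
    have eq: "conv x a = conv a z"
      using functional_lact[OF x(1), of a] functional_ract[OF z, of a] \<Phi> by (auto simp: z_def)
    obtain h where h: "functional scale h" "conv h x = \<epsilon>" by (rule inverse_exists[OF x(1) xJ])
    \<comment> \<open>If \<open>x\<close> is a unit, \<open>x a = a z\<close> gives \<open>a = a j\<close> with \<open>j = u z\<close> in \<open>J\<close>, so \<open>ract a\<close> is zero.\<close>
    obtain u where u: "functional scale u" "conv h a = conv a u"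
      using gen[OF J_conv_left[OF a(1) h(1)]] by blast
    have "conv h (conv x a) = a"
      using conv_assoc[OF h(1) x(1) af] h(2) conv_counit[OF af] by simp
    moreover have "conv h (conv a z) = conv a (conv u z)"
      using conv_assoc h(1) af z u by metis
    ultimately have aj: "a = conv a (conv u z)" using eq by simp
    have uz: "conv u z \<in> J" using J_conv_left[OF zJ u(1)] .
    have "ract (conv u z) (ract a y) = ract a y" for y
      using aj ract_conv[OF af J_functional[OF uz], of y] by metis
    then have "ract a y = 0" for y using ract_fixed_by_J[OF uz] by blast
    then show False using ker coradical_finite_dim not_finite_dim by (metis UNIV_eq_I)
  qed
  have inj: "k = 0" if k: "k \<in> coradical" "\<Phi> k = 0" for k
    using dim_less_of_endo_with_kernel[OF endo sub coradical_finite_dim k(1) _ k(2) onto] by auto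
  define e where "e = ract a c"
  have "\<Phi> ((ract a ^^ n) e) = 0" for n
  proof (induction n)
    case 0
    then show ?case using \<Phi> c by (simp add: e_def)
  next
    case (Suc n)
    obtain d where d: "(ract a ^^ n) e = ract a d" using ract_surj[OF af a(2)] by (metis surjD)
    have "\<Phi> (ract a (ract a d)) = ract a (\<Phi> (ract a d))" by (simp add: \<Phi> lact_ract[OF af af])
    also have "\<dots> = 0" using Suc d endo_zero[OF ract_endo[OF af]] by simp
    finally show ?case using d by simp
  qed
  then have step: "(ract a ^^ n) e = 0" if "(ract a ^^ Suc n) e = 0" for n
    using that ker inj by simp
  obtain n where "(ract a ^^ n) e = 0" by (rule ract_locally_nilpotent[OF a(1)])
  then have "e = 0" using step by (induction n) auto
  then show ?thesis using ker by (simp add: e_def)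
qed

section \<open>The left ideals form a chain\<close>

definition conv_power :: "('c \<Rightarrow> 'k) \<Rightarrow> nat \<Rightarrow> 'c \<Rightarrow> 'k" where
  "conv_power a n = (conv a ^^ n) \<epsilon>"

lemma conv_power_simps [simp]:
  "conv_power a 0 = \<epsilon>" "conv_power a (Suc n) = conv a (conv_power a n)"
  by (simp_all add: conv_power_def)

lemma conv_power_functional: "functional scale a \<Longrightarrow> functional scale (conv_power a n)"
  by (induction n) (simp_all add: counit_linear conv_functional)

lemma conv_power_add:
  assumes "functional scale a"
  shows "conv_power a (m + n) = conv (conv_power a m) (conv_power a n)"
  using assms by (induction m) (simp_all add: conv_counit conv_power_functional conv_assoc)

lemma ract_conv_power:
  assumes "functional scale a"
  shows "ract (conv_power a n) c = (ract a ^^ n) c"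
  by (induction n arbitrary: c)
    (simp_all add: ract_counit ract_conv assms conv_power_functional funpow_swap1)

text \<open>
  As \<open>J = A a\<close>, a nonzero \<open>y\<close> without such a factorization would be a left multiple of every power
  of \<open>a\<close>.  Since \<open>A a\<close> is contained in \<open>a A\<close>, it would be a right multiple of every power too,
  and then local nilpotency of \<open>ract a\<close> makes it vanish on each vector.
\<close>

lemma unit_times_power:
  obtains a where "functional scale a"
    "\<And>y. functional scale y \<Longrightarrow> y \<noteq> (\<lambda>_. 0) \<Longrightarrow>
       \<exists>u n. functional scale u \<and> u \<notin> J \<and> y = conv u (conv_power a n)"
proof -
  obtain a where a: "a \<in> J" "a \<noteq> (\<lambda>_. 0)"
    and gen: "\<And>y. y \<in> J \<Longrightarrow> \<exists>s. functional scale s \<and> y = conv a s"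
    using J_right_principal by blast
  have af: "functional scale a" using a by (simp add: J_functional)
  have left_gen: "\<exists>x. functional scale x \<and> y = conv x a" if y: "y \<in> J" for y
  proof -
    have "y c = 0" if "lact a c = 0" for c
      using lact_kernel_of_generator[OF a gen that] y by (simp add: J_def)
    then obtain h where h: "functional scale h" "\<And>c. h (lact a c) = y c"
      using functional_factors[OF lact_endo[OF af] J_functional[OF y]] by blast
    then have "y = conv h a" using functional_lact[OF h(1)] by auto
    then show ?thesis using h(1) by blast
  qed
  have move: "\<exists>s. functional scale s \<and> conv x (conv_power a n) = conv (conv_power a n) s"
    if "functional scale x" for x n
    using that
  proof (induction n arbitrary: x)
    case 0
    then show ?case using conv_counit by auto
  next
    case (Suc n)
    obtain s where s: "functional scale s" "conv x a = conv a s"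
      using gen[OF J_conv_left[OF a(1) Suc.prems]] by blast
    obtain s' where s': "functional scale s'" "conv s (conv_power a n) = conv (conv_power a n) s'"
      using Suc.IH[OF s(1)] by blast
    have p: "functional scale (conv_power a n)" by (rule conv_power_functional[OF af])
    have "conv x (conv_power a (Suc n)) = conv (conv x a) (conv_power a n)"
      using conv_assoc[OF Suc.prems af p] by simp
    also have "\<dots> = conv a (conv (conv_power a n) s')"
      using s conv_assoc[OF af s(1) p] s'(2) by simp
    also have "\<dots> = conv (conv_power a (Suc n)) s'" using conv_assoc[OF af p s'(1)] by simp
    finally show ?case using s'(1) by blast
  qed
  have "\<exists>u n. functional scale u \<and> u \<notin> J \<and> y = conv u (conv_power a n)"
    if y: "functional scale y" "y \<noteq> (\<lambda>_. 0)" for y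
  proof (rule ccontr)
    assume no: "\<not> ?thesis"
    have mult: "\<exists>x. functional scale x \<and> y = conv x (conv_power a n)" for n
    proof (induction n)
      case 0
      then show ?case using conv_counit[OF y(1)] y(1) by auto
    next
      case (Suc n)
      then obtain x where x: "functional scale x" "y = conv x (conv_power a n)" by blast
      then have "x \<in> J" using no by blast
      then obtain x' where x': "functional scale x'" "x = conv x' a" using left_gen by blast
      then have "y = conv x' (conv_power a (Suc n))"
        using x conv_assoc[OF x'(1) af conv_power_functional[OF af]] by simp
      then show ?case using x'(1) by blast
    qed
    have "y c = 0" for c
    proof -
      obtain n where n: "(ract a ^^ n) c = 0" by (rule ract_locally_nilpotent[OF a(1)])
      obtain x where x: "functional scale x" "y = conv x (conv_power a n)" using mult by blast
      then obtain s where s: "functional scale s" "y = conv (conv_power a n) s" using move by metis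
      then have "y c = s ((ract a ^^ n) c)"
        using functional_ract[OF s(1), of "conv_power a n" c] ract_conv_power[OF af] by simp
      then show ?thesis using n functional_zero[OF s(1)] by simp
    qed
    then show False using y(2) by auto
  qed
  then show ?thesis using that af by blast
qed

text \<open>
  A subspace is determined by the functionals vanishing on it, and these form a left ideal when
  it is a left subcomodule.  A functional vanishing on \<open>V\<close> but not on \<open>W\<close> is a unit times a power
  of \<open>a\<close>, and that power vanishes on \<open>V\<close> but not on \<open>W\<close> as well.  Of two powers one is a left
  multiple of the other, so \<open>V\<close> and \<open>W\<close> cannot be separated in both directions.
\<close>

lemma left_subcomodules_comparable: chain_coalgebra
  unfolding chain_coalgebra_def left_subcomodule_iff
proof (intro allI impI, rule ccontr)
  fix Y Z assume stable: "ract_stable Y \<and> ract_stable Z" and "\<not> (Y \<subseteq> Z \<or> Z \<subseteq> Y)"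
  then obtain y z where yz: "y \<in> Y" "y \<notin> Z" "z \<in> Z" "z \<notin> Y" by blast
  obtain a where a: "functional scale a"
    and factor: "\<And>y. functional scale y \<Longrightarrow> y \<noteq> (\<lambda>_. 0) \<Longrightarrow>
       \<exists>u n. functional scale u \<and> u \<notin> J \<and> y = conv u (conv_power a n)"
    using unit_times_power by blast
  have p: "functional scale (conv_power a n)" for n by (rule conv_power_functional[OF a])
  define perp where "perp V = {f. functional scale f \<and> (\<forall>v\<in>V. f v = 0)}" for V
  have ideal: "conv h f \<in> perp V" if "ract_stable V" "f \<in> perp V" "functional scale h" for V f h
    using that functional_ract[of f h] by (auto simp: perp_def conv_functional ract_stable_def) metis
  have power: "\<exists>n. conv_power a n \<in> perp V \<and> conv_power a n \<notin> perp W"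
    if V: "ract_stable V" and W: "ract_stable W" and w: "w \<in> W" "w \<notin> V" for V W w
  proof -
    have "subspace V" using V by (simp add: ract_stable_def)
    then obtain f where f: "functional scale f" "f w = 1" "\<And>v. v \<in> V \<Longrightarrow> f v = 0"
      using separating_functional_subspace w(2) by blast
    then have "f \<noteq> (\<lambda>_. 0)" by auto
    then obtain u n where u: "functional scale u" "u \<notin> J" "f = conv u (conv_power a n)"
      using factor[OF f(1)] by blast
    obtain h where h: "functional scale h" "conv h u = \<epsilon>" by (rule inverse_exists[OF u(1,2)])
    have "conv h f = conv_power a n"
      using conv_assoc[OF h(1) u(1) p] h(2) u(3) conv_counit[OF p] by simp
    then have "conv_power a n \<in> perp V" using ideal[OF V _ h(1), of f] f by (simp add: perp_def)
    moreover have "conv_power a n \<notin> perp W"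
    proof
      assume "conv_power a n \<in> perp W"
      then have "f \<in> perp W" using ideal[OF W _ u(1)] u(3) by simp
      then have "f w = 0" using w(1) by (simp add: perp_def)
      then show False using f(2) by simp
    qed
    ultimately show ?thesis by blast
  qed
  obtain n where n: "conv_power a n \<in> perp Z" "conv_power a n \<notin> perp Y"
    using power[of Z Y y] stable yz by blast
  obtain m where m: "conv_power a m \<in> perp Y" "conv_power a m \<notin> perp Z"
    using power[of Y Z z] stable yz by blast
  show False
  proof (cases "n \<le> m")
    case True
    then have "conv_power a m = conv (conv_power a (m - n)) (conv_power a n)"
      using conv_power_add[OF a, of "m - n" n] by simp
    then show False using ideal[of Z "conv_power a n"] stable n(1) m(2) p by simp
  next
    case False
    then have "conv_power a n = conv (conv_power a (n - m)) (conv_power a m)"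
      using conv_power_add[OF a, of "n - m" m] by simp
    then show False using ideal[of Y "conv_power a m"] stable m(1) n(2) p by simp
  qed
qed

end

theorem theorem3p4:
  fixes scale :: "'k::field \<Rightarrow> 'c::ab_group_add \<Rightarrow> 'c"
    and \<Delta> :: "'c \<Rightarrow> ('c \<times> 'c) list"
    and \<epsilon> :: "'c \<Rightarrow> 'k"
  assumes "coalgebra scale \<Delta> \<epsilon>"
    and "coalgebra.infinite_dimensional scale"
    and "coalgebra.colocal scale \<Delta>"
    and "coalgebra.left_finite_Rat_splitting scale \<Delta> \<epsilon>"
  shows "coalgebra.chain_coalgebra scale \<Delta>"
proof -
  interpret coalgebra scale \<Delta> \<epsilon> by fact
  interpret splitting_colocal_coalgebra scale \<Delta> \<epsilon>
    using assms by unfold_locales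
  show ?thesis by (rule left_subcomodules_comparable)
qed

end
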